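(* (1) A semi-simplicial space $X$ is a quasi-unital inner Kan space if and only if the marked semi-simplicial space $X^{\natural}$ (that is, $X$ with all equivalences marked) is a marked inner Kan space. (2) Let $X$ and $Y$ be quasi-unital inner Kan spaces. A map $F\colon X\to Y$ of semi-simplicial spaces is quasi-unital if and only if it lifts to a map $F^{\natural}\colon X^{\natural}\to Y^{\natural}$ of marked semi-simplicial spaces.
   Context: Let $\mathcal{S}$ be the $\infty$-category of spaces, $\Delta_s$ the category of the ordered sets $[n]$, $n\ge 0$, and injective order-preserving maps, and $ss\mathcal{S}=\mathrm{Fun}(\Delta_s^{op},\mathcal{S})$ the $\infty$-category of semi-simplicial spaces. Write $X_n=X([n])$; $\Delta^n_s$ is the representable semi-simplicial set, and $\Lambda^n_{i,s}\subset\Delta^n_s$ ($n\ge1$, $0\le i\le n$) is the horn, i.e. the union of all codimension-one faces containing the vertex $i$ (so $\Lambda^1_{0,s}=\{0\}$, $\Lambda^1_{1,s}=\{1\}$). $T$ is the terminal semi-simplicial space, $T_n=\ast$. We write $a\sim b$ if two points lie in the same connected component. In an $\infty$-category, a map $f\colon X\to Y$ has the right lifting property (RLP) with respect to $j\colon A\to B$ if $\mathrm{Map}(B,X)\to \mathrm{Map}(A,X)\times_{\mathrm{Map}(A,Y)}\mathrm{Map}(B,Y)$ is surjective on $\pi_0$. A semi-simplicial space $X$ is an inner Kan space if $X\to T$ has the RLP with respect to $\Lambda^n_{i,s}\to\Delta^n_s$ for all $0<i<n$. An edge $f\in X_1$ is an equivalence if for all $n\geq 2$ every map $\Lambda^n_{0,s}\to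 X$ whose edge $\{0,1\}$ is homotopic to $f$ (in the same component of $X_1$), and every map $\Lambda^n_{n,s}\to X$ whose edge $\{n-1,n\}$ is homotopic to $f$, extends up to homotopy to $\Delta^n_s$. An edge $f$ is idempotent if $d_0f\sim d_1f$ in $X_0$ and there is $H\in X_2$ with $d_iH\sim f$ for $i=0,1,2$; it is an idempotent at $x\in X_0$ if moreover its endpoints are homotopic to $x$. An idempotent equivalence is an edge that is both idempotent and an equivalence. An inner Kan space $X$ is quasi-unital if every $x\in X_0$ admits an idempotent equivalence at $x$. A map of semi-simplicial spaces is quasi-unital if it takes idempotent equivalences to idempotent equivalences. A marked semi-simplicial space is a pair $(X,A)$ with $X\in ss\mathcal{S}$ and $A\to X_1$ a monomorphism of spaces (an inclusion of connected components); a map $(X,A)\to(Y,B)$ is a map $X\to Y$ such that $A\to X_1\to Y_1$ factors through $B$. They form the $\infty$-category $ss\mathcal{S}_+$. Put $X^{\sharp}=(X,X_1)$; $T^\sharp$ is terminal in $ss\mathcal{S}_+$. $X^{\natural}$ is $X$ with marking the subspace of equivalences in $X_1$. Let $J_{JL}$ be the collection of the following maps of marked semi-simplicial sets: (a) the admissible horn inclusions $(\Lambda^n_{i,s},A)\to(\Delta^n_s,B)$, $n\ge1$, $A=B\cap(\Lambda^n_{i,s})_1$, where either $B=\emptyset$ and $0<i<n$; or $B=\{\{0,1\}\}$ and $i=0$; or $B=\{\{n-1,n\}\}$ and $i=n$; (b) the map $S_{2/6}\colon(\Delta^3_s,\{\{0,2\},\{1,3\}\})\to\Delta^{3,\sharp}_s$.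 A marked semi-simplicial space $Z$ is a marked inner Kan space if $Z\to T^{\sharp}$ has the RLP with respect to every map in $J_{JL}$. *)

theory Defs
  imports Main
begin

text \<open>
  The \<open>\<infinity>\<close>-category of semi-simplicial spaces is presented by the Reedy (equivalently, injective)
  model structure on functors from \<open>\<Delta>\<^sub>s\<^sup>o\<^sup>p\<close> to simplicial sets.  All objects of this model
  structure are cofibrant, so the \<open>\<infinity>\<close>-category has the Reedy fibrant functors as objects, every
  map between two of them is represented by a strict natural transformation, and strict mapping
  spaces into them are the mapping spaces of the \<open>\<infinity>\<close>-category.  A space is a Kan complex, and
  a point of a space is a 0-simplex.
\<close>

section \<open>Simplicial and semi-simplicial sets\<close>

text \<open>
  A monotone map from \<open>[m]\<close> to \<open>[n]\<close> is encoded as the list of its \<open>m + 1\<close> values.  The list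
  does not determine \<open>n\<close>, so actions of monotone maps also take the codomain \<open>n\<close> as an argument.
\<close>

definition delta :: "nat \<Rightarrow> nat \<Rightarrow> nat list set" where
  "delta m n = {\<alpha>. length \<alpha> = Suc m \<and> sorted \<alpha> \<and> set \<alpha> \<subseteq> {..n}}"

definition delta_s :: "nat \<Rightarrow> nat \<Rightarrow> nat list set" where
  "delta_s m n = {\<alpha> \<in> delta m n. distinct \<alpha>}"

definition ident :: "nat \<Rightarrow> nat list" where
  "ident n = [0..<Suc n]"

definition comp_op :: "nat list \<Rightarrow> nat list \<Rightarrow> nat list" where
  "comp_op \<beta> \<alpha> = map (\<lambda>i. \<beta> ! i) \<alpha>"

text \<open>The injective map from \<open>[n - 1]\<close> to \<open>[n]\<close> that omits \<open>i\<close>.\<close>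

definition coface :: "nat \<Rightarrow> nat \<Rightarrow> nat list" where
  "coface n i = filter (\<lambda>j. j \<noteq> i) [0..<Suc n]"

text \<open>\<open>act X n \<alpha> x\<close> is \<open>\<alpha>\<^sup>* x\<close> for \<open>x\<close> in \<open>X\<^sub>n\<close> and \<open>\<alpha>\<close> a map with codomain \<open>[n]\<close>.\<close>

record 'a presheaf =
  cells :: "nat \<Rightarrow> 'a set"
  act :: "nat \<Rightarrow> nat list \<Rightarrow> 'a \<Rightarrow> 'a"

definition presheaf_on :: "(nat \<Rightarrow> nat \<Rightarrow> nat list set) \<Rightarrow> 'a presheaf \<Rightarrow> bool" where
  "presheaf_on D X \<longleftrightarrow>
     (\<forall>m n. \<forall>\<alpha> \<in> D m n. \<forall>x \<in> cells X n. act X n \<alpha> x \<in> cells X m) \<and>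
     (\<forall>n. \<forall>x \<in> cells X n. act X n (ident n) x = x) \<and>
     (\<forall>l m n. \<forall>\<alpha> \<in> D l m. \<forall>\<beta> \<in> D m n. \<forall>x \<in> cells X n.
        act X m \<alpha> (act X n \<beta> x) = act X n (comp_op \<beta> \<alpha>) x)"

abbreviation simplicial_set :: "'a presheaf \<Rightarrow> bool" where
  "simplicial_set \<equiv> presheaf_on delta"

definition simplicial_map ::
  "'a presheaf \<Rightarrow> 'b presheaf \<Rightarrow> (nat \<Rightarrow> 'a \<Rightarrow> 'b) \<Rightarrow> bool" where
  "simplicial_map X Y f \<longleftrightarrow>
     (\<forall>n. \<forall>x \<in> cells X n. f n x \<in> cells Y n) \<and>
     (\<forall>m n. \<forall>\<alpha> \<in> delta m n. \<forall>x \<in> cells X n. f m (act X n \<alpha> x) = act Y n \<alpha> (f n x))"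

definition kan_fibration ::
  "'a presheaf \<Rightarrow> 'b presheaf \<Rightarrow> (nat \<Rightarrow> 'a \<Rightarrow> 'b) \<Rightarrow> bool" where
  "kan_fibration X Y p \<longleftrightarrow> simplicial_map X Y p \<and>
     (\<forall>n i x. \<forall>y \<in> cells Y n. 1 \<le> n \<longrightarrow> i \<le> n \<longrightarrow>
        (\<forall>j. j \<le> n \<longrightarrow> j \<noteq> i \<longrightarrow>
           x j \<in> cells X (n - 1) \<and> p (n - 1) (x j) = act Y n (coface n j) y) \<longrightarrow>
        (\<forall>j k. j < k \<longrightarrow> k \<le> n \<longrightarrow> j \<noteq> i \<longrightarrow> k \<noteq> i \<longrightarrow>
           act X (n - 1) (coface (n - 1) j) (x k) = act X (n - 1) (coface (n - 1) (k - 1)) (x j)) \<longrightarrow>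
        (\<exists>z \<in> cells X n. p n z = y \<and> (\<forall>j. j \<le> n \<longrightarrow> j \<noteq> i \<longrightarrow> act X n (coface n j) z = x j)))"

text \<open>The relation \<open>a \<sim> b\<close>: two points of \<open>P\<close> lie in the same connected component.\<close>

definition same_component :: "'a presheaf \<Rightarrow> 'a \<Rightarrow> 'a \<Rightarrow> bool" where
  "same_component P a b \<longleftrightarrow> a \<in> cells P 0 \<and> b \<in> cells P 0 \<and>
     equivclp (\<lambda>u v. \<exists>e \<in> cells P 1. act P 1 [0] e = u \<and> act P 1 [1] e = v) a b"

definition pi0_surjective ::
  "'a presheaf \<Rightarrow> 'b presheaf \<Rightarrow> (nat \<Rightarrow> 'a \<Rightarrow> 'b) \<Rightarrow> bool" where
  "pi0_surjective P Q f \<longleftrightarrow> (\<forall>b \<in> cells Q 0. \<exists>a \<in> cells P 0. same_component Q (f 0 a) b)"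

definition fibre_product ::
  "'a presheaf \<Rightarrow> 'b presheaf \<Rightarrow> (nat \<Rightarrow> 'a \<Rightarrow> 'c) \<Rightarrow> (nat \<Rightarrow> 'b \<Rightarrow> 'c) \<Rightarrow> ('a \<times> 'b) presheaf" where
  "fibre_product P R p r =
     \<lparr>cells = (\<lambda>k. {(a, b). a \<in> cells P k \<and> b \<in> cells R k \<and> p k a = r k b}),
      act = (\<lambda>k \<theta> (a, b). (act P k \<theta> a, act R k \<theta> b))\<rparr>"

definition simplex :: "nat \<Rightarrow> nat list presheaf" where
  "simplex n = \<lparr>cells = (\<lambda>m. delta_s m n), act = (\<lambda>_ \<alpha> s. comp_op s \<alpha>)\<rparr>"

definition boundary :: "nat \<Rightarrow> nat list presheaf" where
  "boundary n = (simplex n)\<lparr>cells := (\<lambda>m. {s \<in> delta_s m n. \<exists>j \<le> n. j \<notin> set s})\<rparr>"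

definition horn :: "nat \<Rightarrow> nat \<Rightarrow> nat list presheaf" where
  "horn n i = (simplex n)\<lparr>cells := (\<lambda>m. {s \<in> delta_s m n. \<exists>j \<le> n. j \<noteq> i \<and> j \<notin> set s})\<rparr>"

section \<open>Semi-simplicial spaces\<close>

text \<open>\<open>pull X n \<alpha>\<close> is the simplicial map \<open>\<alpha>\<^sup>*\<close> out of \<open>X\<^sub>n = space_at X n\<close>.\<close>

record 'a ssspace =
  space_at :: "nat \<Rightarrow> 'a presheaf"
  pull :: "nat \<Rightarrow> nat list \<Rightarrow> nat \<Rightarrow> 'a \<Rightarrow> 'a"

definition ss_functor :: "'a ssspace \<Rightarrow> bool" where
  "ss_functor X \<longleftrightarrow>
     (\<forall>n. simplicial_set (space_at X n)) \<and>
     (\<forall>m n. \<forall>\<alpha> \<in> delta_s m n. simplicial_map (space_at X n) (space_at X m) (pull X n \<alpha>)) \<and>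
     (\<forall>n k. \<forall>x \<in> cells (space_at X n) k. pull X n (ident n) k x = x) \<and>
     (\<forall>l m n k. \<forall>\<alpha> \<in> delta_s l m. \<forall>\<beta> \<in> delta_s m n. \<forall>x \<in> cells (space_at X n) k.
        pull X m \<alpha> k (pull X n \<beta> k x) = pull X n (comp_op \<beta> \<alpha>) k x)"

text \<open>
  The space of maps from a semi-simplicial set \<open>A\<close>, regarded as a levelwise discrete semi-simplicial
  space: a \<open>k\<close>-simplex is a map from \<open>A \<times> \<Delta>\<^sup>k\<close> to \<open>X\<close>, that is, a map from \<open>A\<close> to the
  semi-simplicial set of \<open>k\<close>-simplices of \<open>X\<close>.
\<close>

definition map_space :: "'s presheaf \<Rightarrow> 'a ssspace \<Rightarrow> (nat \<Rightarrow> 's \<Rightarrow> 'a) presheaf" where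
  "map_space A X =
     \<lparr>cells = (\<lambda>k. {g.
        (\<forall>m. \<forall>s \<in> cells A m. g m s \<in> cells (space_at X m) k) \<and>
        (\<forall>m s. s \<notin> cells A m \<longrightarrow> g m s = undefined) \<and>
        (\<forall>l m. \<forall>\<alpha> \<in> delta_s l m. \<forall>s \<in> cells A m. g l (act A m \<alpha> s) = pull X m \<alpha> k (g m s))}),
      act = (\<lambda>k \<theta> g m s. if s \<in> cells A m then act (space_at X m) k \<theta> (g m s) else undefined)\<rparr>"

definition restrict_map :: "'s presheaf \<Rightarrow> (nat \<Rightarrow> 's \<Rightarrow> 'a) \<Rightarrow> nat \<Rightarrow> 's \<Rightarrow> 'a" where
  "restrict_map A g = (\<lambda>m s. if s \<in> cells A m then g m s else undefined)"

definition post_compose ::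
  "'s presheaf \<Rightarrow> (nat \<Rightarrow> nat \<Rightarrow> 'a \<Rightarrow> 'b) \<Rightarrow> nat \<Rightarrow> (nat \<Rightarrow> 's \<Rightarrow> 'a) \<Rightarrow> nat \<Rightarrow> 's \<Rightarrow> 'b" where
  "post_compose A F k g = (\<lambda>m s. if s \<in> cells A m then F m k (g m s) else undefined)"

definition matching_map :: "'a ssspace \<Rightarrow> nat \<Rightarrow> nat \<Rightarrow> 'a \<Rightarrow> nat \<Rightarrow> nat list \<Rightarrow> 'a" where
  "matching_map X n k x = (\<lambda>m s. if s \<in> cells (boundary n) m then pull X n s k x else undefined)"

text \<open>Reedy fibrancy; the matching object is \<open>Map(\<partial>\<Delta>\<^sup>n\<^sub>s, X)\<close>.\<close>

definition semisimplicial_space :: "'a ssspace \<Rightarrow> bool" where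
  "semisimplicial_space X \<longleftrightarrow> ss_functor X \<and>
     (\<forall>n. kan_fibration (space_at X n) (map_space (boundary n) X) (matching_map X n))"

text \<open>\<open>F n k\<close> is the map from the \<open>k\<close>-simplices of \<open>X\<^sub>n\<close> to those of \<open>Y\<^sub>n\<close>.\<close>

definition ss_map :: "'a ssspace \<Rightarrow> 'b ssspace \<Rightarrow> (nat \<Rightarrow> nat \<Rightarrow> 'a \<Rightarrow> 'b) \<Rightarrow> bool" where
  "ss_map X Y F \<longleftrightarrow>
     (\<forall>n. simplicial_map (space_at X n) (space_at Y n) (F n)) \<and>
     (\<forall>m n k. \<forall>\<alpha> \<in> delta_s m n. \<forall>x \<in> cells (space_at X n) k.
        F m k (pull X n \<alpha> k x) = pull Y n \<alpha> k (F n k x))"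

definition terminal_ss :: "unit ssspace" where
  "terminal_ss = \<lparr>space_at = (\<lambda>_. \<lparr>cells = (\<lambda>_. {()}), act = (\<lambda>_ _ _. ())\<rparr>),
                  pull = (\<lambda>_ _ _ _. ())\<rparr>"

definition to_terminal :: "nat \<Rightarrow> nat \<Rightarrow> 'a \<Rightarrow> unit" where
  "to_terminal = (\<lambda>_ _ _. ())"

text \<open>
  Right lifting property of \<open>F : X \<rightarrow> Y\<close> with respect to the inclusion of a semi-simplicial subset
  \<open>A\<close> of \<open>B\<close>.  For such an inclusion the restriction \<open>Map(B, Y) \<rightarrow> Map(A, Y)\<close> is a Kan fibration
  because \<open>Y\<close> is Reedy fibrant, so the strict fibre product is the one in the \<open>\<infinity>\<close>-category of
  spaces.
\<close>

definition rlp ::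
  "'s presheaf \<Rightarrow> 's presheaf \<Rightarrow> 'a ssspace \<Rightarrow> 'b ssspace \<Rightarrow> (nat \<Rightarrow> nat \<Rightarrow> 'a \<Rightarrow> 'b) \<Rightarrow> bool" where
  "rlp A B X Y F \<longleftrightarrow>
     pi0_surjective (map_space B X)
       (fibre_product (map_space A X) (map_space B Y) (post_compose A F) (\<lambda>_. restrict_map A))
       (\<lambda>k g. (restrict_map A g, post_compose B F k g))"

definition inner_kan :: "'a ssspace \<Rightarrow> bool" where
  "inner_kan X \<longleftrightarrow>
     (\<forall>n i. 0 < i \<longrightarrow> i < n \<longrightarrow> rlp (horn n i) (simplex n) X terminal_ss to_terminal)"

section \<open>Equivalences and idempotents\<close>

text \<open>The face \<open>d\<^sub>i\<close> of a point of \<open>X\<^sub>n\<close>.\<close>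

definition face :: "'a ssspace \<Rightarrow> nat \<Rightarrow> nat \<Rightarrow> 'a \<Rightarrow> 'a" where
  "face X n i x = pull X n (coface n i) 0 x"

definition extends_up_to_homotopy ::
  "'s presheaf \<Rightarrow> 's presheaf \<Rightarrow> 'a ssspace \<Rightarrow> (nat \<Rightarrow> 's \<Rightarrow> 'a) \<Rightarrow> bool" where
  "extends_up_to_homotopy A B X g \<longleftrightarrow>
     (\<exists>h \<in> cells (map_space B X) 0. same_component (map_space A X) (restrict_map A h) g)"

definition equivalence_edge :: "'a ssspace \<Rightarrow> 'a \<Rightarrow> bool" where
  "equivalence_edge X f \<longleftrightarrow> f \<in> cells (space_at X 1) 0 \<and>
     (\<forall>n \<ge> 2.
        (\<forall>g \<in> cells (map_space (horn n 0) X) 0.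
           same_component (space_at X 1) (g 1 [0, 1]) f \<longrightarrow>
           extends_up_to_homotopy (horn n 0) (simplex n) X g) \<and>
        (\<forall>g \<in> cells (map_space (horn n n) X) 0.
           same_component (space_at X 1) (g 1 [n - 1, n]) f \<longrightarrow>
           extends_up_to_homotopy (horn n n) (simplex n) X g))"

definition idempotent_edge :: "'a ssspace \<Rightarrow> 'a \<Rightarrow> bool" where
  "idempotent_edge X f \<longleftrightarrow> f \<in> cells (space_at X 1) 0 \<and>
     same_component (space_at X 0) (face X 1 0 f) (face X 1 1 f) \<and>
     (\<exists>H \<in> cells (space_at X 2) 0. \<forall>i \<le> 2. same_component (space_at X 1) (face X 2 i H) f)"

definition idempotent_edge_at :: "'a ssspace \<Rightarrow> 'a \<Rightarrow> 'a \<Rightarrow> bool" where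
  "idempotent_edge_at X x f \<longleftrightarrow> idempotent_edge X f \<and>
     same_component (space_at X 0) (face X 1 0 f) x \<and>
     same_component (space_at X 0) (face X 1 1 f) x"

definition quasi_unital_inner_kan :: "'a ssspace \<Rightarrow> bool" where
  "quasi_unital_inner_kan X \<longleftrightarrow> inner_kan X \<and>
     (\<forall>x \<in> cells (space_at X 0) 0. \<exists>f. idempotent_edge_at X x f \<and> equivalence_edge X f)"

definition quasi_unital_map ::
  "'a ssspace \<Rightarrow> 'b ssspace \<Rightarrow> (nat \<Rightarrow> nat \<Rightarrow> 'a \<Rightarrow> 'b) \<Rightarrow> bool" where
  "quasi_unital_map X Y F \<longleftrightarrow> ss_map X Y F \<and>
     (\<forall>f. idempotent_edge X f \<and> equivalence_edge X f \<longrightarrow>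
          idempotent_edge Y (F 1 0 f) \<and> equivalence_edge Y (F 1 0 f))"

section \<open>Marked semi-simplicial spaces\<close>

text \<open>
  A subspace of \<open>X\<^sub>1\<close> that is a union of connected components is given by its set of points.
\<close>

type_synonym 'a marked_ssspace = "'a ssspace \<times> 'a set"

definition marked_ssspace :: "'a marked_ssspace \<Rightarrow> bool" where
  "marked_ssspace Z \<longleftrightarrow> semisimplicial_space (fst Z) \<and> snd Z \<subseteq> cells (space_at (fst Z) 1) 0 \<and>
     (\<forall>e \<in> snd Z. \<forall>e'. same_component (space_at (fst Z) 1) e e' \<longrightarrow> e' \<in> snd Z)"

text \<open>
  The marked mapping space is a union of components of the unmarked one, so \<open>F\<close> lifts to a map of
  marked semi-simplicial spaces iff \<open>F\<close> itself preserves the marking.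
\<close>

definition marked_map ::
  "'a marked_ssspace \<Rightarrow> 'b marked_ssspace \<Rightarrow> (nat \<Rightarrow> nat \<Rightarrow> 'a \<Rightarrow> 'b) \<Rightarrow> bool" where
  "marked_map Z W F \<longleftrightarrow> ss_map (fst Z) (fst W) F \<and> (\<forall>e \<in> snd Z. F 1 0 e \<in> snd W)"

definition sharp :: "'a ssspace \<Rightarrow> 'a marked_ssspace" where
  "sharp X = (X, cells (space_at X 1) 0)"

definition natural_marking :: "'a ssspace \<Rightarrow> 'a marked_ssspace" where
  "natural_marking X = (X, {f. equivalence_edge X f})"

type_synonym 's marked_ssset = "'s presheaf \<times> 's set"

text \<open>
  The mapping space out of a marked semi-simplicial set is the union of those components of the
  unmarked mapping space whose points preserve the marking; a simplex belongs to it iff all of its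
  vertices do.
\<close>

definition marked_map_space ::
  "'s marked_ssset \<Rightarrow> 'a marked_ssspace \<Rightarrow> (nat \<Rightarrow> 's \<Rightarrow> 'a) presheaf" where
  "marked_map_space A Z = (map_space (fst A) (fst Z))
     \<lparr>cells := (\<lambda>k. {g \<in> cells (map_space (fst A) (fst Z)) k.
        \<forall>e \<in> snd A. \<forall>v \<le> k. act (space_at (fst Z) 1) k [v] (g 1 e) \<in> snd Z})\<rparr>"

text \<open>
  As for \<open>rlp\<close>, the map of marked semi-simplicial sets is an inclusion on underlying
  semi-simplicial sets; the markings may differ even if the latter agree.
\<close>

definition marked_rlp ::
  "'s marked_ssset \<Rightarrow> 's marked_ssset \<Rightarrow> 'a marked_ssspace \<Rightarrow> 'b marked_ssspace \<Rightarrow>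
   (nat \<Rightarrow> nat \<Rightarrow> 'a \<Rightarrow> 'b) \<Rightarrow> bool" where
  "marked_rlp A B Z W F \<longleftrightarrow>
     pi0_surjective (marked_map_space B Z)
       (fibre_product (marked_map_space A Z) (marked_map_space B W)
          (post_compose (fst A) F) (\<lambda>_. restrict_map (fst A)))
       (\<lambda>k g. (restrict_map (fst A) g, post_compose (fst B) F k g))"

definition marked_horn_inclusion ::
  "nat \<Rightarrow> nat \<Rightarrow> nat list set \<Rightarrow> nat list marked_ssset \<times> nat list marked_ssset" where
  "marked_horn_inclusion n i B = ((horn n i, B \<inter> cells (horn n i) 1), (simplex n, B))"

definition admissible_horn_inclusions :: "(nat list marked_ssset \<times> nat list marked_ssset) set" where
  "admissible_horn_inclusions =
     {marked_horn_inclusion n i {} | n i. 0 < i \<and> i < n} \<union>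
     {marked_horn_inclusion n 0 {[0, 1]} | n. 1 \<le> n} \<union>
     {marked_horn_inclusion n n {[n - 1, n]} | n. 1 \<le> n}"

definition S_two_six :: "nat list marked_ssset \<times> nat list marked_ssset" where
  "S_two_six = ((simplex 3, {[0, 2], [1, 3]}), (simplex 3, cells (simplex 3) 1))"

definition J_JL :: "(nat list marked_ssset \<times> nat list marked_ssset) set" where
  "J_JL = admissible_horn_inclusions \<union> {S_two_six}"

definition marked_inner_kan :: "'a marked_ssspace \<Rightarrow> bool" where
  "marked_inner_kan Z \<longleftrightarrow> marked_ssspace Z \<and>
     (\<forall>(A, B) \<in> J_JL. marked_rlp A B Z (sharp terminal_ss) to_terminal)"

end

theory Submission
  imports Defs
begin

text \<open>
  The points of a Reedy fibrant semi-simplicial space form a semi-simplicial set.  Restriction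
  \<open>Map(B, X) \<rightarrow> Map(A, X)\<close> along an inclusion of complexes lifts paths (\<open>path_lifting\<close>,
  \<open>homotopy_lifting\<close>), so a lifting problem that has a solution up to homotopy has a strict one.
  Both sides of the theorem thereby become statements about strict horn fillers in one
  semi-simplicial set: \<open>X\<close> is an inner Kan space iff all inner horns of points have fillers
  (\<open>inner_kan_iff\<close>), and an edge \<open>f\<close> is an equivalence iff the horns \<open>\<Lambda>\<^sup>n\<^sub>0\<close> whose first edge is \<open>f\<close>
  and the horns \<open>\<Lambda>\<^sup>n\<^sub>n\<close> whose last edge is \<open>f\<close> have fillers (\<open>equivalence_edge_iff\<close>).

  The heart of the matter is that equivalences satisfy two out of six in every inner Kan space
  (\<open>invertible_two_of_six\<close>).  The condition on the horns \<open>\<Lambda>\<^sup>n\<^sub>0\<close> says that precomposition with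
  \<open>f : x \<rightarrow> y\<close> is an equivalence \<open>Map(y, z) \<rightarrow> Map(x, z)\<close> for all \<open>z\<close>, and precomposition is
  functorial up to homotopy; so one expects two out of six to be inherited from equivalences of
  spaces.  The proof below is a direct combinatorial version of this argument.  Let \<open>\<sigma>\<close> be a simplex
  and consider a horn that starts with an edge of \<open>\<sigma>\<close> and has a set \<open>T\<close> of further vertices.  The
  horn and \<open>\<sigma>\<close> are extended together over a part of the join of \<open>\<sigma>\<close> with \<open>T\<close>, by adding faces in
  pairs \<open>U\<close>, \<open>U \<union> {v}\<close>.  Each pair is the missing part of a horn at \<open>v\<close>, which has a filler because
  \<open>v\<close> is an inner vertex or because it is the first vertex and the first edge is already known to be
  invertible (\<open>extend\<close>).  The condition on \<open>\<Lambda>\<^sup>n\<^sub>n\<close> follows by reversing the order of the vertices.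

  In part (1), two out of six is the lifting property for \<open>S\<^sub>2\<^sub>/\<^sub>6\<close>, and idempotent equivalences
  solve the lifting problems for horns in \<open>\<Delta>\<^sup>1\<close>.  Conversely, those lifting problems give an
  equivalence \<open>f\<close> that starts at a given point.  A horn with \<open>{1, 2} \<mapsto> f\<close> and \<open>{0, 2} \<mapsto> f\<close> produces
  an edge \<open>e\<close> with \<open>f \<circ> e = f\<close>; three copies of the resulting triangle form a horn \<open>\<Lambda>\<^sup>3\<^sub>3\<close> whose filler
  shows that \<open>e\<close> is idempotent, and two out of six shows that \<open>e\<close> is an equivalence
  (\<open>units_from_invertible\<close>).

  In part (2), an equivalence \<open>f : x \<rightarrow> y\<close> is the middle edge of a 3-simplex with vertices
  \<open>y, x, y, x\<close> whose edges \<open>{0, 2}\<close> and \<open>{1, 3}\<close> are idempotent equivalences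
  (\<open>invertible_between_units\<close>).  A quasi-unital map preserves these two edges as equivalences, and
  two out of six in the target shows that the image of \<open>f\<close> is an equivalence.
\<close>

section \<open>Maps on complexes of faces\<close>

definition faces :: "int set \<Rightarrow> int set set" where
  "faces V = {U. U \<noteq> {} \<and> U \<subseteq> V}"

definition faces_omitting :: "int set \<Rightarrow> int set \<Rightarrow> int set set" where
  "faces_omitting V W = {U. U \<noteq> {} \<and> U \<subseteq> V \<and> \<not> W \<subseteq> U}"

definition horn_faces :: "int set \<Rightarrow> int \<Rightarrow> int set set" where
  "horn_faces V i = faces_omitting V (V - {i})"

lemma horn_faces_iff: "U \<in> horn_faces V i \<longleftrightarrow> U \<noteq> {} \<and> U \<subseteq> V \<and> \<not> V - {i} \<subseteq> U"
  by (simp add: horn_faces_def faces_omitting_def)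

lemma strict_mono_bij_exists:
  fixes V W :: "int set"
  assumes "finite V" "finite W" "card V = card W"
  shows "\<exists>h. strict_mono_on V h \<and> h ` V = W"
  using assms
proof (induction "card V" arbitrary: V W)
  case 0
  then show ?case by (auto simp: strict_mono_on_def)
next
  case (Suc n)
  then have ne: "V \<noteq> {}" "W \<noteq> {}" by auto
  let ?V = "V - {Max V}" and ?W = "W - {Max W}"
  have "\<exists>h. strict_mono_on ?V h \<and> h ` ?V = ?W"
    using Suc ne by (intro Suc.hyps(1)) (auto simp: card_Diff_singleton)
  then obtain h where h: "strict_mono_on ?V h" "h ` ?V = ?W" by blast
  have VM: "v < Max V" if "v \<in> ?V" for v using that Suc.prems by (simp add: order_less_le)
  have WM: "w < Max W" if "w \<in> ?W" for w using that Suc.prems by (simp add: order_less_le)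
  let ?h = "h(Max V := Max W)"
  have "strict_mono_on V ?h"
  proof (rule strict_mono_onI)
    fix r s assume rs: "r \<in> V" "s \<in> V" "r < s"
    then have r: "r \<in> ?V" using Max_ge[OF Suc.prems(1) rs(2)] by auto
    show "?h r < ?h s"
    proof (cases "s = Max V")
      case True
      then show ?thesis using r h(2) WM rs by auto
    next
      case False
      then show ?thesis using r rs h(1) by (auto simp: strict_mono_on_def)
    qed
  qed
  moreover have "?h ` V = W"
  proof -
    have M: "Max V \<in> V" "Max W \<in> W" using Suc.prems ne by (blast intro: Max_in)+
    then have "?h ` V = insert (Max W) (?h ` ?V)" by auto
    also have "?h ` ?V = h ` ?V" by (intro image_cong) auto
    finally show ?thesis using h(2) M by auto
  qed
  ultimately show ?case by blast
qed

text \<open>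
  A semi-simplicial set, given for every finite set \<open>V\<close> of integers by the set \<open>S V\<close> of simplices
  whose vertices are named by the elements of \<open>V\<close> in increasing order; \<open>res U V z\<close> is the face of \<open>z\<close>
  spanned by \<open>U\<close>.  With named vertices, joins and reversal are operations on sets of integers, and
  the passage to a face needs no renumbering.
\<close>

locale simplex_system =
  fixes S :: "int set \<Rightarrow> 'a set" and res :: "int set \<Rightarrow> int set \<Rightarrow> 'a \<Rightarrow> 'a"
  assumes res_in: "\<lbrakk>finite V; U \<subseteq> V; U \<noteq> {}; z \<in> S V\<rbrakk> \<Longrightarrow> res U V z \<in> S U"
    and res_self: "\<lbrakk>finite V; V \<noteq> {}; z \<in> S V\<rbrakk> \<Longrightarrow> res V V z = z"
    and res_res: "\<lbrakk>finite V; U \<subseteq> V; W \<subseteq> U; W \<noteq> {}; z \<in> S V\<rbrakk> \<Longrightarrow> res W U (res U V z) = res W V z"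
    and S_iso: "\<lbrakk>finite V; strict_mono_on V h\<rbrakk> \<Longrightarrow> S (h ` V) = S V"
    and res_iso: "\<lbrakk>finite V; strict_mono_on V h; U \<subseteq> V\<rbrakk> \<Longrightarrow> res (h ` U) (h ` V) z = res U V z"
begin

text \<open>
  That the complex \<open>K\<close> is closed under nonempty faces is part of this predicate.
\<close>

definition is_map :: "int set set \<Rightarrow> (int set \<Rightarrow> 'a) \<Rightarrow> bool" where
  "is_map K x \<longleftrightarrow> (\<forall>V\<in>K. finite V \<and> V \<noteq> {} \<and> x V \<in> S V \<and>
     (\<forall>U. U \<noteq> {} \<longrightarrow> U \<subseteq> V \<longrightarrow> U \<in> K \<and> x U = res U V (x V)))"

definition fills :: "int set \<Rightarrow> int \<Rightarrow> (int set \<Rightarrow> 'a) \<Rightarrow> bool" where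
  "fills V i x \<longleftrightarrow> (\<exists>z\<in>S V. \<forall>U\<in>horn_faces V i. res U V z = x U)"

text \<open>
  Precomposition with \<open>f\<close> is an equivalence of mapping spaces, phrased as the existence of fillers
  for the horns at the first vertex whose first edge is \<open>f\<close>.  A third vertex is required since the
  horns in \<open>\<Delta>\<^sup>1\<close> contain no edge.
\<close>

definition left_inv :: "'a \<Rightarrow> bool" where
  "left_inv f \<longleftrightarrow> (\<forall>V a b x. finite V \<longrightarrow> a \<in> V \<longrightarrow> b \<in> V \<longrightarrow> a < b \<longrightarrow> (\<forall>v \<in> V - {a, b}. b < v) \<longrightarrow>
     V - {a, b} \<noteq> {} \<longrightarrow> is_map (horn_faces V a) x \<longrightarrow> x {a, b} = f \<longrightarrow> fills V a x)"

definition right_inv :: "'a \<Rightarrow> bool" where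
  "right_inv f \<longleftrightarrow> (\<forall>V a b x. finite V \<longrightarrow> a \<in> V \<longrightarrow> b \<in> V \<longrightarrow> b < a \<longrightarrow> (\<forall>v \<in> V - {a, b}. v < b) \<longrightarrow>
     V - {a, b} \<noteq> {} \<longrightarrow> is_map (horn_faces V a) x \<longrightarrow> x {a, b} = f \<longrightarrow> fills V a x)"

lemma is_mapD:
  assumes "is_map K x" "V \<in> K"
  shows "finite V" "V \<noteq> {}" "x V \<in> S V"
    and "\<And>U. U \<noteq> {} \<Longrightarrow> U \<subseteq> V \<Longrightarrow> U \<in> K"
    and "\<And>U. U \<noteq> {} \<Longrightarrow> U \<subseteq> V \<Longrightarrow> x U = res U V (x V)"
  using assms unfolding is_map_def by blast+

lemma is_map_subset:
  assumes "is_map K x" "L \<subseteq> K" "\<And>U V. V \<in> L \<Longrightarrow> U \<subseteq> V \<Longrightarrow> U \<noteq> {} \<Longrightarrow> U \<in> L"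
  shows "is_map L x"
  using assms unfolding is_map_def by blast

lemma is_map_faces:
  assumes "finite V" "z \<in> S V"
  shows "is_map (faces V) (\<lambda>U. res U V z)"
  unfolding is_map_def faces_def
  using assms by (auto intro: finite_subset res_in simp: res_res)

lemma is_map_union:
  assumes "is_map K x" "is_map L y" "\<And>U. U \<in> K \<Longrightarrow> U \<in> L \<Longrightarrow> x U = y U"
  shows "is_map (K \<union> L) (\<lambda>U. if U \<in> K then x U else y U)"
  using assms unfolding is_map_def by (smt (verit) UnE UnI1 UnI2)

text \<open>
  A filler of the horn at \<open>i\<close> contributes two simplices: itself and the face opposite to \<open>i\<close>.
\<close>

lemma extend_by_horn:
  assumes x: "is_map K x" and V: "finite V" "V - {i} \<noteq> {}" "i \<in> V"
    and horn: "horn_faces V i \<subseteq> K" and new: "V \<notin> K" "V - {i} \<notin> K" and fill: "fills V i x"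
  shows "\<exists>x'. is_map (insert V (insert (V - {i}) K)) x' \<and> (\<forall>U\<in>K. x' U = x U)"
proof -
  obtain z where z: "z \<in> S V" "\<And>U. U \<in> horn_faces V i \<Longrightarrow> res U V z = x U"
    using fill unfolding fills_def by blast
  let ?x = "\<lambda>U. if U \<in> K then x U else res U V z"
  have face: "?x U = res U V z \<and> U \<in> insert V (insert (V - {i}) K)" if "U \<noteq> {}" "U \<subseteq> V" for U
  proof (cases "U \<in> horn_faces V i")
    case True
    then show ?thesis using z horn by auto
  next
    case False
    then have "U = V \<or> U = V - {i}" using that V(3) by (auto simp: horn_faces_iff)
    then show ?thesis using new by auto
  qed
  have "is_map (insert V (insert (V - {i}) K)) ?x"
    unfolding is_map_def
  proof (intro ballI conjI allI impI)
    fix W assume W: "W \<in> insert V (insert (V - {i}) K)"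
    show fW: "finite W" using W V x by (auto dest: is_mapD)
    show neW: "W \<noteq> {}" using W V x by (auto dest: is_mapD)
    show "?x W \<in> S W"
      using W face[of W] neW x z(1) V res_in[of V W z] by (auto dest: is_mapD)
    fix U assume U: "U \<noteq> {}" "U \<subseteq> W"
    show "U \<in> insert V (insert (V - {i}) K)"
      using W U face[of U] x by (auto dest: is_mapD)
    show "?x U = res U W (?x W)"
    proof (cases "W \<in> K")
      case True
      then show ?thesis using U x by (auto dest: is_mapD)
    next
      case False
      then have WV: "W \<subseteq> V" using W by auto
      then have "?x U = res U V z" "?x W = res W V z" using face[of U] face[of W] U neW by auto
      then show ?thesis using res_res[of V W U z] V(1) WV U z(1) by simp
    qed
  qed
  then show ?thesis by (intro exI[of _ ?x]) auto
qed

definition fillable :: "int set set \<Rightarrow> (int set \<Rightarrow> 'a) \<Rightarrow> int set \<Rightarrow> int \<Rightarrow> bool" where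
  "fillable K x V i \<longleftrightarrow> (\<exists>a\<in>V. \<exists>b\<in>V. a < i \<and> i < b) \<or>
     (\<exists>b\<in>V. i < b \<and> (\<forall>v\<in>V - {i, b}. b < v) \<and> V - {i, b} \<noteq> {} \<and> {i, b} \<in> K \<and> left_inv (x {i, b}))"

end

locale inner_kan_system = simplex_system +
  assumes inner_fills: "\<lbrakk>finite V; a \<in> V; i \<in> V; b \<in> V; a < i; i < b; is_map (horn_faces V i) x\<rbrakk> \<Longrightarrow> fills V i x"
begin

lemma fills_if_fillable:
  assumes "finite V" "i \<in> V" "is_map (horn_faces V i) x" "fillable K x V i"
  shows "fills V i x"
  using assms(4) unfolding fillable_def
proof (elim disjE bexE conjE)
  fix a b assume "a \<in> V" "b \<in> V" "a < i" "i < b"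
  then show ?thesis using inner_fills assms by blast
next
  fix b assume "b \<in> V" "i < b" "\<forall>v\<in>V - {i, b}. b < v" "V - {i, b} \<noteq> {}" "left_inv (x {i, b})"
  then show ?thesis using assms unfolding left_inv_def by blast
qed

text \<open>
  The new faces are exchanged in pairs by inserting and removing \<open>v\<close>, and each pair consists of the
  two simplices missing from a horn at \<open>v\<close>.  A largest new face that contains \<open>v\<close> is a proper face
  of no simplex of \<open>K'\<close>, and the same then holds for its partner apart from that face; so this pair can
  be attached last.
\<close>

lemma extend:
  assumes "is_map K x" "finite K'" "K \<subseteq> K'"
    and "\<And>U. U \<in> K' \<Longrightarrow> finite U \<and> U \<noteq> {}"
    and "\<And>U W. W \<in> K' \<Longrightarrow> U \<subseteq> W \<Longrightarrow> U \<noteq> {} \<Longrightarrow> U \<in> K'"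
    and "\<And>U. U \<in> K' \<Longrightarrow> U \<notin> K \<Longrightarrow> insert v U \<in> K' \<and> insert v U \<notin> K \<and> U - {v} \<in> K' \<and> U - {v} \<notin> K"
    and "\<And>U. U \<in> K' \<Longrightarrow> U \<notin> K \<Longrightarrow> v \<in> U \<Longrightarrow> fillable K x U v"
  shows "\<exists>x'. is_map K' x' \<and> (\<forall>U\<in>K. x' U = x U)"
  using assms
proof (induction "card (K' - K)" arbitrary: K' rule: less_induct)
  case less
  note x = less.prems(1) and fin = less.prems(2) and sub = less.prems(3) and ne = less.prems(4)
    and closed = less.prems(5) and toggle = less.prems(6) and fill = less.prems(7)
  show ?case
  proof (cases "K' - K = {}")
    case True
    then show ?thesis using x sub by (metis Diff_eq_empty_iff subset_antisym)
  next
    case False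
    let ?N = "{U \<in> K' - K. v \<in> U}"
    have "?N \<noteq> {}" using False toggle by blast
    moreover have finN: "finite ?N" using fin by auto
    ultimately have "Max (card ` ?N) \<in> card ` ?N" by (intro Max_in) auto
    then obtain U where UM: "Max (card ` ?N) = card U" and U: "U \<in> ?N" by (rule imageE)
    have max: "card W \<le> card U" if "W \<in> ?N" for W
      unfolding UM[symmetric] using that finN by (intro Max_ge) auto
    have top: "W = U" if "W \<in> K'" "W \<notin> K" "U \<subseteq> W" for W
    proof -
      have "W \<in> ?N" using that U by auto
      then show ?thesis using card_seteq[of W U] that(3) max[of W] ne[of W] that(1) by auto
    qed
    let ?L = "K' - {U, U - {v}}"
    have notK: "U - {v} \<in> K'" "U - {v} \<notin> K" "U \<in> K'" "U \<notin> K" "v \<in> U" using U toggle by auto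
    have Lclosed: "Y \<in> ?L" if W: "W \<in> ?L" and Y: "Y \<subseteq> W" "Y \<noteq> {}" for W Y
    proof -
      have YK: "Y \<in> K'" using W Y closed by blast
      have "Y \<noteq> U \<and> Y \<noteq> U - {v}"
      proof (cases "W \<in> K")
        case True
        then have "Y \<in> K" using Y x by (auto dest: is_mapD)
        then show ?thesis using notK by auto
      next
        case False
        have "insert v W = U" if "U - {v} \<subseteq> W"
          using toggle[of W] W False top[of "insert v W"] that by auto
        then have "W = U \<or> W = U - {v}" if "U - {v} \<subseteq> W" using that by auto
        then show ?thesis using W Y by auto
      qed
      then show ?thesis using YK by auto
    qed
    have "\<exists>x'. is_map ?L x' \<and> (\<forall>U\<in>K. x' U = x U)"
    proof (rule less.hyps[OF _ x])
      show "card (?L - K) < card (K' - K)"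
        using notK fin by (intro psubset_card_mono) auto
      show "finite ?L" using fin by simp
      show "K \<subseteq> ?L" using sub notK by auto
      show "finite W \<and> W \<noteq> {}" if "W \<in> ?L" for W using that ne by blast
      show "Y \<in> ?L" if "W \<in> ?L" "Y \<subseteq> W" "Y \<noteq> {}" for Y W using that by (rule Lclosed)
      show "insert v W \<in> ?L \<and> insert v W \<notin> K \<and> W - {v} \<in> ?L \<and> W - {v} \<notin> K"
        if W: "W \<in> ?L" "W \<notin> K" for W
      proof -
        have "W \<noteq> U" "W \<noteq> U - {v}" using W by auto
        then have "insert v W \<noteq> U" "insert v W \<noteq> U - {v}" "W - {v} \<noteq> U" "W - {v} \<noteq> U - {v}"
          using notK(5) by blast+
        then show ?thesis using toggle[of W] W by simp
      qed
      show "fillable K x W v" if "W \<in> ?L" "W \<notin> K" "v \<in> W" for W using that fill by blast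
    qed
    then obtain x1 where x1: "is_map ?L x1" "\<And>W. W \<in> K \<Longrightarrow> x1 W = x W" by blast
    have horn: "horn_faces U v \<subseteq> ?L"
      using closed notK by (auto simp: horn_faces_iff)
    have "fillable K x1 U v"
      using fill[of U] notK x1(2) unfolding fillable_def by metis
    moreover have "is_map (horn_faces U v) x1"
      using x1(1) horn by (rule is_map_subset) (auto simp: horn_faces_iff)
    ultimately have "fills U v x1"
      using fills_if_fillable ne notK by blast
    then obtain x2 where x2: "is_map (insert U (insert (U - {v}) ?L)) x2" "\<And>W. W \<in> ?L \<Longrightarrow> x2 W = x1 W"
      using extend_by_horn[OF x1(1) _ _ notK(5) horn] ne[OF notK(3)] ne[OF notK(1)] by auto
    have "insert U (insert (U - {v}) ?L) = K'" using notK by auto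
    moreover have "x2 W = x W" if "W \<in> K" for W
    proof -
      have "W \<in> ?L" using that sub notK by auto
      then show ?thesis using x2(2) x1(2) that by simp
    qed
    ultimately show ?thesis using x2(1) by auto
  qed
qed

end

section \<open>Two out of three and two out of six\<close>

context simplex_system
begin

text \<open>
  Vertices may be renamed by order isomorphisms.  Moving the later vertices of a horn beyond \<open>c\<close>
  makes room for the vertices of an auxiliary simplex that contains its first edge.
\<close>

lemma left_invI:
  assumes ab: "a < b" "b \<le> c"
    and fill: "\<And>T x. \<lbrakk>finite T; T \<noteq> {}; \<forall>t\<in>T. c < t;
      is_map (faces_omitting ({a, b} \<union> T) ({b} \<union> T)) x; x {a, b} = f\<rbrakk> \<Longrightarrow>
      \<exists>z\<in>S ({a, b} \<union> T). \<forall>U\<in>faces_omitting ({a, b} \<union> T) ({b} \<union> T). res U ({a, b} \<union> T) z = x U"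
  shows "left_inv f"
  unfolding left_inv_def
proof (intro allI impI)
  fix V a' b' x
  assume V: "finite V" "a' \<in> V" "b' \<in> V" "a' < b'" "\<forall>v\<in>V - {a', b'}. b' < v" "V - {a', b'} \<noteq> {}"
    and x: "is_map (horn_faces V a') x" "x {a', b'} = f"
  define T where "T = {c + 1 .. c + int (card (V - {a', b'}))}"
  have T: "finite T" "\<forall>t\<in>T. c < t" "card T = card (V - {a', b'})" unfolding T_def by auto
  then have neT: "T \<noteq> {}" using V(1,6) by (metis card_eq_0_iff finite_Diff)
  obtain h0 where h0: "strict_mono_on T h0" "h0 ` T = V - {a', b'}"
    using strict_mono_bij_exists[of T "V - {a', b'}"] T V(1) by auto
  define h where "h = h0(a := a', b := b')"
  let ?W = "{a, b} \<union> T"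
  have aT: "a \<notin> T" "b \<notin> T" using T(2) ab by force+
  have hT: "h t = h0 t" if "t \<in> T" for t using that aT unfolding h_def by auto
  have ha: "h a = a'" "h b = b'" using ab unfolding h_def by auto
  have mono: "strict_mono_on ?W h"
  proof (rule strict_mono_onI)
    fix r s assume rs: "r \<in> ?W" "s \<in> ?W" "r < s"
    have b's: "b' < h t" if "t \<in> T" for t using that h0(2) V(5) hT by auto
    show "h r < h s"
    proof (cases "r \<in> T")
      case True
      then have "s \<in> T" using rs T(2) ab by force
      then show ?thesis using True rs h0(1) hT by (auto simp: strict_mono_on_def)
    next
      case False
      then have r: "r = a \<or> r = b" using rs by auto
      have "s = b \<and> r = a \<or> s \<in> T" using rs r ab by auto
      then show ?thesis using r ha b's V(4) by force
    qed
  qed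
  have img: "h ` ?W = V" using ha hT h0(2) V(2,3) by (auto simp: image_iff)
  have inj: "inj_on h ?W" using mono by (rule strict_mono_on_imp_inj_on)
  have hornimg: "h ` U \<in> horn_faces V a' \<longleftrightarrow> U \<in> faces_omitting ?W ({b} \<union> T)" if "U \<subseteq> ?W" for U
  proof -
    have Va: "V - {a'} = h ` ({b} \<union> T)"
    proof -
      have "{b} \<union> T = ?W - {a}" using ab aT by auto
      then show ?thesis using inj_on_image_set_diff[OF inj, of ?W "{a}"] img ha by auto
    qed
    have sub: "h ` ({b} \<union> T) \<subseteq> h ` U \<longleftrightarrow> {b} \<union> T \<subseteq> U"
      unfolding image_subset_iff using that inj_on_image_mem_iff[OF inj _ that] by blast
    have "h ` U \<subseteq> V" using that img by blast
    then show ?thesis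
      unfolding horn_faces_iff Va sub using that by (simp add: faces_omitting_def)
  qed
  have resh: "res (h ` U) (h ` U') z = res U U' z" if "U \<subseteq> U'" "U' \<subseteq> ?W" for U U' z
    using that mono T(1) by (intro res_iso) (auto intro: finite_subset monotone_on_subset)
  have Sh: "S (h ` U) = S U" if "U \<subseteq> ?W" for U
    using that mono T(1) by (intro S_iso) (auto intro: finite_subset monotone_on_subset)
  have "is_map (faces_omitting ?W ({b} \<union> T)) (\<lambda>U. x (h ` U))"
    unfolding is_map_def
  proof (intro ballI conjI allI impI)
    fix U assume U: "U \<in> faces_omitting ?W ({b} \<union> T)"
    then have UW: "U \<subseteq> ?W" "U \<noteq> {}" by (auto simp: faces_omitting_def)
    show "finite U" using UW T(1) by (auto intro: finite_subset)
    show "U \<noteq> {}" by fact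
    have hU: "h ` U \<in> horn_faces V a'" using hornimg UW U by auto
    show "x (h ` U) \<in> S U" using is_mapD(3)[OF x(1) hU] Sh UW by auto
    fix Y assume Y: "Y \<noteq> {}" "Y \<subseteq> U"
    then show "Y \<in> faces_omitting ?W ({b} \<union> T)" using U by (auto simp: faces_omitting_def)
    show "x (h ` Y) = res Y U (x (h ` U))"
      using is_mapD(5)[OF x(1) hU, of "h ` Y"] Y UW resh[of Y U] by auto
  qed
  then obtain z where z: "z \<in> S ?W" "\<And>U. U \<in> faces_omitting ?W ({b} \<union> T) \<Longrightarrow> res U ?W z = x (h ` U)"
    using fill[of T "\<lambda>U. x (h ` U)"] T neT x(2) ha by auto
  show "fills V a' x"
    unfolding fills_def
  proof (intro bexI ballI)
    show "z \<in> S V" using z(1) Sh[OF subset_refl] unfolding img by blast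
    fix Y assume Y: "Y \<in> horn_faces V a'"
    then obtain U where U: "U \<subseteq> ?W" "Y = h ` U"
      using subset_imageE[of Y h ?W] unfolding img horn_faces_iff by blast
    then have "U \<in> faces_omitting ?W ({b} \<union> T)" using hornimg Y by blast
    then show "res Y V z = x Y" using z(2) resh[OF U(1) subset_refl] unfolding img U(2) by simp
  qed
qed

text \<open>
  A horn that starts with an edge of \<open>z\<close>, and whose other vertices come after those of \<open>z\<close>, meets \<open>z\<close>
  in that edge only.  So the two together are a map on a union of complexes, and the horn has a
  filler as soon as this map extends to a complex that contains the full simplex.
\<close>

lemma left_inv_by_extension:
  assumes V0: "finite V0" "a \<in> V0" "b \<in> V0" "a < b" and z: "z \<in> S V0"
    and extension: "\<And>T x. \<lbrakk>finite T; T \<noteq> {}; \<forall>t\<in>T. \<forall>v\<in>V0. v < t;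
      is_map (faces V0 \<union> faces_omitting ({a, b} \<union> T) ({b} \<union> T)) x; \<forall>U\<in>faces V0. x U = res U V0 z\<rbrakk> \<Longrightarrow>
      \<exists>K x'. is_map K x' \<and> (\<forall>U\<in>faces V0 \<union> faces_omitting ({a, b} \<union> T) ({b} \<union> T). x' U = x U) \<and>
        {a, b} \<union> T \<in> K"
  shows "left_inv (res {a, b} V0 z)"
proof (rule left_invI[of a b "Max V0"])
  show "a < b" using V0 by simp
  show "b \<le> Max V0" using V0 by simp
next
  fix T x
  let ?F = "faces_omitting ({a, b} \<union> T) ({b} \<union> T)"
  assume T: "finite T" "T \<noteq> {}" "\<forall>t\<in>T. Max V0 < t"
    and x: "is_map ?F x" "x {a, b} = res {a, b} V0 z"
  have T0: "\<forall>t\<in>T. \<forall>v\<in>V0. v < t" using T(3) Max_ge[OF V0(1)] by fastforce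
  obtain t where t: "t \<in> T" "a < t" "b < t" using T(2) T0 V0 by blast
  have ab: "{a, b} \<in> ?F" using t by (auto simp: faces_omitting_def)
  define x0 where "x0 = (\<lambda>U. if U \<in> faces V0 then res U V0 z else x U)"
  have agree: "res U V0 z = x U" if "U \<in> faces V0" "U \<in> ?F" for U
  proof -
    have U: "U \<noteq> {}" "U \<subseteq> {a, b}" using that T0 by (auto simp: faces_def faces_omitting_def)
    then have "x U = res U {a, b} (x {a, b})" using is_mapD(5)[OF x(1) ab] by blast
    then show ?thesis using x(2) res_res[of V0 "{a, b}" U z] V0 U z by auto
  qed
  have "is_map (faces V0 \<union> ?F) x0"
    unfolding x0_def using is_map_faces[OF V0(1) z] x(1) agree by (rule is_map_union)
  moreover have "\<forall>U\<in>faces V0. x0 U = res U V0 z" by (simp add: x0_def)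
  ultimately obtain K x' where x': "is_map K x'" "\<forall>U\<in>faces V0 \<union> ?F. x' U = x0 U" "{a, b} \<union> T \<in> K"
    using extension[OF T(1,2) T0, of x0] by blast
  have "res U ({a, b} \<union> T) (x' ({a, b} \<union> T)) = x U" if "U \<in> ?F" for U
  proof -
    have "x' U = x U" using agree that x'(2) unfolding x0_def by auto
    moreover have "U \<noteq> {}" "U \<subseteq> {a, b} \<union> T" using that by (auto simp: faces_omitting_def)
    ultimately show ?thesis using is_mapD(5)[OF x'(1,3), of U] by simp
  qed
  then show "\<exists>z\<in>S ({a, b} \<union> T). \<forall>U\<in>?F. res U ({a, b} \<union> T) z = x U"
    using is_mapD(3)[OF x'(1,3)] by blast
qed

end

context inner_kan_system
begin

text \<open>
  The pairing argument of \<open>extend\<close> is applied to the finitely many faces on \<open>Y\<close>, and the result is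
  glued to the map on \<open>K\<close>.
\<close>

lemma extend_by_faces_omitting:
  assumes x: "is_map K x" and Y: "finite Y" "v \<in> Y" "v \<notin> W"
    and new: "\<And>U. \<lbrakk>U \<subseteq> Y; v \<in> U; \<not> W \<subseteq> U; U \<notin> K\<rbrakk> \<Longrightarrow>
      U - {v} \<noteq> {} \<and> U - {v} \<notin> K \<and> fillable K x U v"
  shows "\<exists>x'. is_map (K \<union> faces_omitting Y W) x' \<and> (\<forall>U\<in>K. x' U = x U)"
proof -
  let ?F = "faces_omitting Y W" and ?L = "{U \<in> K. U \<subseteq> Y}"
  have closed: "U \<in> K" if "V \<in> K" "U \<subseteq> V" "U \<noteq> {}" for U V using is_mapD(4)[OF x] that by blast
  have L: "is_map ?L x" using x by (rule is_map_subset) (use closed in auto)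
  have finF: "finite ?F" using Y(1) by (auto simp: faces_omitting_def)
  have finL: "finite ?L" using Y(1) by auto
  have fill: "fillable ?L x U v" if "U \<subseteq> Y" "v \<in> U" "fillable K x U v" for U
    using that unfolding fillable_def by blast
  have "\<exists>y. is_map (?L \<union> ?F) y \<and> (\<forall>U\<in>?L. y U = x U)"
  proof (rule extend[OF L, where v = v])
    show "finite (?L \<union> ?F)" using finF finL by simp
    show "?L \<subseteq> ?L \<union> ?F" by blast
    show "finite U \<and> U \<noteq> {}" if "U \<in> ?L \<union> ?F" for U
      using that is_mapD(1,2)[OF x] Y(1) by (auto simp: faces_omitting_def intro: finite_subset)
    show "U \<in> ?L \<union> ?F" if "V \<in> ?L \<union> ?F" "U \<subseteq> V" "U \<noteq> {}" for U V
      using that closed by (auto simp: faces_omitting_def)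
    fix U assume "U \<in> ?L \<union> ?F" "U \<notin> ?L"
    then have U: "U \<in> ?F" "U \<notin> K" by (auto simp: faces_omitting_def)
    have vU: "insert v U \<subseteq> Y" "v \<in> insert v U" "\<not> W \<subseteq> insert v U" "insert v U \<notin> K"
      using U Y closed[of "insert v U" U] by (auto simp: faces_omitting_def)
    have n: "U - {v} \<noteq> {}" "U - {v} \<notin> K" "fillable K x (insert v U) v" using new[OF vU] by auto
    show "insert v U \<in> ?L \<union> ?F \<and> insert v U \<notin> ?L \<and> U - {v} \<in> ?L \<union> ?F \<and> U - {v} \<notin> ?L"
      using vU n U by (auto simp: faces_omitting_def)
    show "fillable ?L x U v" if "v \<in> U" using that n(3) fill[of U] vU(1) by (simp add: insert_absorb)
  qed
  then obtain y where y: "is_map (?L \<union> ?F) y" "\<And>U. U \<in> ?L \<Longrightarrow> y U = x U" by blast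
  have "is_map (K \<union> (?L \<union> ?F)) (\<lambda>U. if U \<in> K then x U else y U)"
    using x y(1) by (rule is_map_union) (use y(2) in \<open>auto simp: faces_omitting_def\<close>)
  moreover have "K \<union> (?L \<union> ?F) = K \<union> ?F" by blast
  ultimately show ?thesis by (intro exI[of _ "\<lambda>U. if U \<in> K then x U else y U"]) auto
qed

lemma extend_by_faces:
  assumes x: "is_map K x" and Y: "finite Y" "v \<in> Y"
    and new: "\<And>U. \<lbrakk>U \<subseteq> Y; v \<in> U; U \<notin> K\<rbrakk> \<Longrightarrow> U - {v} \<noteq> {} \<and> U - {v} \<notin> K \<and> fillable K x U v"
  shows "\<exists>x'. is_map (K \<union> faces Y) x' \<and> (\<forall>U\<in>K. x' U = x U)"
proof -
  obtain t where t: "t \<notin> Y" using Y(1) ex_new_if_finite[OF infinite_UNIV_int] by blast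
  have eq: "faces Y = faces_omitting Y {t}" using t by (auto simp: faces_def faces_omitting_def)
  show ?thesis
    unfolding eq by (rule extend_by_faces_omitting[OF x]) (use Y t new in auto)
qed

lemma fillable_inner: "a \<in> U \<Longrightarrow> b \<in> U \<Longrightarrow> a < v \<Longrightarrow> v < b \<Longrightarrow> fillable K x U v"
  unfolding fillable_def by blast

lemma fillable_left:
  "\<lbrakk>b \<in> U; v < b; \<forall>u\<in>U - {v, b}. b < u; U - {v, b} \<noteq> {}; {v, b} \<in> K; left_inv (x {v, b})\<rbrakk> \<Longrightarrow> fillable K x U v"
  unfolding fillable_def by blast

text \<open>
  Precomposition with a composite is the composite of the precompositions.  Faces over a proper part
  of \<open>T\<close> are added first, by inner horns at \<open>r\<close>.  Then the faces over all of \<open>T\<close> can be added in the order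
  \<open>{p, q}\<close>, \<open>{q, r}\<close>, \<open>{p, q, r}\<close>; the last step is an inner horn at \<open>q\<close> and also adds \<open>{p, r}\<close>.
\<close>

lemma left_inv_comp:
  assumes pqr: "p < q" "q < r" and z: "z \<in> S {p, q, r}"
    and pq: "left_inv (res {p, q} {p, q, r} z)" and qr: "left_inv (res {q, r} {p, q, r} z)"
  shows "left_inv (res {p, r} {p, q, r} z)"
proof (rule left_inv_by_extension)
  fix T x
  assume T: "finite T" "T \<noteq> {}" "\<forall>t\<in>T. \<forall>v\<in>{p, q, r}. v < t"
  then obtain t where t: "t \<in> T" by blast
  let ?V = "{p, q, r}"
  let ?K0 = "faces ?V \<union> faces_omitting ({p, r} \<union> T) ({r} \<union> T)"
  let ?K1 = "?K0 \<union> faces_omitting (?V \<union> T) T"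
  let ?K2 = "?K1 \<union> faces ({p, q} \<union> T)"
  let ?K3 = "?K2 \<union> faces ({q, r} \<union> T)"
  assume x: "is_map ?K0 x" and xz: "\<forall>U\<in>faces ?V. x U = res U ?V z"
  have disj: "p \<notin> T" "q \<notin> T" "r \<notin> T" "p \<noteq> q" "q \<noteq> r" "p \<noteq> r" using T(3) pqr by auto
  have nT: "\<not> T \<subseteq> {p, q, r}" "\<And>a. T \<subseteq> insert a T" "\<And>a b. T \<subseteq> insert a (insert b T)"
    "\<And>a b c. T \<subseteq> insert a (insert b (insert c T))" using t T(3) by auto
  have edges: "{p, q} \<in> faces ?V" "{q, r} \<in> faces ?V" by (auto simp: faces_def)
  note defs = faces_def faces_omitting_def
  have "\<exists>x1. is_map ?K1 x1 \<and> (\<forall>U\<in>?K0. x1 U = x U)"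
  proof (rule extend_by_faces_omitting[OF x, where v = r])
    fix U assume U: "U \<subseteq> ?V \<union> T" "r \<in> U" "\<not> T \<subseteq> U" "U \<notin> ?K0"
    then have "q \<in> U" "\<exists>t\<in>T. t \<in> U" using disj by (auto simp: defs)
    then show "U - {r} \<noteq> {} \<and> U - {r} \<notin> ?K0 \<and> fillable ?K0 x U r"
      using U disj pqr T(3) by (auto simp: defs intro: fillable_inner)
  qed (use T disj in auto)
  then obtain x1 where x1: "is_map ?K1 x1" "\<And>U. U \<in> ?K0 \<Longrightarrow> x1 U = x U" by blast
  have "\<exists>x2. is_map ?K2 x2 \<and> (\<forall>U\<in>?K1. x2 U = x1 U)"
  proof (rule extend_by_faces[OF x1(1), where v = p])
    fix U assume U: "U \<subseteq> {p, q} \<union> T" "p \<in> U" "U \<notin> ?K1"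
    then have "T \<subseteq> U" by (auto simp: faces_omitting_def)
    then have UT: "U = {p, q} \<union> T" using U disj by (auto simp: faces_omitting_def)
    have "left_inv (x1 {p, q})" using x1(2)[of "{p, q}"] xz pq edges by auto
    then have "fillable ?K1 x1 U p"
      unfolding UT using T t pqr edges disj by (intro fillable_left[where b = q]) auto
    then show "U - {p} \<noteq> {} \<and> U - {p} \<notin> ?K1 \<and> fillable ?K1 x1 U p"
      unfolding UT using T(2) by (simp add: defs insert_Diff_if disj disj(4-6)[symmetric] nT)
  qed (use T in auto)
  then obtain x2 where x2: "is_map ?K2 x2" "\<And>U. U \<in> ?K1 \<Longrightarrow> x2 U = x1 U" by blast
  have "\<exists>x3. is_map ?K3 x3 \<and> (\<forall>U\<in>?K2. x3 U = x2 U)"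
  proof (rule extend_by_faces[OF x2(1), where v = q])
    fix U assume U: "U \<subseteq> {q, r} \<union> T" "q \<in> U" "U \<notin> ?K2"
    then have "T \<subseteq> U" by (auto simp: faces_omitting_def)
    moreover have "U \<notin> faces ({p, q} \<union> T)" using U(3) by simp_all
    ultimately have UT: "U = {q, r} \<union> T" using U(1,2) disj by (auto simp: faces_def)
    have "left_inv (x2 {q, r})" using x2(2)[of "{q, r}"] x1(2)[of "{q, r}"] xz qr edges by auto
    then have "fillable ?K2 x2 U q"
      unfolding UT using T t pqr edges disj by (intro fillable_left[where b = r]) auto
    then show "U - {q} \<noteq> {} \<and> U - {q} \<notin> ?K2 \<and> fillable ?K2 x2 U q"
      unfolding UT using T(2) by (simp add: defs insert_Diff_if disj disj(4-6)[symmetric] nT)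
  qed (use T in auto)
  then obtain x3 where x3: "is_map ?K3 x3" "\<And>U. U \<in> ?K2 \<Longrightarrow> x3 U = x2 U" by blast
  have "\<exists>x4. is_map (?K3 \<union> faces (?V \<union> T)) x4 \<and> (\<forall>U\<in>?K3. x4 U = x3 U)"
  proof (rule extend_by_faces[OF x3(1), where v = q])
    fix U assume U: "U \<subseteq> ?V \<union> T" "q \<in> U" "U \<notin> ?K3"
    then have "T \<subseteq> U" by (auto simp: faces_omitting_def)
    moreover have "U \<notin> faces ({p, q} \<union> T)" "U \<notin> faces ({q, r} \<union> T)" using U(3) by simp_all
    ultimately have UT: "U = ?V \<union> T" using U(1,2) disj by (auto simp: faces_def)
    show "U - {q} \<noteq> {} \<and> U - {q} \<notin> ?K3 \<and> fillable ?K3 x3 U q"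
      unfolding UT using T(2) t T(3) pqr fillable_inner[of p "?V \<union> T" r q] fillable_inner[of p "{p, q} \<union> T" t q]
      by (simp add: defs insert_Diff_if disj disj(4-6)[symmetric] nT)
  qed (use T in auto)
  then obtain x4 where x4: "is_map (?K3 \<union> faces (?V \<union> T)) x4" "\<And>U. U \<in> ?K3 \<Longrightarrow> x4 U = x3 U" by blast
  show "\<exists>K x'. is_map K x' \<and> (\<forall>U\<in>?K0. x' U = x U) \<and> {p, r} \<union> T \<in> K"
  proof (intro exI conjI ballI)
    show "is_map (?K3 \<union> faces (?V \<union> T)) x4" by (rule x4(1))
    show "x4 U = x U" if "U \<in> ?K0" for U
      using that x1(2)[of U] x2(2)[of U] x3(2)[of U] x4(2)[of U] by simp
    show "{p, r} \<union> T \<in> ?K3 \<union> faces (?V \<union> T)" by (auto simp: faces_def)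
  qed
qed (use pqr z in auto)

text \<open>
  As before, inner horns at \<open>r\<close> give the faces over proper parts of \<open>T\<close>.  The faces over all of \<open>T\<close> are
  added in the order \<open>{p, q}\<close> (inner at \<open>q\<close>), \<open>{p, r}\<close> (as \<open>pr\<close> is invertible) and \<open>{p, q, r}\<close> (as \<open>pq\<close>
  is invertible); the last step is a horn at \<open>p\<close> and also adds \<open>{q, r}\<close>.
\<close>

lemma left_inv_cancel:
  assumes pqr: "p < q" "q < r" and z: "z \<in> S {p, q, r}"
    and pq: "left_inv (res {p, q} {p, q, r} z)" and pr: "left_inv (res {p, r} {p, q, r} z)"
  shows "left_inv (res {q, r} {p, q, r} z)"
proof (rule left_inv_by_extension)
  fix T x
  assume T: "finite T" "T \<noteq> {}" "\<forall>t\<in>T. \<forall>v\<in>{p, q, r}. v < t"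
  then obtain t where t: "t \<in> T" by blast
  let ?V = "{p, q, r}"
  let ?K0 = "faces ?V \<union> faces_omitting ({q, r} \<union> T) ({r} \<union> T)"
  let ?K1 = "?K0 \<union> faces_omitting (?V \<union> T) T"
  let ?K2 = "?K1 \<union> faces ({p, q} \<union> T)"
  let ?K3 = "?K2 \<union> faces ({p, r} \<union> T)"
  assume x: "is_map ?K0 x" and xz: "\<forall>U\<in>faces ?V. x U = res U ?V z"
  have disj: "p \<notin> T" "q \<notin> T" "r \<notin> T" "p \<noteq> q" "q \<noteq> r" "p \<noteq> r" using T(3) pqr by auto
  have nT: "\<not> T \<subseteq> {p, q, r}" "\<And>a. T \<subseteq> insert a T" "\<And>a b. T \<subseteq> insert a (insert b T)"
    "\<And>a b c. T \<subseteq> insert a (insert b (insert c T))" using t T(3) by auto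
  have edges: "{p, q} \<in> faces ?V" "{p, r} \<in> faces ?V" by (auto simp: faces_def)
  note defs = faces_def faces_omitting_def
  have "\<exists>x1. is_map ?K1 x1 \<and> (\<forall>U\<in>?K0. x1 U = x U)"
  proof (rule extend_by_faces_omitting[OF x, where v = r])
    fix U assume U: "U \<subseteq> ?V \<union> T" "r \<in> U" "\<not> T \<subseteq> U" "U \<notin> ?K0"
    then have "p \<in> U" "\<exists>t\<in>T. t \<in> U" using disj by (auto simp: defs)
    then show "U - {r} \<noteq> {} \<and> U - {r} \<notin> ?K0 \<and> fillable ?K0 x U r"
      using U disj pqr T(3) by (auto simp: defs intro: fillable_inner)
  qed (use T disj in auto)
  then obtain x1 where x1: "is_map ?K1 x1" "\<And>U. U \<in> ?K0 \<Longrightarrow> x1 U = x U" by blast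
  have "\<exists>x2. is_map ?K2 x2 \<and> (\<forall>U\<in>?K1. x2 U = x1 U)"
  proof (rule extend_by_faces[OF x1(1), where v = q])
    fix U assume U: "U \<subseteq> {p, q} \<union> T" "q \<in> U" "U \<notin> ?K1"
    then have "T \<subseteq> U" by (auto simp: faces_omitting_def)
    then have UT: "U = {p, q} \<union> T" using U disj by (auto simp: faces_omitting_def)
    show "U - {q} \<noteq> {} \<and> U - {q} \<notin> ?K1 \<and> fillable ?K1 x1 U q"
      unfolding UT using T(2) t T(3) pqr fillable_inner[of p "?V \<union> T" r q] fillable_inner[of p "{p, q} \<union> T" t q]
      by (simp add: defs insert_Diff_if disj disj(4-6)[symmetric] nT)
  qed (use T in auto)
  then obtain x2 where x2: "is_map ?K2 x2" "\<And>U. U \<in> ?K1 \<Longrightarrow> x2 U = x1 U" by blast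
  have "\<exists>x3. is_map ?K3 x3 \<and> (\<forall>U\<in>?K2. x3 U = x2 U)"
  proof (rule extend_by_faces[OF x2(1), where v = p])
    fix U assume U: "U \<subseteq> {p, r} \<union> T" "p \<in> U" "U \<notin> ?K2"
    then have "T \<subseteq> U" by (auto simp: faces_omitting_def)
    moreover have "U \<notin> faces ({p, q} \<union> T)" using U(3) by simp_all
    ultimately have UT: "U = {p, r} \<union> T" using U(1,2) disj by (auto simp: faces_def)
    have "left_inv (x2 {p, r})" using x2(2)[of "{p, r}"] x1(2)[of "{p, r}"] xz pr edges by auto
    then have "fillable ?K2 x2 U p"
      unfolding UT using T t pqr edges disj by (intro fillable_left[where b = r]) auto
    then show "U - {p} \<noteq> {} \<and> U - {p} \<notin> ?K2 \<and> fillable ?K2 x2 U p"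
      unfolding UT using T(2) by (simp add: defs insert_Diff_if disj disj(4-6)[symmetric] nT)
  qed (use T in auto)
  then obtain x3 where x3: "is_map ?K3 x3" "\<And>U. U \<in> ?K2 \<Longrightarrow> x3 U = x2 U" by blast
  have "\<exists>x4. is_map (?K3 \<union> faces (?V \<union> T)) x4 \<and> (\<forall>U\<in>?K3. x4 U = x3 U)"
  proof (rule extend_by_faces[OF x3(1), where v = p])
    fix U assume U: "U \<subseteq> ?V \<union> T" "p \<in> U" "U \<notin> ?K3"
    then have "T \<subseteq> U" by (auto simp: faces_omitting_def)
    moreover have "U \<notin> faces ({p, q} \<union> T)" "U \<notin> faces ({p, r} \<union> T)" using U(3) by simp_all
    ultimately have UT: "U = ?V \<union> T" using U(1,2) disj by (auto simp: faces_def)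
    have "left_inv (x3 {p, q})"
      using x3(2)[of "{p, q}"] x2(2)[of "{p, q}"] x1(2)[of "{p, q}"] xz pq edges by auto
    then have "fillable ?K3 x3 U p"
      unfolding UT using T t pqr edges disj by (intro fillable_left[where b = q]) auto
    then show "U - {p} \<noteq> {} \<and> U - {p} \<notin> ?K3 \<and> fillable ?K3 x3 U p"
      unfolding UT using T(2) by (simp add: defs insert_Diff_if disj disj(4-6)[symmetric] nT)
  qed (use T in auto)
  then obtain x4 where x4: "is_map (?K3 \<union> faces (?V \<union> T)) x4" "\<And>U. U \<in> ?K3 \<Longrightarrow> x4 U = x3 U" by blast
  show "\<exists>K x'. is_map K x' \<and> (\<forall>U\<in>?K0. x' U = x U) \<and> {q, r} \<union> T \<in> K"
  proof (intro exI conjI ballI)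
    show "is_map (?K3 \<union> faces (?V \<union> T)) x4" by (rule x4(1))
    show "x4 U = x U" if "U \<in> ?K0" for U
      using that x1(2)[of U] x2(2)[of U] x3(2)[of U] x4(2)[of U] by simp
    show "{q, r} \<union> T \<in> ?K3 \<union> faces (?V \<union> T)" by (auto simp: faces_def)
  qed
qed (use pqr z in auto)

lemma not_in_faces:
  assumes "w \<in> U" "w \<notin> Y"
  shows "U \<notin> faces Y" "U \<notin> faces_omitting Y W"
  using assms by (auto simp: faces_def faces_omitting_def)

text \<open>
  The faces of \<open>{p, q}\<close> over proper parts of \<open>T\<close> do not extend to \<open>r\<close> directly, as nothing is known
  about the edge \<open>qr\<close>.  But they extend to \<open>s\<close> because \<open>qs\<close> is invertible, and then to \<open>r\<close> by inner
  horns at \<open>s\<close>.  Over all of \<open>T\<close>, invertibility of \<open>pr\<close> yields the face on \<open>{p, r}\<close>, and two inner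
  horns at \<open>r\<close> yield the faces on \<open>{q, r}\<close> and \<open>{p, q, r}\<close>; the latter contains the required filler.
\<close>

lemma left_inv_two_of_six:
  assumes pqrs: "p < q" "q < r" "r < s" and z: "z \<in> S {p, q, r, s}"
    and pr: "left_inv (res {p, r} {p, q, r, s} z)" and qs: "left_inv (res {q, s} {p, q, r, s} z)"
  shows "left_inv (res {p, q} {p, q, r, s} z)"
proof (rule left_inv_by_extension)
  fix T x
  assume T: "finite T" "T \<noteq> {}" "\<forall>t\<in>T. \<forall>v\<in>{p, q, r, s}. v < t"
  then obtain t where t: "t \<in> T" by blast
  let ?V = "{p, q, r, s}"
  let ?K0 = "faces ?V \<union> faces_omitting ({p, q} \<union> T) ({q} \<union> T)"
  let ?K1 = "?K0 \<union> faces_omitting ({q, s} \<union> T) T"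
  let ?K2 = "?K1 \<union> faces_omitting ({p, q, s} \<union> T) T"
  let ?K3 = "?K2 \<union> faces_omitting (?V \<union> T) T"
  let ?K4 = "?K3 \<union> faces ({p, r} \<union> T)"
  let ?K5 = "?K4 \<union> faces ({p, q, r} \<union> T)"
  assume x: "is_map ?K0 x" and xz: "\<forall>U\<in>faces ?V. x U = res U ?V z"
  have disj: "p \<notin> T" "q \<notin> T" "r \<notin> T" "s \<notin> T" "p \<noteq> q" "q \<noteq> r" "p \<noteq> r" "p \<noteq> s" "q \<noteq> s" "r \<noteq> s"
    using T(3) pqrs by auto
  have nT: "\<not> T \<subseteq> {p, q, r, s}" "\<And>a. T \<subseteq> insert a T" "\<And>a b. T \<subseteq> insert a (insert b T)"
    "\<And>a b c. T \<subseteq> insert a (insert b (insert c T))" using t T(3) by auto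
  have edges: "{p, r} \<in> faces ?V" "{q, s} \<in> faces ?V" by (auto simp: faces_def)
  note defs = faces_def faces_omitting_def
  have "\<exists>x1. is_map ?K1 x1 \<and> (\<forall>U\<in>?K0. x1 U = x U)"
  proof (rule extend_by_faces_omitting[OF x, where v = q])
    fix U assume U: "U \<subseteq> {q, s} \<union> T" "q \<in> U" "\<not> T \<subseteq> U" "U \<notin> ?K0"
    then have sU: "s \<in> U" "\<exists>t\<in>T. t \<in> U" using disj by (auto simp: defs)
    have "left_inv (x {q, s})" using xz qs edges by auto
    then have "fillable ?K0 x U q"
      using sU U T(3) pqrs edges disj by (intro fillable_left[where b = s]) auto
    then show "U - {q} \<noteq> {} \<and> U - {q} \<notin> ?K0 \<and> fillable ?K0 x U q"
      using U sU disj by (auto simp: defs)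
  qed (use T disj in auto)
  then obtain x1 where x1: "is_map ?K1 x1" "\<And>U. U \<in> ?K0 \<Longrightarrow> x1 U = x U" by blast
  have "\<exists>x2. is_map ?K2 x2 \<and> (\<forall>U\<in>?K1. x2 U = x1 U)"
  proof (rule extend_by_faces_omitting[OF x1(1), where v = q])
    fix U assume U: "U \<subseteq> {p, q, s} \<union> T" "q \<in> U" "\<not> T \<subseteq> U" "U \<notin> ?K1"
    have old: "U \<notin> faces ?V" "U \<notin> faces_omitting ({p, q} \<union> T) ({q} \<union> T)" "U \<notin> faces_omitting ({q, s} \<union> T) T"
      using U(4) by simp_all
    have s: "s \<in> U" using old(2) U(1-3) by (auto simp: faces_omitting_def)
    have p: "p \<in> U" using old(3) U(1-3) by (auto simp: faces_omitting_def)
    obtain t' where t': "t' \<in> T" "t' \<in> U" using old(1) U(1,2) by (auto simp: faces_def)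
    then have "t' \<notin> ?V" using disj by auto
    then have "U - {q} \<notin> ?K1"
      using not_in_faces[of t' "U - {q}" ?V] not_in_faces[of s "U - {q}" "{p, q} \<union> T"]
        not_in_faces[of p "U - {q}" "{q, s} \<union> T"] s p t' disj by simp
    then show "U - {q} \<noteq> {} \<and> U - {q} \<notin> ?K1 \<and> fillable ?K1 x1 U q"
      using p s disj fillable_inner[OF p s pqrs(1)] pqrs by auto
  qed (use T disj in auto)
  then obtain x2 where x2: "is_map ?K2 x2" "\<And>U. U \<in> ?K1 \<Longrightarrow> x2 U = x1 U" by blast
  have "\<exists>x3. is_map ?K3 x3 \<and> (\<forall>U\<in>?K2. x3 U = x2 U)"
  proof (rule extend_by_faces_omitting[OF x2(1), where v = s])
    fix U assume U: "U \<subseteq> ?V \<union> T" "s \<in> U" "\<not> T \<subseteq> U" "U \<notin> ?K2"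
    have old: "U \<notin> faces ?V" "U \<notin> faces_omitting ({p, q, s} \<union> T) T" using U(4) by simp_all
    have r: "r \<in> U" using old(2) U(1-3) by (auto simp: faces_omitting_def)
    obtain t' where t': "t' \<in> T" "t' \<in> U" using old(1) U(1,2) by (auto simp: faces_def)
    then have "t' \<notin> ?V" using disj by auto
    then have "U - {s} \<notin> ?K2"
      using not_in_faces[of t' "U - {s}" ?V] not_in_faces[of r "U - {s}" "{p, q} \<union> T"]
        not_in_faces[of r "U - {s}" "{q, s} \<union> T"] not_in_faces[of r "U - {s}" "{p, q, s} \<union> T"] r t' disj
      by simp
    moreover have "fillable ?K2 x2 U s" using r t' pqrs T(3) by (intro fillable_inner[of r U t']) auto
    ultimately show "U - {s} \<noteq> {} \<and> U - {s} \<notin> ?K2 \<and> fillable ?K2 x2 U s"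
      using r disj by auto
  qed (use T disj in auto)
  then obtain x3 where x3: "is_map ?K3 x3" "\<And>U. U \<in> ?K2 \<Longrightarrow> x3 U = x2 U" by blast
  have "\<exists>x4. is_map ?K4 x4 \<and> (\<forall>U\<in>?K3. x4 U = x3 U)"
  proof (rule extend_by_faces[OF x3(1), where v = p])
    fix U assume U: "U \<subseteq> {p, r} \<union> T" "p \<in> U" "U \<notin> ?K3"
    then have "T \<subseteq> U" by (auto simp: faces_omitting_def)
    then have UT: "U = {p, r} \<union> T" using U disj by (auto simp: faces_omitting_def)
    have "left_inv (x3 {p, r})"
      using x3(2)[of "{p, r}"] x2(2)[of "{p, r}"] x1(2)[of "{p, r}"] xz pr edges by auto
    then have "fillable ?K3 x3 U p"
      unfolding UT using T t pqrs edges disj by (intro fillable_left[where b = r]) auto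
    then show "U - {p} \<noteq> {} \<and> U - {p} \<notin> ?K3 \<and> fillable ?K3 x3 U p"
      unfolding UT using T(2) by (simp add: defs insert_Diff_if disj disj(5-10)[symmetric] nT)
  qed (use T in auto)
  then obtain x4 where x4: "is_map ?K4 x4" "\<And>U. U \<in> ?K3 \<Longrightarrow> x4 U = x3 U" by blast
  have "\<exists>x5. is_map ?K5 x5 \<and> (\<forall>U\<in>?K4. x5 U = x4 U)"
  proof (rule extend_by_faces[OF x4(1), where v = r])
    fix U assume U: "U \<subseteq> {p, q, r} \<union> T" "r \<in> U" "U \<notin> ?K4"
    then have TU: "T \<subseteq> U" by (auto simp: faces_omitting_def)
    moreover have "U \<notin> faces ({p, r} \<union> T)" using U(3) by simp
    ultimately have qU: "q \<in> U" using U(1,2) disj by (auto simp: faces_def)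
    have "fillable ?K4 x4 U r"
      using qU U(2) TU t pqrs T(3) by (intro fillable_inner[of q U t]) auto
    moreover have "U - {r} = {q} \<union> T \<or> U - {r} = {p, q} \<union> T"
      using U(1) TU qU disj by auto
    ultimately show "U - {r} \<noteq> {} \<and> U - {r} \<notin> ?K4 \<and> fillable ?K4 x4 U r"
      using T(2) by (elim disjE) (simp_all add: defs disj disj(5-10)[symmetric] nT)
  qed (use T in auto)
  then obtain x5 where x5: "is_map ?K5 x5" "\<And>U. U \<in> ?K4 \<Longrightarrow> x5 U = x4 U" by blast
  show "\<exists>K x'. is_map K x' \<and> (\<forall>U\<in>?K0. x' U = x U) \<and> {p, q} \<union> T \<in> K"
  proof (intro exI conjI ballI)
    show "is_map ?K5 x5" by (rule x5(1))
    show "x5 U = x U" if "U \<in> ?K0" for U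
      using that x1(2)[of U] x2(2)[of U] x3(2)[of U] x4(2)[of U] x5(2)[of U] by simp
    show "{p, q} \<union> T \<in> ?K5" by (auto simp: faces_def)
  qed
qed (use pqrs z in auto)

end

section \<open>Reversing the order of the vertices\<close>

lemma neg_image_simps [simp]:
  fixes U V :: "int set"
  shows "uminus ` uminus ` U = U" "uminus ` U = {} \<longleftrightarrow> U = {}" "finite (uminus ` U) \<longleftrightarrow> finite U"
    "uminus ` U \<subseteq> uminus ` V \<longleftrightarrow> U \<subseteq> V" "uminus ` U = uminus ` V \<longleftrightarrow> U = V"
  by (auto simp: image_image inj_image_subset_iff inj_image_eq_iff finite_image_iff)

lemma neg_image_mem: "U \<in> (`) uminus ` K \<longleftrightarrow> uminus ` U \<in> K" for U :: "int set"
proof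
  assume "uminus ` U \<in> K"
  then have "uminus ` uminus ` U \<in> (`) uminus ` K" by (rule imageI)
  then show "U \<in> (`) uminus ` K" by simp
qed auto

lemma horn_faces_neg: "horn_faces (uminus ` V) (- i) = (`) uminus ` horn_faces V i"
proof -
  have "U \<in> horn_faces (uminus ` V) (- i) \<longleftrightarrow> uminus ` U \<in> horn_faces V i" for U
  proof -
    have "uminus ` V - {- i} = uminus ` (V - {i})" by auto
    moreover have "U \<subseteq> uminus ` V \<longleftrightarrow> uminus ` U \<subseteq> V" by (metis neg_image_simps(1,4))
    moreover have "uminus ` (V - {i}) \<subseteq> U \<longleftrightarrow> V - {i} \<subseteq> uminus ` U" by (metis neg_image_simps(1,4))
    ultimately show ?thesis by (simp add: horn_faces_iff)
  qed
  then show ?thesis unfolding set_eq_iff by (simp add: neg_image_mem)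
qed

context simplex_system
begin

lemma opposite: "simplex_system (\<lambda>V. S (uminus ` V)) (\<lambda>U V. res (uminus ` U) (uminus ` V))"
proof
  fix V :: "int set" and h :: "int \<Rightarrow> int"
  assume V: "finite V" "strict_mono_on V h"
  let ?h = "\<lambda>v. - h (- v)"
  have h: "strict_mono_on (uminus ` V) ?h"
    using V(2) by (auto simp: strict_mono_on_def)
  have img: "uminus ` h ` U = ?h ` uminus ` U" for U by (auto simp: image_image)
  show "S (uminus ` h ` V) = S (uminus ` V)"
    unfolding img using V h by (intro S_iso) auto
  fix U z assume "U \<subseteq> V"
  then show "res (uminus ` h ` U) (uminus ` h ` V) z = res (uminus ` U) (uminus ` V) z"
    unfolding img using V h by (intro res_iso) auto
qed (simp_all add: res_in res_self res_res)

lemma opposite_is_map: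
  "simplex_system.is_map (\<lambda>V. S (uminus ` V)) (\<lambda>U V. res (uminus ` U) (uminus ` V)) K x \<longleftrightarrow>
    is_map ((`) uminus ` K) (\<lambda>U. x (uminus ` U))"
proof -
  interpret op: simplex_system "\<lambda>V. S (uminus ` V)" "\<lambda>U V. res (uminus ` U) (uminus ` V)"
    by (rule opposite)
  have all: "(\<forall>U::int set. P U) \<longleftrightarrow> (\<forall>U. P (uminus ` U))" for P by (metis neg_image_simps(1))
  show ?thesis
    unfolding op.is_map_def is_map_def ball_simps
    by (subst (2) all) (simp add: neg_image_mem)
qed

lemma opposite_fills:
  "simplex_system.fills (\<lambda>V. S (uminus ` V)) (\<lambda>U V. res (uminus ` U) (uminus ` V)) V i x \<longleftrightarrow>
    fills (uminus ` V) (- i) (\<lambda>U. x (uminus ` U))"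
proof -
  interpret op: simplex_system "\<lambda>V. S (uminus ` V)" "\<lambda>U V. res (uminus ` U) (uminus ` V)"
    by (rule opposite)
  show ?thesis unfolding op.fills_def fills_def horn_faces_neg by simp
qed

text \<open>
  Reversal exchanges horns at the first and at the last vertex, so that results on left invertible
  edges hold for right invertible ones as well.
\<close>

lemma right_inv_iff_opposite_left_inv:
  "right_inv f \<longleftrightarrow>
    simplex_system.left_inv (\<lambda>V. S (uminus ` V)) (\<lambda>U V. res (uminus ` U) (uminus ` V)) f"
proof -
  interpret op: simplex_system "\<lambda>V. S (uminus ` V)" "\<lambda>U V. res (uminus ` U) (uminus ` V)"
    by (rule opposite)
  have diff: "uminus ` V - {- a, - b} = uminus ` (V - {a, b})" for V and a b :: int by auto
  show ?thesis
  proof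
    assume R: "right_inv f"
    show "op.left_inv f"
      unfolding op.left_inv_def
    proof (intro allI impI)
      fix V a b x
      assume V: "finite V" "a \<in> V" "b \<in> V" "a < b" "\<forall>v\<in>V - {a, b}. b < v" "V - {a, b} \<noteq> {}"
        and x: "op.is_map (horn_faces V a) x" "x {a, b} = f"
      have "is_map (horn_faces (uminus ` V) (- a)) (\<lambda>U. x (uminus ` U))"
        using x(1) unfolding opposite_is_map horn_faces_neg .
      moreover have "x (uminus ` {- a, - b}) = f" using x(2) by simp
      moreover have "\<And>v. v \<in> uminus ` (V - {a, b}) \<Longrightarrow> v < - b" using V(5) by auto
      ultimately show "op.fills V a x"
        unfolding opposite_fills
        using R[unfolded right_inv_def, rule_format, of "uminus ` V" "- a" "- b" "\<lambda>U. x (uminus ` U)"] V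
        unfolding diff by simp
    qed
  next
    assume L: "op.left_inv f"
    show "right_inv f"
      unfolding right_inv_def
    proof (intro allI impI)
      fix V a b x
      assume V: "finite V" "a \<in> V" "b \<in> V" "b < a" "\<forall>v\<in>V - {a, b}. v < b" "V - {a, b} \<noteq> {}"
        and x: "is_map (horn_faces V a) x" "x {a, b} = f"
      have "op.is_map (horn_faces (uminus ` V) (- a)) (\<lambda>U. x (uminus ` U))"
        using x(1) unfolding opposite_is_map by (simp add: image_image horn_faces_neg)
      moreover have "x (uminus ` {- a, - b}) = f" using x(2) by simp
      moreover have "\<And>v. v \<in> uminus ` (V - {a, b}) \<Longrightarrow> - b < v" using V(5) by auto
      ultimately have "op.fills (uminus ` V) (- a) (\<lambda>U. x (uminus ` U))"
        using L[unfolded op.left_inv_def, rule_format, of "uminus ` V" "- a" "- b" "\<lambda>U. x (uminus ` U)"] V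
        unfolding diff by simp
      then show "fills V a x" unfolding opposite_fills by simp
    qed
  qed
qed

end

context inner_kan_system
begin

lemma opposite_inner: "inner_kan_system (\<lambda>V. S (uminus ` V)) (\<lambda>U V. res (uminus ` U) (uminus ` V))"
proof -
  interpret op: simplex_system "\<lambda>V. S (uminus ` V)" "\<lambda>U V. res (uminus ` U) (uminus ` V)"
    by (rule opposite)
  show ?thesis
  proof
    fix V a i b x
    assume "finite V" "a \<in> V" "i \<in> V" "b \<in> V" "a < i" "i < b" "op.is_map (horn_faces V i) x"
    then show "op.fills V i x"
      unfolding opposite_fills
      by (intro inner_fills[of _ "- b" "- i" "- a"]) (auto simp: opposite_is_map horn_faces_neg)
  qed
qed

definition invertible :: "'a \<Rightarrow> bool" where
  "invertible f \<longleftrightarrow> left_inv f \<and> right_inv f"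

text \<open>
  Once the first edge is invertible, the triangles \<open>{p, q, r}\<close>, \<open>{q, r, s}\<close> and \<open>{p, q, s}\<close> give the
  remaining edges.
\<close>

lemma left_inv_two_of_six_all:
  assumes pqrs: "p < q" "q < r" "r < s" and z: "z \<in> S {p, q, r, s}"
    and pr: "left_inv (res {p, r} {p, q, r, s} z)" and qs: "left_inv (res {q, s} {p, q, r, s} z)"
    and uv: "u \<in> {p, q, r, s}" "v \<in> {p, q, r, s}" "u < v"
  shows "left_inv (res {u, v} {p, q, r, s} z)"
proof -
  let ?V = "{p, q, r, s}"
  have tri: "res {a, b, c} ?V z \<in> S {a, b, c}" "res {a, b} {a, b, c} (res {a, b, c} ?V z) = res {a, b} ?V z"
    "res {b, c} {a, b, c} (res {a, b, c} ?V z) = res {b, c} ?V z"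
    "res {a, c} {a, b, c} (res {a, b, c} ?V z) = res {a, c} ?V z"
    if "{a, b, c} \<subseteq> ?V" for a b c
    using that z by (auto intro!: res_res res_in)
  have pq: "left_inv (res {p, q} ?V z)" using pqrs z pr qs by (rule left_inv_two_of_six)
  have qr: "left_inv (res {q, r} ?V z)"
    using left_inv_cancel[of p q r "res {p, q, r} ?V z"] tri[of p q r] pqrs pq pr by simp
  have rs: "left_inv (res {r, s} ?V z)"
    using left_inv_cancel[of q r s "res {q, r, s} ?V z"] tri[of q r s] pqrs qr qs by simp
  have ps: "left_inv (res {p, s} ?V z)"
    using left_inv_comp[of p q s "res {p, q, s} ?V z"] tri[of p q s] pqrs pq qs by simp
  consider "u = p" "v = q" | "u = p" "v = r" | "u = p" "v = s" | "u = q" "v = r" | "u = q" "v = s" | "u = r" "v = s"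
    using uv pqrs by auto
  then show ?thesis using pq pr ps qr qs rs by cases simp_all
qed

text \<open>
  The hypotheses are stable under reversal, which exchanges the edges \<open>{0, 2}\<close> and \<open>{1, 3}\<close>.
\<close>

lemma invertible_two_of_six:
  assumes z: "z \<in> S {0, 1, 2, 3}"
    and inv: "invertible (res {0, 2} {0, 1, 2, 3} z)" "invertible (res {1, 3} {0, 1, 2, 3} z)"
    and pq: "p \<in> {0, 1, 2, 3}" "q \<in> {0, 1, 2, 3}" "p < q"
  shows "invertible (res {p, q} {0, 1, 2, 3} z)"
proof -
  interpret op: inner_kan_system "\<lambda>V. S (uminus ` V)" "\<lambda>U V. res (uminus ` U) (uminus ` V)"
    by (rule opposite_inner)
  have V: "uminus ` {- 3, - 2, - 1, 0 :: int} = {0, 1, 2, 3}" by auto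
  have e: "uminus ` {- 3, - 1 :: int} = {1, 3}" "uminus ` {- 2, 0 :: int} = {0, 2}" "uminus ` {- q, - p} = {p, q}"
    by auto
  have "op.left_inv (res (uminus ` {- q, - p}) (uminus ` {- 3, - 2, - 1, 0}) z)"
  proof (rule op.left_inv_two_of_six_all)
    show "z \<in> S (uminus ` {- 3, - 2, - 1, 0})" unfolding V by (rule z)
    show "op.left_inv (res (uminus ` {- 3, - 1}) (uminus ` {- 3, - 2, - 1, 0}) z)"
      "op.left_inv (res (uminus ` {- 2, 0}) (uminus ` {- 3, - 2, - 1, 0}) z)"
      unfolding V e using inv by (auto simp: invertible_def right_inv_iff_opposite_left_inv)
    show "- q \<in> {- 3, - 2, - 1, 0}" "- p \<in> {- 3, - 2, - 1, 0}" using pq by auto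
  qed (use pq in auto)
  then have "right_inv (res {p, q} {0, 1, 2, 3} z)"
    unfolding V e right_inv_iff_opposite_left_inv .
  moreover have "left_inv (res {p, q} {0, 1, 2, 3} z)"
    using left_inv_two_of_six_all[of 0 1 2 3 z p q] inv pq z by (simp add: invertible_def)
  ultimately show ?thesis by (simp add: invertible_def)
qed

end

section \<open>Triangles, tetrahedra and units\<close>

context simplex_system
begin

text \<open>Edges and triangles are brought into standard position before their faces are named.\<close>

abbreviation "src \<equiv> res {0} {0, 1}"
abbreviation "tgt \<equiv> res {1} {0, 1}"
abbreviation "d0 \<equiv> res {1, 2} {0, 1, 2}"
abbreviation "d1 \<equiv> res {0, 2} {0, 1, 2}"
abbreviation "d2 \<equiv> res {0, 1} {0, 1, 2}"

lemma edge_standard: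
  assumes "a < b"
  shows "S {a, b} = S {0, 1}" "res {a} {a, b} = src" "res {b} {a, b} = tgt"
proof -
  let ?h = "\<lambda>v::int. if v = 0 then a else b"
  have h: "strict_mono_on {0, 1} ?h" using assms by (auto simp: strict_mono_on_def)
  have im: "?h ` {0, 1} = {a, b}" "?h ` {0} = {a}" "?h ` {1} = {b}" by auto
  show "S {a, b} = S {0, 1}" using S_iso[OF _ h] unfolding im by simp
  show "res {a} {a, b} = src" using res_iso[OF _ h, of "{0}"] unfolding im by (intro ext) simp
  show "res {b} {a, b} = tgt" using res_iso[OF _ h, of "{1}"] unfolding im by (intro ext) simp
qed

lemma triangle_standard:
  assumes "a < b" "b < c"
  shows "S {a, b, c} = S {0, 1, 2}" "res {b, c} {a, b, c} = d0" "res {a, c} {a, b, c} = d1"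
    "res {a, b} {a, b, c} = d2"
proof -
  let ?h = "\<lambda>v::int. if v = 0 then a else if v = 1 then b else c"
  have h: "strict_mono_on {0, 1, 2} ?h" using assms by (auto simp: strict_mono_on_def)
  have im: "?h ` {0, 1, 2} = {a, b, c}" "?h ` {1, 2} = {b, c}" "?h ` {0, 2} = {a, c}" "?h ` {0, 1} = {a, b}"
    by auto
  show "S {a, b, c} = S {0, 1, 2}" using S_iso[OF _ h] unfolding im by simp
  show "res {b, c} {a, b, c} = d0" using res_iso[OF _ h, of "{1, 2}"] unfolding im by (intro ext) simp
  show "res {a, c} {a, b, c} = d1" using res_iso[OF _ h, of "{0, 2}"] unfolding im by (intro ext) simp
  show "res {a, b} {a, b, c} = d2" using res_iso[OF _ h, of "{0, 1}"] unfolding im by (intro ext) simp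
qed

lemma triangle_edges:
  assumes "z \<in> S {0, 1, 2}"
  shows "d0 z \<in> S {0, 1}" "d1 z \<in> S {0, 1}" "d2 z \<in> S {0, 1}"
    and "src (d1 z) = src (d2 z)" "tgt (d2 z) = src (d0 z)" "tgt (d1 z) = tgt (d0 z)"
proof -
  have r: "res {v} {a, b} (res {a, b} {0, 1, 2} z) = res {v} {0, 1, 2} z" if "{a, b} \<subseteq> {0, 1, 2}" "v \<in> {a, b}" for a b v
    using that assms by (intro res_res) auto
  have i: "res {a, b} {0, 1, 2} z \<in> S {a, b}" if "{a, b} \<subseteq> {0, 1, 2}" for a b
    using that assms by (intro res_in) auto
  have e: "S {1, 2} = S {0, 1}" "S {0, 2} = S {0, 1}" "res {1} {1, 2} = src" "res {0} {0, 2} = src"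
    "res {2} {1, 2} = tgt" "res {2} {0, 2} = tgt"
    using edge_standard[of 1 2] edge_standard[of 0 2] by auto
  show "d0 z \<in> S {0, 1}" "d1 z \<in> S {0, 1}" "d2 z \<in> S {0, 1}"
    using i[of 1 2] i[of 0 2] i[of 0 1] e by auto
  show "src (d1 z) = src (d2 z)" "tgt (d2 z) = src (d0 z)" "tgt (d1 z) = tgt (d0 z)"
    using r[of 0 2 0] r[of 0 1 0] r[of 0 1 1] r[of 1 2 1] r[of 0 2 2] r[of 1 2 2] e by simp_all
qed

lemma tetrahedron_edges:
  assumes "z \<in> S {0, 1, 2, 3}"
  shows "d0 (res {1, 2, 3} {0, 1, 2, 3} z) = res {2, 3} {0, 1, 2, 3} z"
    "d1 (res {1, 2, 3} {0, 1, 2, 3} z) = res {1, 3} {0, 1, 2, 3} z"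
    "d2 (res {1, 2, 3} {0, 1, 2, 3} z) = res {1, 2} {0, 1, 2, 3} z"
    "d2 (res {0, 1, 3} {0, 1, 2, 3} z) = res {0, 1} {0, 1, 2, 3} z"
    "d2 (res {0, 2, 3} {0, 1, 2, 3} z) = res {0, 2} {0, 1, 2, 3} z"
    "d0 (res {0, 1, 2} {0, 1, 2, 3} z) = res {1, 2} {0, 1, 2, 3} z"
    "d1 (res {0, 1, 2} {0, 1, 2, 3} z) = res {0, 2} {0, 1, 2, 3} z"
    "d2 (res {0, 1, 2} {0, 1, 2, 3} z) = res {0, 1} {0, 1, 2, 3} z"
proof -
  have r: "res U V (res V {0, 1, 2, 3} z) = res U {0, 1, 2, 3} z" if "V \<subseteq> {0, 1, 2, 3}" "U \<subseteq> V" "U \<noteq> {}" for U V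
    using that assms by (intro res_res) auto
  note e = triangle_standard[of 1 2 3] triangle_standard[of 0 1 3] triangle_standard[of 0 2 3]
  show "d0 (res {1, 2, 3} {0, 1, 2, 3} z) = res {2, 3} {0, 1, 2, 3} z"
    using r[of "{1, 2, 3}" "{2, 3}"] e by simp
  show "d1 (res {1, 2, 3} {0, 1, 2, 3} z) = res {1, 3} {0, 1, 2, 3} z"
    using r[of "{1, 2, 3}" "{1, 3}"] e by simp
  show "d2 (res {1, 2, 3} {0, 1, 2, 3} z) = res {1, 2} {0, 1, 2, 3} z"
    using r[of "{1, 2, 3}" "{1, 2}"] e by simp
  show "d2 (res {0, 1, 3} {0, 1, 2, 3} z) = res {0, 1} {0, 1, 2, 3} z"
    using r[of "{0, 1, 3}" "{0, 1}"] e by simp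
  show "d2 (res {0, 2, 3} {0, 1, 2, 3} z) = res {0, 2} {0, 1, 2, 3} z"
    using r[of "{0, 2, 3}" "{0, 2}"] e by simp
  show "d0 (res {0, 1, 2} {0, 1, 2, 3} z) = res {1, 2} {0, 1, 2, 3} z"
    using r[of "{0, 1, 2}" "{1, 2}"] by simp
  show "d1 (res {0, 1, 2} {0, 1, 2, 3} z) = res {0, 2} {0, 1, 2, 3} z"
    using r[of "{0, 1, 2}" "{0, 2}"] by simp
  show "d2 (res {0, 1, 2} {0, 1, 2, 3} z) = res {0, 1} {0, 1, 2, 3} z"
    using r[of "{0, 1, 2}" "{0, 1}"] by simp
qed

text \<open>
  Every face of the horn lies in a facet \<open>V - {j}\<close>.  Two facets meet in a face of codimension two, so
  compatibility there makes the choice of \<open>j\<close> immaterial.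
\<close>

lemma is_map_of_faces:
  assumes V: "finite V" and y: "\<And>j. j \<in> V - {i} \<Longrightarrow> y j \<in> S (V - {j})"
    and compat: "\<And>j k. j \<in> V - {i} \<Longrightarrow> k \<in> V - {i} \<Longrightarrow> j < k \<Longrightarrow> V - {j, k} \<noteq> {} \<Longrightarrow>
      res (V - {j, k}) (V - {j}) (y j) = res (V - {j, k}) (V - {k}) (y k)"
  shows "\<exists>x. is_map (horn_faces V i) x \<and>
    (\<forall>j\<in>V - {i}. \<forall>U. U \<noteq> {} \<longrightarrow> U \<subseteq> V - {j} \<longrightarrow> x U = res U (V - {j}) (y j))"
proof -
  define c where "c U = (SOME j. j \<in> V - {i} \<and> j \<notin> U)" for U
  define x where "x U = res U (V - {c U}) (y (c U))" for U
  have le: "res U (V - {j}) (y j) = res U (V - {k}) (y k)"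
    if "j \<in> V - {i}" "k \<in> V - {i}" "j < k" "U \<noteq> {}" "U \<subseteq> V - {j, k}" for U j k
  proof -
    have "res U (V - {j, k}) (res (V - {j, k}) (V - {j}) (y j)) = res U (V - {j}) (y j)"
      "res U (V - {j, k}) (res (V - {j, k}) (V - {k}) (y k)) = res U (V - {k}) (y k)"
      using that V y by (auto intro!: res_res)
    moreover have "V - {j, k} \<noteq> {}" using that by auto
    ultimately show ?thesis using compat[OF that(1-3)] by simp
  qed
  have eq: "res U (V - {j}) (y j) = res U (V - {k}) (y k)"
    if "j \<in> V - {i}" "k \<in> V - {i}" "U \<noteq> {}" "U \<subseteq> V - {j, k}" for U j k
    using le[of j k U] le[of k j U] that by (cases j k rule: linorder_cases) (auto simp: insert_commute)
  have c: "c U \<in> V - {i} \<and> c U \<notin> U" if "j \<in> V - {i}" "j \<notin> U" for U j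
    unfolding c_def using someI[of "\<lambda>j. j \<in> V - {i} \<and> j \<notin> U" j] that by blast
  have x: "x U = res U (V - {j}) (y j)" if "j \<in> V - {i}" "U \<noteq> {}" "U \<subseteq> V - {j}" for U j
    unfolding x_def using that c[of j U] by (intro eq) auto
  have "is_map (horn_faces V i) x"
    unfolding is_map_def
  proof (intro ballI conjI allI impI)
    fix W assume W: "W \<in> horn_faces V i"
    then obtain j where j: "j \<in> V - {i}" "W \<subseteq> V - {j}" "W \<noteq> {}" by (auto simp: horn_faces_iff)
    show "finite W" using j V finite_subset by blast
    show "W \<noteq> {}" by fact
    show "x W \<in> S W" using x[OF j(1,3,2)] res_in[of "V - {j}" W] V j y by simp
    fix U assume U: "U \<noteq> {}" "U \<subseteq> W"
    show "U \<in> horn_faces V i" using W U by (auto simp: horn_faces_iff)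
    show "x U = res U W (x W)"
      using x[OF j(1,3,2)] x[of j U] res_res[of "V - {j}" W U "y j"] U j V y by auto
  qed
  then show ?thesis using x by blast
qed

lemma fill_faces:
  assumes V: "finite V" and y: "\<And>j. j \<in> V - {i} \<Longrightarrow> y j \<in> S (V - {j})"
    and compat: "\<And>j k. j \<in> V - {i} \<Longrightarrow> k \<in> V - {i} \<Longrightarrow> j < k \<Longrightarrow> V - {j, k} \<noteq> {} \<Longrightarrow>
      res (V - {j, k}) (V - {j}) (y j) = res (V - {j, k}) (V - {k}) (y k)"
    and i: "i \<in> V"
    and fill: "\<And>x. is_map (horn_faces V i) x \<Longrightarrow>
      (\<And>j U. j \<in> V - {i} \<Longrightarrow> U \<noteq> {} \<Longrightarrow> U \<subseteq> V - {j} \<Longrightarrow> x U = res U (V - {j}) (y j)) \<Longrightarrow> fills V i x"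
  shows "\<exists>z\<in>S V. \<forall>j\<in>V - {i}. res (V - {j}) V z = y j"
proof -
  have "\<exists>x. is_map (horn_faces V i) x \<and>
    (\<forall>j\<in>V - {i}. \<forall>U. U \<noteq> {} \<longrightarrow> U \<subseteq> V - {j} \<longrightarrow> x U = res U (V - {j}) (y j))"
    using V by (rule is_map_of_faces) (rule y compat; assumption)+
  then obtain x where x: "is_map (horn_faces V i) x"
    and xy: "\<forall>j\<in>V - {i}. \<forall>U. U \<noteq> {} \<longrightarrow> U \<subseteq> V - {j} \<longrightarrow> x U = res U (V - {j}) (y j)"
    by (elim exE conjE)
  have "fills V i x" using x by (rule fill) (use xy in simp)
  then obtain z where z: "z \<in> S V" "\<And>U. U \<in> horn_faces V i \<Longrightarrow> res U V z = x U"
    unfolding fills_def by blast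
  have "res (V - {j}) V z = y j" if j: "j \<in> V - {i}" for j
  proof -
    have ne: "V - {j} \<noteq> {}" using j i by auto
    then have "V - {j} \<in> horn_faces V i" using j by (auto simp: horn_faces_iff)
    then show ?thesis
      using z(2) xy[rule_format, OF j ne] res_self[of "V - {j}" "y j"] V ne y[OF j] by simp
  qed
  then show ?thesis using z(1) by blast
qed

lemma triangle_left:
  assumes f: "f \<in> S {0, 1}" "left_inv f" and h: "h \<in> S {0, 1}" "src h = src f"
  shows "\<exists>z\<in>S {0, 1, 2}. d2 z = f \<and> d1 z = h"
proof -
  let ?V = "{0, 1, 2 :: int}" and ?y = "\<lambda>j::int. if j = 1 then h else f"
  have V: "?V - {1} = {0, 2}" "?V - {2} = {0, 1}" "?V - {1, 2} = {0}" "?V - {0} = {1, 2}" by auto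
  note e = edge_standard[of 0 2] edge_standard[of 1 2]
  have "\<exists>z\<in>S ?V. \<forall>j\<in>?V - {0}. res (?V - {j}) ?V z = ?y j"
  proof (rule fill_faces)
    fix x assume x: "is_map (horn_faces ?V 0) x"
      "\<And>j U. j \<in> ?V - {0} \<Longrightarrow> U \<noteq> {} \<Longrightarrow> U \<subseteq> ?V - {j} \<Longrightarrow> x U = res U (?V - {j}) (?y j)"
    have "x {0, 1} = f" using x(2)[of 2 "{0, 1}"] res_self[of "{0, 1}" f] f(1) by (simp add: V)
    then show "fills ?V 0 x"
      using f(2)[unfolded left_inv_def, rule_format, of ?V 0 1 x] x(1) by auto
  qed (use f h e in \<open>auto simp: V\<close>)
  then show ?thesis using V by auto
qed

lemma triangle_right:
  assumes f: "f \<in> S {0, 1}" "right_inv f" and h: "h \<in> S {0, 1}" "tgt h = tgt f"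
  shows "\<exists>z\<in>S {0, 1, 2}. d0 z = f \<and> d1 z = h"
proof -
  let ?V = "{0, 1, 2 :: int}" and ?y = "\<lambda>j::int. if j = 1 then h else f"
  have V: "?V - {1} = {0, 2}" "?V - {0} = {1, 2}" "?V - {0, 1} = {2}" "?V - {2} = {0, 1}" by auto
  note e = edge_standard[of 0 2] edge_standard[of 1 2]
  have "\<exists>z\<in>S ?V. \<forall>j\<in>?V - {2}. res (?V - {j}) ?V z = ?y j"
  proof (rule fill_faces)
    fix x assume x: "is_map (horn_faces ?V 2) x"
      "\<And>j U. j \<in> ?V - {2} \<Longrightarrow> U \<noteq> {} \<Longrightarrow> U \<subseteq> ?V - {j} \<Longrightarrow> x U = res U (?V - {j}) (?y j)"
    have "x {1, 2} = f" using x(2)[of 0 "{1, 2}"] res_self[of "{1, 2}" f] f(1) by (simp add: V e)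
    moreover have "{2, 1} = {1, 2 :: int}" by auto
    ultimately have "x {2, 1} = f" by metis
    then show "fills ?V 2 x"
      by (intro f(2)[unfolded right_inv_def, rule_format, of ?V 2 1 x] x(1)) auto
  qed (use f h e in \<open>auto simp: V\<close>)
  then show ?thesis using V by auto
qed

end

context inner_kan_system
begin

lemma triangle_inner:
  assumes f: "f \<in> S {0, 1}" and g: "g \<in> S {0, 1}" "tgt f = src g"
  shows "\<exists>z\<in>S {0, 1, 2}. d2 z = f \<and> d0 z = g"
proof -
  let ?V = "{0, 1, 2 :: int}" and ?y = "\<lambda>j::int. if j = 0 then g else f"
  have V: "?V - {0} = {1, 2}" "?V - {2} = {0, 1}" "?V - {0, 2} = {1}" "{1, 2 :: int} - {2} = {1}" by auto
  note e = edge_standard[of 1 2]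
  have "\<exists>z\<in>S ?V. \<forall>j\<in>?V - {1}. res (?V - {j}) ?V z = ?y j"
  proof (rule fill_faces)
    fix x assume "is_map (horn_faces ?V 1) x"
    then show "fills ?V 1 x" by (rule inner_fills[where a = 0 and b = 2, rotated -1]) auto
  qed (use f g e in \<open>auto simp: V\<close>)
  then obtain z where z: "z \<in> S ?V" "\<And>j. j \<in> ?V - {1} \<Longrightarrow> res (?V - {j}) ?V z = ?y j" by blast
  have "d0 z = g" "d2 z = f" using z(2)[of 0] z(2)[of 2] by (simp_all add: V)
  then show ?thesis using z(1) by blast
qed

lemma tetrahedron_inner:
  assumes y: "y0 \<in> S {0, 1, 2}" "y2 \<in> S {0, 1, 2}" "y3 \<in> S {0, 1, 2}"
    and compat: "d1 y0 = d0 y2" "d2 y0 = d0 y3" "d2 y2 = d2 y3"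
  shows "\<exists>z\<in>S {0, 1, 2, 3}. res {1, 2, 3} {0, 1, 2, 3} z = y0 \<and> res {0, 1, 3} {0, 1, 2, 3} z = y2 \<and>
    res {0, 1, 2} {0, 1, 2, 3} z = y3"
proof -
  let ?V = "{0, 1, 2, 3 :: int}" and ?y = "\<lambda>j::int. if j = 0 then y0 else if j = 2 then y2 else y3"
  have V: "?V - {0} = {1, 2, 3}" "?V - {2} = {0, 1, 3}" "?V - {3} = {0, 1, 2}"
    "?V - {0, 2} = {1, 3}" "?V - {0, 3} = {1, 2}" "?V - {2, 3} = {0, 1}" by auto
  note e = triangle_standard[of 1 2 3] triangle_standard[of 0 1 3]
  have "\<exists>z\<in>S ?V. \<forall>j\<in>?V - {1}. res (?V - {j}) ?V z = ?y j"
  proof (rule fill_faces)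
    fix x assume "is_map (horn_faces ?V 1) x"
    then show "fills ?V 1 x" by (rule inner_fills[where a = 0 and b = 2, rotated -1]) auto
  next
    fix j k assume "j \<in> ?V - {1}" "k \<in> ?V - {1}" "j < k"
    then consider "j = 0" "k = 2" | "j = 0" "k = 3" | "j = 2" "k = 3" by auto
    then show "res (?V - {j, k}) (?V - {j}) (?y j) = res (?V - {j, k}) (?V - {k}) (?y k)"
      by cases (use compat e in \<open>simp_all add: V\<close>)
  next
    fix j assume "j \<in> ?V - {1}"
    then consider "j = 0" | "j = 2" | "j = 3" by auto
    then show "?y j \<in> S (?V - {j})" by cases (use y e in \<open>simp_all add: V\<close>)
  qed auto
  then obtain z where z: "z \<in> S ?V" "\<And>j. j \<in> ?V - {1} \<Longrightarrow> res (?V - {j}) ?V z = ?y j" by blast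
  have "res (?V - {0}) ?V z = y0" "res (?V - {2}) ?V z = y2" "res (?V - {3}) ?V z = y3"
    using z(2)[of 0] z(2)[of 2] z(2)[of 3] by simp_all
  then show ?thesis unfolding V using z(1) by blast
qed

lemma tetrahedron_right:
  assumes y: "y0 \<in> S {0, 1, 2}" "y1 \<in> S {0, 1, 2}" "y2 \<in> S {0, 1, 2}"
    and compat: "d0 y0 = d0 y1" "d1 y0 = d0 y2" "d1 y1 = d1 y2" and inv: "right_inv (d0 y0)"
  shows "\<exists>z\<in>S {0, 1, 2, 3}. res {1, 2, 3} {0, 1, 2, 3} z = y0 \<and> res {0, 2, 3} {0, 1, 2, 3} z = y1 \<and>
    res {0, 1, 3} {0, 1, 2, 3} z = y2"
proof -
  let ?V = "{0, 1, 2, 3 :: int}" and ?y = "\<lambda>j::int. if j = 0 then y0 else if j = 1 then y1 else y2"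
  have V: "?V - {0} = {1, 2, 3}" "?V - {2} = {0, 1, 3}" "?V - {1} = {0, 2, 3}"
    "?V - {0, 2} = {1, 3}" "?V - {0, 1} = {2, 3}" "?V - {1, 2} = {0, 3}" by auto
  note e = triangle_standard[of 1 2 3] triangle_standard[of 0 1 3] triangle_standard[of 0 2 3]
  have "\<exists>z\<in>S ?V. \<forall>j\<in>?V - {3}. res (?V - {j}) ?V z = ?y j"
  proof (rule fill_faces)
    fix x assume x: "is_map (horn_faces ?V 3) x"
      "\<And>j U. j \<in> ?V - {3} \<Longrightarrow> U \<noteq> {} \<Longrightarrow> U \<subseteq> ?V - {j} \<Longrightarrow> x U = res U (?V - {j}) (?y j)"
    have "x {2, 3} = d0 y0" using x(2)[of 0 "{2, 3}"] e by (simp add: V)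
    moreover have "{3, 2} = {2, 3 :: int}" by auto
    ultimately have "x {3, 2} = d0 y0" by metis
    then show "fills ?V 3 x"
      by (intro inv[unfolded right_inv_def, rule_format, of ?V 3 2 x] x(1)) auto
  next
    fix j k assume "j \<in> ?V - {3}" "k \<in> ?V - {3}" "j < k"
    then consider "j = 0" "k = 1" | "j = 0" "k = 2" | "j = 1" "k = 2" by auto
    then show "res (?V - {j, k}) (?V - {j}) (?y j) = res (?V - {j, k}) (?V - {k}) (?y k)"
      by cases (use compat e in \<open>simp_all add: V\<close>)
  next
    fix j assume "j \<in> ?V - {3}"
    then consider "j = 0" | "j = 1" | "j = 2" by auto
    then show "?y j \<in> S (?V - {j})" by cases (use y e in \<open>simp_all add: V\<close>)
  qed auto
  then obtain z where z: "z \<in> S ?V" "\<And>j. j \<in> ?V - {3} \<Longrightarrow> res (?V - {j}) ?V z = ?y j" by blast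
  have "res (?V - {0}) ?V z = y0" "res (?V - {1}) ?V z = y1" "res (?V - {2}) ?V z = y2"
    using z(2)[of 0] z(2)[of 1] z(2)[of 2] by simp_all
  then show ?thesis unfolding V using z(1) by blast
qed

text \<open>
  The faces of the triangle equal \<open>e\<close> as points, which is stronger than being homotopic to \<open>e\<close>.
\<close>

definition strict_idempotent :: "'a \<Rightarrow> bool" where
  "strict_idempotent e \<longleftrightarrow> (\<exists>G\<in>S {0, 1, 2}. d0 G = e \<and> d1 G = e \<and> d2 G = e)"

lemma strict_idempotent_edge:
  assumes "strict_idempotent e"
  shows "e \<in> S {0, 1}" "tgt e = src e"
proof -
  obtain G where G: "G \<in> S {0, 1, 2}" "d0 G = e" "d1 G = e" "d2 G = e"
    using assms unfolding strict_idempotent_def by blast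
  show "e \<in> S {0, 1}" using triangle_edges(1)[OF G(1)] G(2) by simp
  show "tgt e = src e" using triangle_edges(5)[OF G(1)] G(2,4) by simp
qed

text \<open>
  Units are obtained by dividing \<open>f\<close> by itself: \<open>f \<circ> e = f\<close> at the source and \<open>g \<circ> f = f\<close> at the
  target.
\<close>

lemma units_from_invertible:
  assumes f: "f \<in> S {0, 1}" "invertible f"
  shows "\<exists>e. invertible e \<and> strict_idempotent e \<and> src e = src f"
    and "\<exists>g\<in>S {0, 1}. invertible g \<and> src g = tgt f"
proof -
  have LR: "left_inv f" "right_inv f" using f(2) by (auto simp: invertible_def)
  obtain H1 where H1: "H1 \<in> S {0, 1, 2}" "d0 H1 = f" "d1 H1 = f"
    using triangle_right[OF f(1) LR(2) f(1) refl] by blast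
  obtain H2 where H2: "H2 \<in> S {0, 1, 2}" "d2 H2 = f" "d1 H2 = f"
    using triangle_left[OF f(1) LR(1) f(1) refl] by blast
  \<comment> \<open>The successive edges of this 3-simplex are \<open>e\<close>, \<open>f\<close>, \<open>g\<close>, and \<open>{0, 2}\<close>, \<open>{1, 3}\<close> are both \<open>f\<close>.\<close>
  obtain z where z: "z \<in> S {0, 1, 2, 3}" "res {1, 2, 3} {0, 1, 2, 3} z = H2" "res {0, 1, 2} {0, 1, 2, 3} z = H1"
    using tetrahedron_inner[OF H2(1) H1(1) H1(1)] H1 H2 by auto
  note ez = tetrahedron_edges[OF z(1), unfolded z(2,3)]
  have "invertible (res {0, 2} {0, 1, 2, 3} z)" "invertible (res {1, 3} {0, 1, 2, 3} z)"
    using ez H1 H2 f(2) by auto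
  note inv = invertible_two_of_six[OF z(1) this]
  have e: "invertible (d2 H1)" using inv[of 0 1] ez by simp
  have g: "invertible (d0 H2)" using inv[of 2 3] ez by simp
  \<comment> \<open>All edges into the last vertex are \<open>f\<close>, hence all edges of the face opposite to it are \<open>e\<close>.\<close>
  obtain w where w: "w \<in> S {0, 1, 2, 3}" "res {1, 2, 3} {0, 1, 2, 3} w = H1"
    "res {0, 2, 3} {0, 1, 2, 3} w = H1" "res {0, 1, 3} {0, 1, 2, 3} w = H1"
    using tetrahedron_right[OF H1(1) H1(1) H1(1)] H1 LR(2) by auto
  have "res {0, 1, 2} {0, 1, 2, 3} w \<in> S {0, 1, 2}" using w(1) by (intro res_in) auto
  then have "strict_idempotent (d2 H1)"
    unfolding strict_idempotent_def using tetrahedron_edges[OF w(1)] w by (intro bexI) auto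
  moreover have "src (d2 H1) = src f" using triangle_edges(4)[OF H1(1)] H1 by simp
  ultimately show "\<exists>e. invertible e \<and> strict_idempotent e \<and> src e = src f" using e by blast
  have "src (d0 H2) = tgt f" using triangle_edges(5)[OF H2(1)] H2 by simp
  then show "\<exists>g\<in>S {0, 1}. invertible g \<and> src g = tgt f" using g triangle_edges(1)[OF H2(1)] by blast
qed

text \<open>
  The vertices of the 3-simplex are \<open>y, x, y, x\<close> for \<open>f : x \<rightarrow> y\<close>; its outer edges \<open>{0, 1}\<close> and
  \<open>{2, 3}\<close> are inverses of \<open>f\<close> on the two sides.
\<close>

lemma invertible_between_units:
  assumes f: "f \<in> S {0, 1}" "invertible f"
  shows "\<exists>z\<in>S {0, 1, 2, 3}. res {1, 2} {0, 1, 2, 3} z = f \<and>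
    (\<forall>e\<in>{res {0, 2} {0, 1, 2, 3} z, res {1, 3} {0, 1, 2, 3} z}. invertible e \<and> strict_idempotent e)"
proof -
  have LR: "left_inv f" "right_inv f" using f(2) by (auto simp: invertible_def)
  obtain e where e: "invertible e" "strict_idempotent e" "src e = src f"
    using units_from_invertible(1)[OF f] by blast
  obtain g where g: "g \<in> S {0, 1}" "invertible g" "src g = tgt f"
    using units_from_invertible(2)[OF f] by blast
  obtain e' where e': "invertible e'" "strict_idempotent e'" "src e' = tgt f"
    using units_from_invertible(1)[OF g(1,2)] g(3) by auto
  note se = strict_idempotent_edge[OF e(2)] strict_idempotent_edge[OF e'(2)]
  obtain H where H: "H \<in> S {0, 1, 2}" "d2 H = f" "d1 H = e"
    using triangle_left[OF f(1) LR(1) se(1) e(3)] by blast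
  obtain H' where H': "H' \<in> S {0, 1, 2}" "d0 H' = f" "d1 H' = e'"
    using triangle_right[OF f(1) LR(2) se(3)] se(4) e'(3) by auto
  have "tgt (d2 H') = src e" using triangle_edges(5)[OF H'(1)] H' e(3) by simp
  \<comment> \<open>The face opposite to the vertex 2, needed for a horn at the vertex 1, is a composite of \<open>{0, 1}\<close> and \<open>e\<close>.\<close>
  then obtain G where G: "G \<in> S {0, 1, 2}" "d2 G = d2 H'" "d0 G = e"
    using triangle_inner[OF triangle_edges(3)[OF H'(1)] se(1)] by blast
  obtain z where z: "z \<in> S {0, 1, 2, 3}" "res {1, 2, 3} {0, 1, 2, 3} z = H" "res {0, 1, 2} {0, 1, 2, 3} z = H'"
    using tetrahedron_inner[OF H(1) G(1) H'(1)] G H H' by auto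
  show ?thesis
    using tetrahedron_edges[OF z(1), unfolded z(2,3)] z(1) H H' e e' by (intro bexI[of _ z]) auto
qed

end

section \<open>Increasing lists and finite sets of integers\<close>

lemma delta_s_iff: "s \<in> delta_s m n \<longleftrightarrow> length s = Suc m \<and> sorted_wrt (<) s \<and> set s \<subseteq> {..n}"
  by (auto simp: delta_s_def delta_def strict_sorted_iff)

lemma delta_s_unique: "s \<in> delta_s m n \<Longrightarrow> t \<in> delta_s l k \<Longrightarrow> set s = set t \<Longrightarrow> s = t"
  by (auto simp: delta_s_def delta_def intro: sorted_distinct_set_unique)

lemma card_set_delta_s: "s \<in> delta_s m n \<Longrightarrow> card (set s) = Suc m"
  by (auto simp: delta_s_def delta_def distinct_card)

lemma comp_op_delta_s:
  assumes "\<beta> \<in> delta_s m n" "\<alpha> \<in> delta_s l m"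
  shows "comp_op \<beta> \<alpha> \<in> delta_s l n" "set (comp_op \<beta> \<alpha>) \<subseteq> set \<beta>"
proof -
  have \<alpha>: "i < length \<beta>" if "i \<in> set \<alpha>" for i using that assms by (auto simp: delta_s_iff)
  have "sorted_wrt (\<lambda>i j. \<beta> ! i < \<beta> ! j) \<alpha>"
  proof (rule sorted_wrt_mono_rel)
    show "sorted_wrt (<) \<alpha>" using assms by (simp add: delta_s_iff)
    show "\<beta> ! i < \<beta> ! j" if "i \<in> set \<alpha>" "j \<in> set \<alpha>" "i < j" for i j
      using that \<alpha> assms(1) by (auto simp: delta_s_iff intro: sorted_wrt_nth_less)
  qed
  then show "set (comp_op \<beta> \<alpha>) \<subseteq> set \<beta>" using \<alpha> by (auto simp: comp_op_def)
  then show "comp_op \<beta> \<alpha> \<in> delta_s l n"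
    using \<open>sorted_wrt (\<lambda>i j. \<beta> ! i < \<beta> ! j) \<alpha>\<close> assms by (auto simp: delta_s_iff comp_op_def sorted_wrt_map)
qed

lemma comp_op_assoc:
  assumes "\<beta> \<in> delta_s m n" "\<alpha> \<in> delta_s l m"
  shows "comp_op (comp_op \<gamma> \<beta>) \<alpha> = comp_op \<gamma> (comp_op \<beta> \<alpha>)"
  using assms by (auto simp: comp_op_def delta_s_iff)

lemma ident_delta_s: "ident n \<in> delta_s n n"
  by (auto simp: delta_s_iff ident_def simp del: upt_Suc)

lemma comp_op_ident: "\<alpha> \<in> delta_s m n \<Longrightarrow> comp_op (ident n) \<alpha> = \<alpha>" "\<alpha> \<in> delta_s m n \<Longrightarrow> comp_op \<alpha> (ident m) = \<alpha>"
proof -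
  show "comp_op (ident n) \<alpha> = \<alpha>" if "\<alpha> \<in> delta_s m n"
    unfolding comp_op_def
    by (rule map_idI) (use that in \<open>auto simp: delta_s_iff ident_def subset_iff less_Suc_eq_le simp del: upt_Suc\<close>)
  show "comp_op \<alpha> (ident m) = \<alpha>" if "\<alpha> \<in> delta_s m n"
    using that map_nth[of \<alpha>] by (simp add: comp_op_def ident_def delta_s_iff)
qed

lemma delta_s_top: "\<alpha> \<in> delta_s n n \<Longrightarrow> \<alpha> = ident n"
proof -
  assume a: "\<alpha> \<in> delta_s n n"
  then have "set \<alpha> = {..n}" using card_set_delta_s[OF a] by (intro card_subset_eq) (auto simp: delta_s_iff)
  moreover have "set (ident n) = {..n}" by (auto simp: ident_def)
  ultimately show ?thesis using delta_s_unique[OF a ident_delta_s] by simp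
qed

definition pos :: "int set \<Rightarrow> int \<Rightarrow> nat" where
  "pos V v = card {w \<in> V. w < v}"

text \<open>
  The map of ordinals that the inclusion of \<open>U\<close> into \<open>V\<close> becomes after renumbering both sets.
\<close>

definition incl :: "int set \<Rightarrow> int set \<Rightarrow> nat list" where
  "incl U V = sorted_list_of_set (pos V ` U)"

text \<open>
  The inverse of \<open>incl\<close>: the vertices of \<open>V\<close> at the positions listed in \<open>s\<close>.
\<close>

definition select :: "int set \<Rightarrow> nat list \<Rightarrow> int set" where
  "select V s = {v \<in> V. pos V v \<in> set s}"

lemma pos_less: "finite V \<Longrightarrow> u \<in> V \<Longrightarrow> u < v \<Longrightarrow> pos V u < pos V v"
  unfolding pos_def by (intro psubset_card_mono) auto

lemma pos_less_iff: "finite V \<Longrightarrow> u \<in> V \<Longrightarrow> v \<in> V \<Longrightarrow> pos V u < pos V v \<longleftrightarrow> u < v"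
  using pos_less[of V u v] pos_less[of V v u] by (cases u v rule: linorder_cases) auto

lemma pos_inj: "finite V \<Longrightarrow> inj_on (pos V) V"
  by (intro linorder_inj_onI) (auto dest: pos_less)

lemma pos_less_card: "finite V \<Longrightarrow> v \<in> V \<Longrightarrow> pos V v < card V"
  unfolding pos_def by (intro psubset_card_mono) auto

lemma pos_image: "finite V \<Longrightarrow> pos V ` V = {..<card V}"
  using pos_inj[of V] by (intro card_subset_eq) (auto simp: card_image pos_less_card)

lemma pos_strict_mono_image:
  assumes "strict_mono_on V h" "v \<in> V"
  shows "pos (h ` V) (h v) = pos V v"
proof -
  have "{w \<in> h ` V. w < h v} = h ` {w \<in> V. w < v}"
    using assms strict_mono_on_less[OF assms(1)] by auto
  moreover have "inj_on h {w \<in> V. w < v}"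
    using strict_mono_on_imp_inj_on[OF assms(1)] by (rule inj_on_subset) auto
  ultimately show ?thesis by (simp add: pos_def card_image)
qed

lemma set_incl: "finite V \<Longrightarrow> U \<subseteq> V \<Longrightarrow> set (incl U V) = pos V ` U"
  by (auto simp: incl_def finite_subset)

lemma incl_delta_s:
  assumes "finite V" "U \<subseteq> V" "U \<noteq> {}"
  shows "incl U V \<in> delta_s (card U - 1) (card V - 1)"
proof -
  have fU: "finite U" using assms finite_subset by auto
  have "card (pos V ` U) = card U" using assms pos_inj by (intro card_image) (rule inj_on_subset)
  moreover have "card U > 0" using fU assms(3) by (simp add: card_gt_0_iff)
  moreover have "pos V ` U \<subseteq> {..card V - 1}" using pos_less_card[OF assms(1)] assms(2) by fastforce
  ultimately show ?thesis using fU by (auto simp: delta_s_iff incl_def)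
qed

lemma incl_self: "finite V \<Longrightarrow> V \<noteq> {} \<Longrightarrow> incl V V = ident (card V - 1)"
  using incl_delta_s[of V V] by (auto intro: delta_s_top)

lemma incl_image: "strict_mono_on V h \<Longrightarrow> U \<subseteq> V \<Longrightarrow> incl (h ` U) (h ` V) = incl U V"
proof -
  assume h: "strict_mono_on V h" "U \<subseteq> V"
  then have "pos (h ` V) ` h ` U = pos V ` U"
    using pos_strict_mono_image[OF h(1)] by (auto simp: image_image subset_iff intro!: image_cong)
  then show ?thesis by (simp add: incl_def)
qed

lemma sorted_list_nth_rank:
  fixes A :: "nat set"
  assumes "finite A" "a \<in> A"
  shows "sorted_list_of_set A ! card {b \<in> A. b < a} = a"
proof -
  let ?l = "sorted_list_of_set A"
  obtain i where i: "i < length ?l" "?l ! i = a" using assms by (metis in_set_conv_nth set_sorted_list_of_set)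
  have mono: "?l ! j < ?l ! k \<longleftrightarrow> j < k" if "j < length ?l" "k < length ?l" for j k
    using that strict_sorted_list_of_set[of A] sorted_wrt_nth_less[of "(<)" ?l]
    by (metis linorder_neqE_nat order_less_asym order_less_irrefl)
  have "{b \<in> A. b < a} = {b \<in> set ?l. b < ?l ! i}" using assms i by simp
  also have "\<dots> = (!) ?l ` {..<i}" using mono i(1) by (auto simp: in_set_conv_nth) (metis order_less_trans)
  finally have "card {b \<in> A. b < a} = card ((!) ?l ` {..<i})" by simp
  also have "\<dots> = i"
    using i(1) by (subst card_image) (auto intro!: inj_on_nth)
  finally show ?thesis using i by simp
qed

lemma nth_incl:
  assumes "finite V" "U \<subseteq> V" "w \<in> U"
  shows "incl U V ! pos U w = pos V w"
proof -
  have "{b \<in> pos V ` U. b < pos V w} = pos V ` {u \<in> U. u < w}"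
    using assms pos_less_iff[OF assms(1)] by (auto simp: subset_iff)
  moreover have "inj_on (pos V) {u \<in> U. u < w}"
    using pos_inj[OF assms(1)] by (rule inj_on_subset) (use assms in auto)
  ultimately have "card {b \<in> pos V ` U. b < pos V w} = pos U w"
    by (simp add: card_image pos_def[of U])
  then show ?thesis
    using sorted_list_nth_rank[of "pos V ` U" "pos V w"] assms finite_subset[of U V] by (auto simp: incl_def)
qed

lemma incl_comp:
  assumes "finite V" "U \<subseteq> V" "W \<subseteq> U" "W \<noteq> {}"
  shows "comp_op (incl U V) (incl W U) = incl W V"
proof (rule delta_s_unique)
  have U: "finite U" "U \<noteq> {}" using assms finite_subset by auto
  show "comp_op (incl U V) (incl W U) \<in> delta_s (card W - 1) (card V - 1)"
    using assms U by (intro comp_op_delta_s(1)[where m = "card U - 1"] incl_delta_s) auto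
  show "incl W V \<in> delta_s (card W - 1) (card V - 1)" using assms by (intro incl_delta_s) auto
  have "(!) (incl U V) ` set (incl W U) = pos V ` W"
    using assms U nth_incl[OF assms(1,2)] by (auto simp: set_incl image_image subset_iff intro!: image_cong)
  then show "set (comp_op (incl U V) (incl W U)) = set (incl W V)"
    using assms by (simp add: comp_op_def set_incl)
qed

lemma select_subset: "select V s \<subseteq> V" by (auto simp: select_def)

lemma pos_select:
  assumes "finite V" "V \<noteq> {}" "s \<in> delta_s m (card V - 1)"
  shows "pos V ` select V s = set s"
proof -
  have "card V > 0" using assms by (simp add: card_gt_0_iff)
  then have "set s \<subseteq> pos V ` V" using assms by (auto simp: pos_image delta_s_iff subset_iff)
  then show ?thesis by (auto simp: select_def)
qed

lemma incl_select:
  assumes "finite V" "V \<noteq> {}" "s \<in> delta_s m (card V - 1)"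
  shows "incl (select V s) V = s" "select V s \<noteq> {}" "card (select V s) = Suc m"
proof -
  have s: "sorted_list_of_set (set s) = s" using assms(3)
    by (auto simp: delta_s_def delta_def sorted_list_of_set_sort_remdups distinct_remdups_id sorted_sort_id)
  show "incl (select V s) V = s" using pos_select[OF assms] s by (simp add: incl_def)
  have "inj_on (pos V) (select V s)" using pos_inj[OF assms(1)] select_subset by (rule inj_on_subset)
  then show c: "card (select V s) = Suc m" using pos_select[OF assms] card_set_delta_s[OF assms(3)] by (metis card_image)
  show "select V s \<noteq> {}" using c by auto
qed

lemma select_incl: "finite V \<Longrightarrow> U \<subseteq> V \<Longrightarrow> select V (incl U V) = U"
  using pos_inj[of V] by (auto simp: select_def set_incl inj_on_def)

lemma incl_select_comp:
  assumes V: "finite V" "V \<noteq> {}" and s: "s \<in> delta_s m (card V - 1)" and \<alpha>: "\<alpha> \<in> delta_s l m"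
  shows "select V (comp_op s \<alpha>) \<subseteq> select V s" "incl (select V (comp_op s \<alpha>)) (select V s) = \<alpha>"
proof -
  show sub: "select V (comp_op s \<alpha>) \<subseteq> select V s" using comp_op_delta_s(2)[OF s \<alpha>] by (auto simp: select_def)
  let ?W = "select V (comp_op s \<alpha>)" and ?U = "select V s"
  have c: "comp_op s \<alpha> \<in> delta_s l (card V - 1)" using s \<alpha> by (rule comp_op_delta_s)
  note W = incl_select[OF V c] and U = incl_select[OF V s]
  have fU: "finite ?U" using V(1) select_subset finite_subset by blast
  let ?\<gamma> = "incl ?W ?U"
  have \<gamma>: "?\<gamma> \<in> delta_s l m" using incl_delta_s[OF fU sub W(2)] W(3) U(3) by simp
  have "comp_op s ?\<gamma> = comp_op s \<alpha>"
    using incl_comp[OF V(1) select_subset sub W(2)] W(1) U(1) by simp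
  moreover have "inj_on ((!) s) (set ?\<gamma> \<union> set \<alpha>)"
    by (rule inj_on_nth) (use s \<gamma> \<alpha> in \<open>auto simp: delta_s_iff strict_sorted_iff\<close>)
  ultimately show "?\<gamma> = \<alpha>" unfolding comp_op_def by (rule map_inj_on)
qed

lemma pos_interval: "i \<le> n \<Longrightarrow> pos {0..int n} (int i) = i"
proof -
  assume "i \<le> n"
  then have "{w \<in> {0..int n}. w < int i} = {0..<int i}" by auto
  then show ?thesis by (simp add: pos_def)
qed

lemma incl_interval:
  assumes "s \<in> delta_s m n"
  shows "incl (int ` set s) {0..int n} = s"
proof -
  have "pos {0..int n} ` int ` set s = set s"
    using assms by (force simp: image_image delta_s_iff pos_interval)
  then show ?thesis using assms
    by (auto simp: incl_def delta_s_def delta_def sorted_list_of_set_sort_remdups distinct_remdups_id sorted_sort_id)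
qed

section \<open>The system of points of a semi-simplicial space\<close>

definition pts :: "'a ssspace \<Rightarrow> int set \<Rightarrow> 'a set" where
  "pts X V = cells (space_at X (card V - 1)) 0"

definition restr :: "'a ssspace \<Rightarrow> int set \<Rightarrow> int set \<Rightarrow> 'a \<Rightarrow> 'a" where
  "restr X U V z = pull X (card V - 1) (incl U V) 0 z"

lemma ss_functorD:
  assumes "ss_functor X"
  shows "simplicial_set (space_at X n)"
    and "\<alpha> \<in> delta_s m n \<Longrightarrow> simplicial_map (space_at X n) (space_at X m) (pull X n \<alpha>)"
    and "\<alpha> \<in> delta_s m n \<Longrightarrow> x \<in> cells (space_at X n) k \<Longrightarrow> pull X n \<alpha> k x \<in> cells (space_at X m) k"
    and "x \<in> cells (space_at X n) k \<Longrightarrow> pull X n (ident n) k x = x"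
    and "\<alpha> \<in> delta_s l m \<Longrightarrow> \<beta> \<in> delta_s m n \<Longrightarrow> x \<in> cells (space_at X n) k \<Longrightarrow>
      pull X m \<alpha> k (pull X n \<beta> k x) = pull X n (comp_op \<beta> \<alpha>) k x"
    and "\<alpha> \<in> delta_s m n \<Longrightarrow> \<theta> \<in> delta j k \<Longrightarrow> x \<in> cells (space_at X n) k \<Longrightarrow>
      pull X n \<alpha> j (act (space_at X n) k \<theta> x) = act (space_at X m) k \<theta> (pull X n \<alpha> k x)"
  using assms unfolding ss_functor_def simplicial_map_def by blast+

lemma cells_simplex [simp]: "cells (simplex n) m = delta_s m n" "act (simplex n) m \<alpha> s = comp_op s \<alpha>"
  by (simp_all add: simplex_def)

lemma horn_simps [simp]:
  "s \<in> cells (horn n i) m \<longleftrightarrow> s \<in> delta_s m n \<and> (\<exists>j\<le>n. j \<noteq> i \<and> j \<notin> set s)"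
  "act (horn n i) m \<alpha> s = comp_op s \<alpha>"
  by (simp_all add: simplex_def horn_def)

lemma boundary_simps [simp]:
  "s \<in> cells (boundary n) m \<longleftrightarrow> s \<in> delta_s m n \<and> (\<exists>j\<le>n. j \<notin> set s)"
  "act (boundary n) m \<alpha> s = comp_op s \<alpha>"
  by (simp_all add: simplex_def boundary_def)

lemma map_space_cells:
  "g \<in> cells (map_space A X) k \<longleftrightarrow>
    (\<forall>m. \<forall>s\<in>cells A m. g m s \<in> cells (space_at X m) k) \<and>
    (\<forall>m s. s \<notin> cells A m \<longrightarrow> g m s = undefined) \<and>
    (\<forall>l m. \<forall>\<alpha>\<in>delta_s l m. \<forall>s\<in>cells A m. g l (act A m \<alpha> s) = pull X m \<alpha> k (g m s))"
  by (simp add: map_space_def)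

lemma map_spaceD:
  assumes "g \<in> cells (map_space A X) k"
  shows "s \<in> cells A m \<Longrightarrow> g m s \<in> cells (space_at X m) k"
    and "s \<notin> cells A m \<Longrightarrow> g m s = undefined"
    and "\<alpha> \<in> delta_s l m \<Longrightarrow> s \<in> cells A m \<Longrightarrow> g l (act A m \<alpha> s) = pull X m \<alpha> k (g m s)"
  using assms by (simp_all add: map_space_cells)

lemma map_space_act:
  "act (map_space A X) k \<theta> g m s = (if s \<in> cells A m then act (space_at X m) k \<theta> (g m s) else undefined)"
  by (simp add: map_space_def)

lemma simplex_system_pts: "ss_functor X \<Longrightarrow> simplex_system (pts X) (restr X)"
proof
  assume X: "ss_functor X"
  fix V U z assume *: "finite V" "U \<subseteq> V" "U \<noteq> {}" "z \<in> pts X V"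
  show "restr X U V z \<in> pts X U"
    using * ss_functorD(3)[OF X incl_delta_s] by (simp add: pts_def restr_def)
next
  assume X: "ss_functor X"
  fix V z assume "finite V" "V \<noteq> {}" "z \<in> pts X V"
  then show "restr X V V z = z" using ss_functorD(4)[OF X] by (simp add: pts_def restr_def incl_self)
next
  assume X: "ss_functor X"
  fix V U W z assume *: "finite V" "U \<subseteq> V" "W \<subseteq> U" "W \<noteq> {}" "z \<in> pts X V"
  have U: "finite U" "U \<noteq> {}" using * finite_subset by auto
  show "restr X W U (restr X U V z) = restr X W V z"
    using * U ss_functorD(5)[OF X incl_delta_s[of U W] incl_delta_s[of V U], of z 0]
    by (simp add: pts_def restr_def incl_comp)
next
  fix V :: "int set" and h :: "int \<Rightarrow> int" assume h: "finite V" "strict_mono_on V h"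
  then have card: "card (h ` V) = card V" by (simp add: card_image strict_mono_on_imp_inj_on)
  then show "pts X (h ` V) = pts X V" by (simp add: pts_def)
  fix U z assume "U \<subseteq> V"
  then show "restr X (h ` U) (h ` V) z = restr X U V z" using h card by (simp add: restr_def incl_image)
qed

definition horn_fills :: "'a ssspace \<Rightarrow> nat \<Rightarrow> nat \<Rightarrow> (nat \<Rightarrow> nat list \<Rightarrow> 'a) \<Rightarrow> bool" where
  "horn_fills X n i g \<longleftrightarrow> (\<exists>h\<in>cells (map_space (simplex n) X) 0. restrict_map (horn n i) h = g)"

text \<open>
  Numbering the vertices of \<open>V\<close> by their positions turns the horn at \<open>i\<close> into the horn at \<open>pos V i\<close>.
\<close>

lemma fills_if_horn_fills:
  assumes X: "ss_functor X" and V: "finite V" "card V = Suc n" "i \<in> V"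
    and x: "simplex_system.is_map (pts X) (restr X) (horn_faces V i) x"
    and fill: "\<And>g. g \<in> cells (map_space (horn n (pos V i)) X) 0 \<Longrightarrow>
      (\<And>m s. s \<in> cells (horn n (pos V i)) m \<Longrightarrow> g m s = x (select V s)) \<Longrightarrow> horn_fills X n (pos V i) g"
  shows "simplex_system.fills (pts X) (restr X) V i x"
proof -
  interpret simplex_system "pts X" "restr X" using X by (rule simplex_system_pts)
  let ?H = "horn n (pos V i)"
  define g where "g m s = (if s \<in> cells ?H m then x (select V s) else undefined)" for m s
  have V': "V \<noteq> {}" "card V - 1 = n" using V by auto
  note sub = incl_select[OF V(1) V'(1), unfolded V'(2)] and subc = incl_select_comp[OF V(1) V'(1), unfolded V'(2)]
  have horn: "select V s \<in> horn_faces V i" if "s \<in> cells ?H m" for m s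
  proof -
    obtain j where j: "j \<le> n" "j \<noteq> pos V i" "j \<notin> set s" "s \<in> delta_s m n" using \<open>s \<in> cells ?H m\<close> by auto
    then have "j \<in> pos V ` V" using pos_image[OF V(1)] V(2) by auto
    then obtain v where "v \<in> V" "j = pos V v" by auto
    then have "v \<in> V - {i}" "v \<notin> select V s" using j by (auto simp: select_def)
    then show ?thesis using sub(2)[OF j(4)] select_subset[of V s] by (auto simp: horn_faces_iff)
  qed
  have "g \<in> cells (map_space ?H X) 0"
    unfolding map_space_cells
  proof (intro conjI allI ballI impI)
    fix m s assume s: "s \<in> cells ?H m"
    then show "g m s \<in> cells (space_at X m) 0"
      using is_mapD(3)[OF x horn[OF s]] sub(3)[of s m] by (simp add: g_def pts_def)
  next
    fix l m \<alpha> s assume \<alpha>: "\<alpha> \<in> delta_s l m" and s: "s \<in> cells ?H m"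
    have sn: "s \<in> delta_s m n" using s by simp
    have c: "comp_op s \<alpha> \<in> delta_s l n" "set (comp_op s \<alpha>) \<subseteq> set s" using comp_op_delta_s[OF sn \<alpha>] by auto
    then have "comp_op s \<alpha> \<in> cells ?H l" using s by auto
    moreover have "x (select V (comp_op s \<alpha>)) = restr X (select V (comp_op s \<alpha>)) (select V s) (x (select V s))"
      using is_mapD(5)[OF x horn[OF s]] sub(2)[OF c(1)] subc(1)[OF sn \<alpha>] by simp
    ultimately show "g l (act ?H m \<alpha> s) = pull X m \<alpha> 0 (g m s)"
      using s subc(2)[OF sn \<alpha>] sub(3)[OF sn] by (simp add: g_def restr_def)
  next
    fix m s assume "s \<notin> cells ?H m"
    then show "g m s = undefined" unfolding g_def by (rule if_not_P)
  qed
  then have "horn_fills X n (pos V i) g" by (rule fill) (simp add: g_def)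
  then obtain h where h: "h \<in> cells (map_space (simplex n) X) 0" "restrict_map ?H h = g"
    unfolding horn_fills_def by blast
  show ?thesis
    unfolding fills_def
  proof (intro bexI ballI)
    show "h n (ident n) \<in> pts X V"
      using h(1) ident_delta_s[of n] V' by (auto simp: map_space_cells pts_def)
    fix U assume U: "U \<in> horn_faces V i"
    then have UV: "U \<subseteq> V" "U \<noteq> {}" by (auto simp: horn_faces_iff)
    let ?s = "incl U V"
    have s: "?s \<in> delta_s (card U - 1) n" using incl_delta_s[OF V(1) UV] V' by simp
    obtain v where v: "v \<in> V" "v \<noteq> i" "v \<notin> U" using U by (auto simp: horn_faces_iff)
    then have "pos V v \<noteq> pos V i" "pos V v \<notin> set ?s" "pos V v \<le> n"
      using pos_inj[OF V(1)] V UV pos_less_card[OF V(1), of v] by (auto simp: set_incl inj_on_def)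
    then have sH: "?s \<in> cells ?H (card U - 1)" using s by auto
    have "restr X U V (h n (ident n)) = h (card U - 1) (comp_op (ident n) ?s)"
      using h(1) s ident_delta_s[of n] V' unfolding map_space_cells by (simp add: restr_def)
    also have "\<dots> = h (card U - 1) ?s" using comp_op_ident(1)[OF s] by simp
    also have "\<dots> = g (card U - 1) ?s" unfolding h(2)[symmetric] restrict_map_def using sH by simp
    also have "\<dots> = x U" using sH select_incl[OF V(1) UV(1)] by (simp add: g_def)
    finally show "restr X U V (h n (ident n)) = x U" .
  qed
qed

lemma horn_fills_if_fills:
  assumes X: "ss_functor X" and i: "i \<le> n" and g: "g \<in> cells (map_space (horn n i) X) 0"
    and fill: "\<And>x. simplex_system.is_map (pts X) (restr X) (horn_faces {0..int n} (int i)) x \<Longrightarrow>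
      (\<And>m s. s \<in> cells (horn n i) m \<Longrightarrow> x (int ` set s) = g m s) \<Longrightarrow>
      simplex_system.fills (pts X) (restr X) {0..int n} (int i) x"
  shows "horn_fills X n i g"
proof -
  interpret simplex_system "pts X" "restr X" using X by (rule simplex_system_pts)
  let ?V = "{0..int n}" and ?H = "horn n i"
  have V: "finite ?V" "card ?V - 1 = n" by auto
  define x where "x U = g (card U - 1) (incl U ?V)" for U
  have horn: "incl U ?V \<in> cells ?H (card U - 1)" if "U \<in> horn_faces ?V (int i)" for U
  proof -
    obtain v where v: "v \<in> ?V" "v \<noteq> int i" "v \<notin> U" "U \<subseteq> ?V" "U \<noteq> {}"
      using \<open>U \<in> horn_faces ?V (int i)\<close> unfolding horn_faces_iff by blast
    obtain j where j: "v = int j" "j \<le> n" using v(1) by (metis atLeastAtMost_iff nonneg_int_cases of_nat_le_iff)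
    have "pos ?V v \<notin> set (incl U ?V)"
      using inj_on_image_mem_iff[OF pos_inj[OF V(1)] v(1,4)] v(3,4) by (simp add: set_incl)
    moreover have "pos ?V v = j" "j \<noteq> i" using j v(2) by (auto simp: pos_interval)
    ultimately have "j \<notin> set (incl U ?V)" "j \<noteq> i" "j \<le> n" using j by auto
    then show ?thesis
      using incl_delta_s[OF V(1) v(4,5)] unfolding V(2) by auto
  qed
  have xs: "x (int ` set s) = g m s" if "s \<in> cells ?H m" for m s
    using that incl_interval[of s m n] card_set_delta_s[of s m n] by (simp add: x_def card_image)
  have "is_map (horn_faces ?V (int i)) x"
    unfolding is_map_def
  proof (intro ballI conjI allI impI)
    fix W assume W: "W \<in> horn_faces ?V (int i)"
    then have WV: "W \<subseteq> ?V" "W \<noteq> {}" by (auto simp: horn_faces_iff)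
    then show fW: "finite W" "W \<noteq> {}" using finite_subset by auto
    show "x W \<in> pts X W" using g horn[OF W] by (simp add: map_space_cells x_def pts_def)
    fix U assume U: "U \<noteq> {}" "U \<subseteq> W"
    show "U \<in> horn_faces ?V (int i)" using W U by (auto simp: horn_faces_iff)
    have "g (card U - 1) (act ?H (card W - 1) (incl U W) (incl W ?V)) =
      pull X (card W - 1) (incl U W) 0 (g (card W - 1) (incl W ?V))"
      using g horn[OF W] incl_delta_s[OF fW(1) U(2,1)] unfolding map_space_cells by blast
    then show "x U = restr X U W (x W)"
      using incl_comp[OF V(1) WV(1) U(2,1)] by (simp add: x_def restr_def)
  qed
  then have "fills ?V (int i) x" using xs by (rule fill)
  then obtain z where z: "z \<in> pts X ?V" "\<And>U. U \<in> horn_faces ?V (int i) \<Longrightarrow> restr X U ?V z = x U"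
    unfolding fills_def by blast
  have zn: "z \<in> cells (space_at X n) 0" using z(1) unfolding pts_def V(2) .
  define h where "h m s = (if s \<in> delta_s m n then pull X n s 0 z else undefined)" for m s
  show ?thesis
    unfolding horn_fills_def
  proof (intro bexI ext)
    show "h \<in> cells (map_space (simplex n) X) 0"
      using ss_functorD(3,5)[OF X] zn comp_op_delta_s(1) by (auto simp: map_space_cells h_def)
    fix m s
    show "restrict_map ?H h m s = g m s"
    proof (cases "s \<in> cells ?H m")
      case True
      then have s: "s \<in> delta_s m n" by simp
      obtain j where j: "j \<le> n" "j \<noteq> i" "j \<notin> set s" using True by auto
      then have j': "int j \<in> ?V - {int i}" "int j \<notin> int ` set s" by auto
      have "set s \<noteq> {}" "set s \<subseteq> {..n}" using s by (auto simp: delta_s_iff)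
      then have sV: "int ` set s \<noteq> {}" "int ` set s \<subseteq> ?V" by auto
      have "int ` set s \<in> horn_faces ?V (int i)" unfolding horn_faces_iff using j' sV by blast
      from z(2)[OF this] xs[OF True] have "restr X (int ` set s) ?V z = g m s" by simp
      then show ?thesis using True s incl_interval[OF s] unfolding restr_def V(2) by (simp add: restrict_map_def h_def)
    next
      case False
      then show ?thesis using g by (auto simp: map_space_cells restrict_map_def)
    qed
  qed
qed

section \<open>Lifting paths along restriction\<close>

text \<open>
  The semi-simplicial subsets of the simplex \<open>\<Delta>\<^sup>n\<^sub>s\<close>.
\<close>

definition face_complex :: "nat \<Rightarrow> nat list presheaf \<Rightarrow> bool" where
  "face_complex n A \<longleftrightarrow> (\<forall>m. cells A m \<subseteq> delta_s m n) \<and>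
    (\<forall>l m. \<forall>\<alpha>\<in>delta_s l m. \<forall>s\<in>cells A m. act A m \<alpha> s = comp_op s \<alpha> \<and> comp_op s \<alpha> \<in> cells A l)"

lemma face_complexD:
  assumes "face_complex n A" "s \<in> cells A m"
  shows "s \<in> delta_s m n"
    and "\<alpha> \<in> delta_s l m \<Longrightarrow> act A m \<alpha> s = comp_op s \<alpha>" "\<alpha> \<in> delta_s l m \<Longrightarrow> comp_op s \<alpha> \<in> cells A l"
  using assms unfolding face_complex_def by blast+

lemma face_complex_simplex: "face_complex n (simplex n)"
  by (auto simp: face_complex_def comp_op_delta_s)

lemma face_complex_horn: "face_complex n (horn n i)"
  using comp_op_delta_s unfolding face_complex_def by fastforce

lemma finite_delta_s: "finite (\<Union>m. delta_s m n)"
proof (rule finite_subset)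
  show "(\<Union>m. delta_s m n) \<subseteq> sorted_list_of_set ` Pow {..n}"
  proof
    fix s assume "s \<in> (\<Union>m. delta_s m n)"
    then obtain m where s: "s \<in> delta_s m n" by blast
    then have "s = sorted_list_of_set (set s)"
      by (auto simp: delta_s_def delta_def sorted_list_of_set_sort_remdups distinct_remdups_id sorted_sort_id)
    then show "s \<in> sorted_list_of_set ` Pow {..n}" using s by (auto simp: delta_s_iff)
  qed
qed simp

lemma kan_fibration_path:
  assumes p: "kan_fibration P Q p" and y: "y \<in> cells Q 1" and v: "v \<in> cells P 0" and \<epsilon>: "\<epsilon> \<le> 1"
    and vy: "p 0 v = act Q 1 [\<epsilon>] y"
  shows "\<exists>z\<in>cells P 1. p 1 z = y \<and> act P 1 [\<epsilon>] z = v"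
proof -
  have co: "coface 1 (1 - \<epsilon>) = [\<epsilon>]" using \<epsilon> by (cases \<epsilon>) (auto simp: coface_def)
  have j: "j = 1 - \<epsilon>" if "j \<le> 1" "j \<noteq> \<epsilon>" for j using that \<epsilon> by auto
  note horn = p[unfolded kan_fibration_def, THEN conjunct2, THEN spec[of _ 1], THEN spec[of _ \<epsilon>],
      THEN spec[of _ "\<lambda>_. v"], THEN bspec[OF _ y], THEN mp, THEN mp, THEN mp, THEN mp]
  have "\<exists>z\<in>cells P 1. p 1 z = y \<and> (\<forall>j. j \<le> 1 \<longrightarrow> j \<noteq> \<epsilon> \<longrightarrow> act P 1 (coface 1 j) z = v)"
  proof (rule horn)
    show "\<forall>j. j \<le> 1 \<longrightarrow> j \<noteq> \<epsilon> \<longrightarrow> v \<in> cells P (1 - 1) \<and> p (1 - 1) v = act Q 1 (coface 1 j) y"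
      using v vy co j by auto
    show "\<forall>j k. j < k \<longrightarrow> k \<le> 1 \<longrightarrow> j \<noteq> \<epsilon> \<longrightarrow> k \<noteq> \<epsilon> \<longrightarrow>
      act P (1 - 1) (coface (1 - 1) j) v = act P (1 - 1) (coface (1 - 1) (k - 1)) v"
      using \<epsilon> by auto
  qed (use \<epsilon> in simp_all)
  then obtain z where z: "z \<in> cells P 1" "p 1 z = y"
    "\<And>j. j \<le> 1 \<Longrightarrow> j \<noteq> \<epsilon> \<Longrightarrow> act P 1 (coface 1 j) z = v" by blast
  have "1 - \<epsilon> \<le> 1" "1 - \<epsilon> \<noteq> \<epsilon>" using \<epsilon> by (cases \<epsilon>; simp)+
  from z(3)[OF this] show ?thesis using z(1,2) unfolding co by blast
qed

lemma restrict_map_cells: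
  assumes A: "face_complex n A" and B: "face_complex n B" and AB: "\<And>m. cells A m \<subseteq> cells B m"
    and h: "h \<in> cells (map_space B X) k"
  shows "restrict_map A h \<in> cells (map_space A X) k"
  unfolding map_space_cells
proof (intro conjI allI ballI impI)
  fix m s assume s: "s \<in> cells A m"
  then have sB: "s \<in> cells B m" using AB by blast
  show "restrict_map A h m s \<in> cells (space_at X m) k" using h s sB by (simp add: map_space_cells restrict_map_def)
  fix l \<alpha> assume \<alpha>: "\<alpha> \<in> delta_s l m"
  have "h l (act B m \<alpha> s) = pull X m \<alpha> k (h m s)" using h \<alpha> sB unfolding map_space_cells by blast
  then show "restrict_map A h l (act A m \<alpha> s) = pull X m \<alpha> k (restrict_map A h m s)"
    using face_complexD[OF A s] face_complexD[OF B sB] s \<alpha> by (simp add: restrict_map_def)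
qed (simp add: restrict_map_def)

lemma restrict_map_restrict_map:
  "(\<And>m. cells A m \<subseteq> cells B m) \<Longrightarrow> restrict_map A (restrict_map B h) = restrict_map A h"
  by (intro ext) (auto simp: restrict_map_def)

text \<open>
  The simplices of \<open>B\<close> outside \<open>A\<close> are attached one at a time.  For one simplex, this is the lifting
  of a path along the Kan fibration from \<open>X\<^sub>m\<close> to the matching object.  A simplex outside \<open>A\<close> of
  largest dimension is a proper face of no simplex of \<open>B\<close>, so it can be attached last.
\<close>

lemma path_lifting:
  assumes X: "semisimplicial_space X" and A: "face_complex n A" and \<epsilon>: "\<epsilon> \<le> 1"
    and y: "y \<in> cells (map_space A X) 1"
    and B: "face_complex n B" "\<And>m. cells A m \<subseteq> cells B m"
    and h: "h \<in> cells (map_space B X) 0" "act (map_space A X) 1 [\<epsilon>] y = restrict_map A h"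
  shows "\<exists>y'\<in>cells (map_space B X) 1. restrict_map A y' = y \<and> act (map_space B X) 1 [\<epsilon>] y' = h"
  using B h
proof (induction "card {s. \<exists>m. s \<in> cells B m \<and> s \<notin> cells A m}" arbitrary: B h rule: less_induct)
  case (less B h)
  note B = less.prems(1) and AB = less.prems(2) and h = less.prems(3) and yh = less.prems(4)
  have F: "ss_functor X" and kan: "\<And>m. kan_fibration (space_at X m) (map_space (boundary m) X) (matching_map X m)"
    using X by (auto simp: semisimplicial_space_def)
  let ?D = "\<lambda>B. {s. \<exists>m. s \<in> cells B m \<and> s \<notin> cells A m}"
  have fin: "finite (?D B)"
    by (rule finite_subset[OF _ finite_delta_s[of n]]) (use B in \<open>auto simp: face_complex_def\<close>)
  have yres: "y m s = undefined" if "s \<notin> cells A m" for m s using y that by (simp add: map_space_cells)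
  have yh': "act (space_at X m) 1 [\<epsilon>] (y m s) = h m s" if "s \<in> cells A m" for m s
    using fun_cong[OF fun_cong[OF yh], of m s] that by (simp add: map_space_act restrict_map_def)
  show ?case
  proof (cases "?D B = {}")
    case True
    then have eq: "cells B m = cells A m" for m using AB by blast
    have "y \<in> cells (map_space B X) 1"
      using y face_complexD(2)[OF A] face_complexD(2)[OF B] by (simp add: map_space_cells eq)
    moreover have "restrict_map A y = y" using yres by (intro ext) (simp add: restrict_map_def)
    moreover have "act (map_space B X) 1 [\<epsilon>] y = h"
      using yh' h by (intro ext) (simp add: map_space_act map_space_cells eq)
    ultimately show ?thesis by blast
  next
    case False
    then have "Max (length ` ?D B) \<in> length ` ?D B" using fin by (intro Max_in) auto
    then obtain s where len: "Max (length ` ?D B) = length s" and s: "s \<in> ?D B" by (rule imageE)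
    have max: "length t \<le> length s" if "t \<in> ?D B" for t
      unfolding len[symmetric] using that fin by (intro Max_ge) auto
    obtain m where m: "s \<in> cells B m" "s \<notin> cells A m" using s by blast
    have sm: "s \<in> delta_s m n" using face_complexD(1)[OF B m(1)] .
    have m_unique: "k = m" if "s \<in> cells B k" for k
      using face_complexD(1)[OF B that] sm by (simp add: delta_s_iff)
    define B' where "B' = B\<lparr>cells := \<lambda>k. cells B k - {s}\<rparr>"
    have B'_simps [simp]: "cells B' k = cells B k - {s}" "act B' = act B" for k by (simp_all add: B'_def)
    have top: "comp_op t \<alpha> = s \<longleftrightarrow> t = s \<and> \<alpha> = ident m" if t: "t \<in> cells B k" and \<alpha>: "\<alpha> \<in> delta_s l k" for t \<alpha> k l
    proof
      assume eq: "comp_op t \<alpha> = s"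
      then have "l = m" using face_complexD(3)[OF B t \<alpha>] m_unique by auto
      have "t \<notin> cells A k" using face_complexD(3)[OF A _ \<alpha>, of t] eq m(2) \<open>l = m\<close> by auto
      then have "length t \<le> length s" using max t by blast
      moreover have "length t = Suc k" "length s = Suc m" using face_complexD(1)[OF B t] sm by (simp_all add: delta_s_iff)
      moreover have "length \<alpha> = Suc m" "distinct \<alpha>" "set \<alpha> \<subseteq> {..k}"
        using \<alpha> \<open>l = m\<close> by (auto simp: delta_s_iff strict_sorted_iff)
      then have "Suc m \<le> Suc k" using card_mono[of "{..k}" "set \<alpha>"] distinct_card[of \<alpha>] by simp
      ultimately have "k = m" by simp
      then have "\<alpha> = ident m" using \<alpha> \<open>l = m\<close> delta_s_top by simp
      moreover have "t = s" using eq \<open>\<alpha> = ident m\<close> comp_op_ident(2)[OF face_complexD(1)[OF B t]] \<open>k = m\<close> by simp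
      ultimately show "t = s \<and> \<alpha> = ident m" by simp
    next
      assume "t = s \<and> \<alpha> = ident m"
      then show "comp_op t \<alpha> = s" using comp_op_ident(2)[OF sm] by simp
    qed
    \<comment> \<open>By the choice of \<open>s\<close>, removing it leaves a complex.\<close>
    have B': "face_complex n B'"
      unfolding face_complex_def
    proof (intro conjI allI ballI)
      show "cells B' k \<subseteq> delta_s k n" for k using face_complexD(1)[OF B] by auto
      fix l k \<alpha> t assume \<alpha>: "\<alpha> \<in> delta_s l k" and t: "t \<in> cells B' k"
      then have tB: "t \<in> cells B k" "t \<noteq> s" by auto
      show "act B' k \<alpha> t = comp_op t \<alpha>" using face_complexD(2)[OF B tB(1) \<alpha>] by simp
      show "comp_op t \<alpha> \<in> cells B' l" using face_complexD(3)[OF B tB(1) \<alpha>] top[OF tB(1) \<alpha>] tB(2) by simp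
    qed
    have AB': "cells A k \<subseteq> cells B' k" for k
    proof
      fix t assume t: "t \<in> cells A k"
      then have "t \<in> cells B k" using AB by blast
      moreover have "t \<noteq> s" using m_unique[of k] t m(2) calculation by blast
      ultimately show "t \<in> cells B' k" by simp
    qed
    have "?D B' \<subset> ?D B"
    proof
      show "?D B' \<subseteq> ?D B" by auto
      have "s \<notin> ?D B'" by simp
      then show "?D B' \<noteq> ?D B" using s by blast
    qed
    then have "card (?D B') < card (?D B)" using fin by (rule psubset_card_mono[rotated])
    moreover have "restrict_map B' h \<in> cells (map_space B' X) 0"
      using B' B _ h by (rule restrict_map_cells) auto
    moreover have "act (map_space A X) 1 [\<epsilon>] y = restrict_map A (restrict_map B' h)"
      unfolding yh using AB' by (simp add: restrict_map_restrict_map)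
    ultimately obtain y1 where y1: "y1 \<in> cells (map_space B' X) 1" "restrict_map A y1 = y"
      "act (map_space B' X) 1 [\<epsilon>] y1 = restrict_map B' h"
      using less.hyps[OF _ B' AB'] by blast
    have y1h: "act (space_at X k) 1 [\<epsilon>] (y1 k t) = h k t" if "t \<in> cells B' k" for k t
      using fun_cong[OF fun_cong[OF y1(3)], of k t] that by (simp add: map_space_act restrict_map_def)
    have bd: "comp_op s \<alpha> \<in> cells B' l" if "\<alpha> \<in> cells (boundary m) l" for \<alpha> l
    proof -
      have \<alpha>: "\<alpha> \<in> delta_s l m" using that by simp
      have "\<alpha> \<noteq> ident m" using that by (auto simp: ident_def)
      then show ?thesis using face_complexD(3)[OF B m(1) \<alpha>] top[OF m(1) \<alpha>] by simp
    qed
    define b where "b l \<alpha> = (if \<alpha> \<in> cells (boundary m) l then y1 l (comp_op s \<alpha>) else undefined)" for l \<alpha>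
    have b: "b \<in> cells (map_space (boundary m) X) 1"
      unfolding map_space_cells
    proof (intro conjI allI ballI impI)
      fix l \<alpha> assume \<alpha>: "\<alpha> \<in> cells (boundary m) l"
      then show "b l \<alpha> \<in> cells (space_at X l) 1"
        using y1(1) bd[OF \<alpha>] by (simp add: map_space_cells b_def)
    next
      fix l \<alpha> assume "\<alpha> \<notin> cells (boundary m) l"
      then show "b l \<alpha> = undefined" unfolding b_def by (rule if_not_P)
    next
      fix k l \<beta> \<alpha> assume \<beta>: "\<beta> \<in> delta_s k l" and \<alpha>: "\<alpha> \<in> cells (boundary m) l"
      have \<alpha>m: "\<alpha> \<in> delta_s l m" using \<alpha> by simp
      have "comp_op \<alpha> \<beta> \<in> cells (boundary m) k"
        using \<alpha> comp_op_delta_s[OF \<alpha>m \<beta>] by auto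
      moreover have "y1 k (act B' l \<beta> (comp_op s \<alpha>)) = pull X l \<beta> 1 (y1 l (comp_op s \<alpha>))"
        using y1(1) \<beta> bd[OF \<alpha>] unfolding map_space_cells by blast
      moreover have "act B' l \<beta> (comp_op s \<alpha>) = comp_op s (comp_op \<alpha> \<beta>)"
        using face_complexD(2)[OF B' bd[OF \<alpha>] \<beta>] comp_op_assoc[OF \<alpha>m \<beta>] by simp
      ultimately show "b k (act (boundary m) l \<beta> \<alpha>) = pull X l \<beta> 1 (b l \<alpha>)"
        using \<alpha> by (simp add: b_def)
    qed
    have hs: "h m s \<in> cells (space_at X m) 0" using h m(1) by (simp add: map_space_cells)
    have "matching_map X m 0 (h m s) = act (map_space (boundary m) X) 1 [\<epsilon>] b"
    proof (intro ext)
      fix l \<alpha>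
      show "matching_map X m 0 (h m s) l \<alpha> = act (map_space (boundary m) X) 1 [\<epsilon>] b l \<alpha>"
      proof (cases "\<alpha> \<in> cells (boundary m) l")
        case True
        then have \<alpha>: "\<alpha> \<in> delta_s l m" by simp
        have "pull X m \<alpha> 0 (h m s) = h l (comp_op s \<alpha>)"
          using map_spaceD(3)[OF h \<alpha> m(1)] face_complexD(2)[OF B m(1) \<alpha>] by simp
        then show ?thesis
          using True y1h[OF bd[OF True]] by (simp add: matching_map_def map_space_act b_def)
      next
        case False
        then show ?thesis by (simp only: matching_map_def map_space_act if_False)
      qed
    qed
    then obtain z where z: "z \<in> cells (space_at X m) 1" "matching_map X m 1 z = b"
      "act (space_at X m) 1 [\<epsilon>] z = h m s"
      using kan_fibration_path[OF kan b hs \<epsilon>] by blast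
    have zb: "pull X m \<alpha> 1 z = y1 l (comp_op s \<alpha>)" if "\<alpha> \<in> cells (boundary m) l" for \<alpha> l
      using fun_cong[OF fun_cong[OF z(2)], of l \<alpha>] that by (simp add: matching_map_def b_def)
    define y' where "y' k t = (if t = s \<and> k = m then z else y1 k t)" for k t
    have "y' \<in> cells (map_space B X) 1"
      unfolding map_space_cells
    proof (intro conjI allI ballI impI)
      fix k t assume t: "t \<in> cells B k"
      show "y' k t \<in> cells (space_at X k) 1"
        using t y1(1) z(1) m_unique by (auto simp: y'_def map_space_cells)
    next
      fix k t assume "t \<notin> cells B k"
      then show "y' k t = undefined" using y1(1) m(1) by (auto simp: y'_def map_space_cells)
    next
      fix l k \<alpha> t assume \<alpha>: "\<alpha> \<in> delta_s l k" and t: "t \<in> cells B k"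
      have ac: "act B k \<alpha> t = comp_op t \<alpha>" using face_complexD(2)[OF B t \<alpha>] .
      show "y' l (act B k \<alpha> t) = pull X k \<alpha> 1 (y' k t)"
      proof (cases "t = s")
        case True
        then have km: "k = m" using t m_unique by simp
        show ?thesis
        proof (cases "\<alpha> = ident m")
          case \<alpha>m: True
          then have "l = m" using \<alpha> km by (simp add: delta_s_iff ident_def)
          then show ?thesis
            using True km \<alpha>m z(1) ss_functorD(4)[OF F] top[OF t \<alpha>] ac by (simp add: y'_def)
        next
          case False
          have "\<not> {..m} \<subseteq> set \<alpha>"
          proof
            assume "{..m} \<subseteq> set \<alpha>"
            then have "set \<alpha> = set (ident m)" using \<alpha> km by (auto simp: delta_s_iff ident_def)
            then show False using False delta_s_unique[OF \<alpha> ident_delta_s] by simp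
          qed
          then have "\<alpha> \<in> cells (boundary m) l" using \<alpha> km by auto
          from zb[OF this] have "pull X m \<alpha> 1 z = y1 l (comp_op s \<alpha>)" .
          moreover have "comp_op s \<alpha> \<noteq> s" using top[OF t \<alpha>] True False by simp
          ultimately show ?thesis using True km ac by (simp add: y'_def)
        qed
      next
        case False
        then have t': "t \<in> cells B' k" using t by simp
        have "comp_op t \<alpha> \<noteq> s" using top[OF t \<alpha>] False by simp
        moreover have "y1 l (act B' k \<alpha> t) = pull X k \<alpha> 1 (y1 k t)"
          using y1(1) \<alpha> t' unfolding map_space_cells by blast
        ultimately show ?thesis using ac False by (simp add: y'_def)
      qed
    qed
    moreover have "restrict_map A y' = y"
      unfolding y1(2)[symmetric] using m(2) by (intro ext) (auto simp: restrict_map_def y'_def)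
    moreover have "act (map_space B X) 1 [\<epsilon>] y' = h"
    proof (intro ext)
      fix k t
      show "act (map_space B X) 1 [\<epsilon>] y' k t = h k t"
      proof (cases "t \<in> cells B k")
        case t: True
        have "act (space_at X k) 1 [\<epsilon>] (y' k t) = h k t"
        proof (cases "t = s")
          case True
          then have "k = m" using t m_unique by blast
          then show ?thesis using True z(3) by (simp add: y'_def)
        next
          case False
          then have "t \<in> cells B' k" using t by simp
          from y1h[OF this] show ?thesis using False by (simp add: y'_def)
        qed
        then show ?thesis using t by (simp add: map_space_act)
      next
        case False
        then show ?thesis using map_spaceD(2)[OF h] by (simp add: map_space_act)
      qed
    qed
    ultimately show ?thesis by blast
  qed
qed

section \<open>Connected components of mapping spaces\<close>

lemma same_component_refl: "a \<in> cells P 0 \<Longrightarrow> same_component P a a"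
  by (simp add: same_component_def)

lemma same_component_sym: "same_component P a b \<Longrightarrow> same_component P b a"
  unfolding same_component_def by (auto intro: equivclp_sym)

lemma same_component_trans: "same_component P a b \<Longrightarrow> same_component P b c \<Longrightarrow> same_component P a c"
  unfolding same_component_def by (blast intro: equivclp_trans)

lemma same_component_edge:
  assumes "e \<in> cells P 1" "act P 1 [0] e \<in> cells P 0" "act P 1 [1] e \<in> cells P 0"
  shows "same_component P (act P 1 [0] e) (act P 1 [1] e)"
  using assms unfolding same_component_def by (blast intro: r_into_equivclp)

lemma same_component_induct [consumes 1, case_names base edge]:
  assumes "same_component P a b" and base: "Q a"
    and edge: "\<And>e \<epsilon> \<delta>. e \<in> cells P 1 \<Longrightarrow> \<epsilon> \<le> 1 \<Longrightarrow> \<delta> \<le> 1 \<Longrightarrow> Q (act P 1 [\<epsilon>] e) \<Longrightarrow> Q (act P 1 [\<delta>] e)"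
  shows "Q b"
proof -
  have "equivclp (\<lambda>u v. \<exists>e\<in>cells P 1. act P 1 [0] e = u \<and> act P 1 [1] e = v) a b"
    using assms(1) by (simp add: same_component_def)
  then show ?thesis
  proof (induction rule: equivclp_induct)
    case base
    show ?case by (rule assms(2))
  next
    case (step y z)
    then consider e where "e \<in> cells P 1" "act P 1 [0] e = y" "act P 1 [1] e = z"
      | e where "e \<in> cells P 1" "act P 1 [0] e = z" "act P 1 [1] e = y" by blast
    then show ?case
    proof cases
      case 1
      then show ?thesis using edge[of e 0 1] step.IH by simp
    next
      case 2
      then show ?thesis using edge[of e 1 0] step.IH by simp
    qed
  qed
qed

lemma same_component_map:
  assumes ab: "same_component P a b" and a: "f a \<in> cells Q 0"
    and edge: "\<And>e \<epsilon>. e \<in> cells P 1 \<Longrightarrow> \<epsilon> \<le> 1 \<Longrightarrow> g e \<in> cells Q 1 \<and>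
      f (act P 1 [\<epsilon>] e) = act Q 1 [\<epsilon>] (g e) \<and> act Q 1 [\<epsilon>] (g e) \<in> cells Q 0"
  shows "same_component Q (f a) (f b)"
  using ab
proof (induction rule: same_component_induct)
  case base
  show ?case using a by (rule same_component_refl)
next
  case (edge e \<epsilon> \<delta>)
  have v: "f (act P 1 [\<eta>] e) = act Q 1 [\<eta>] (g e)" "act Q 1 [\<eta>] (g e) \<in> cells Q 0" if "\<eta> \<le> 1" for \<eta>
    using assms(3)[OF edge(1) that] by auto
  have path: "same_component Q (act Q 1 [0] (g e)) (act Q 1 [1] (g e))"
    using assms(3)[OF edge(1), of 0] v(2) by (intro same_component_edge) auto
  have "\<epsilon> = 0 \<or> \<epsilon> = 1" "\<delta> = 0 \<or> \<delta> = 1" using edge(2,3) by auto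
  then have "same_component Q (act Q 1 [\<epsilon>] (g e)) (act Q 1 [\<delta>] (g e))"
    using path same_component_sym[OF path] same_component_refl[OF v(2)[OF edge(2)]] by auto
  then show ?case
    using edge(4) unfolding v(1)[OF edge(2)] v(1)[OF edge(3)] by (rule same_component_trans[rotated])
qed

lemma vertex_delta: "\<epsilon> \<le> 1 \<Longrightarrow> [\<epsilon>] \<in> delta 0 1"
  by (auto simp: delta_def)

lemma presheafD:
  assumes "presheaf_on D P"
  shows "\<alpha> \<in> D m n \<Longrightarrow> x \<in> cells P n \<Longrightarrow> act P n \<alpha> x \<in> cells P m"
    and "x \<in> cells P n \<Longrightarrow> act P n (ident n) x = x"
  using assms unfolding presheaf_on_def by blast+

lemma simplicial_mapD:
  assumes "simplicial_map P Q f"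
  shows "x \<in> cells P n \<Longrightarrow> f n x \<in> cells Q n"
    and "\<alpha> \<in> delta m n \<Longrightarrow> x \<in> cells P n \<Longrightarrow> f m (act P n \<alpha> x) = act Q n \<alpha> (f n x)"
  using assms unfolding simplicial_map_def by blast+

lemma same_component_simplicial_map:
  assumes f: "simplicial_map P Q f" and P: "simplicial_set P" and ab: "same_component P a b"
  shows "same_component Q (f 0 a) (f 0 b)"
  using ab
proof (rule same_component_map[where g = "f 1"])
  show "f 0 a \<in> cells Q 0" using simplicial_mapD(1)[OF f] ab by (simp add: same_component_def)
  show "f 1 e \<in> cells Q 1 \<and> f 0 (act P 1 [\<epsilon>] e) = act Q 1 [\<epsilon>] (f 1 e) \<and> act Q 1 [\<epsilon>] (f 1 e) \<in> cells Q 0"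
    if "e \<in> cells P 1" "\<epsilon> \<le> 1" for e \<epsilon>
    using simplicial_mapD(1)[OF f, of e 1] simplicial_mapD(2)[OF f vertex_delta[OF that(2)] that(1)]
      simplicial_mapD(1)[OF f presheafD(1)[OF P vertex_delta[OF that(2)] that(1)]] that(1) by simp
qed

lemma map_space_act_cells:
  assumes X: "ss_functor X" and A: "face_complex n A" and g: "g \<in> cells (map_space A X) k" and \<theta>: "\<theta> \<in> delta j k"
  shows "act (map_space A X) k \<theta> g \<in> cells (map_space A X) j"
  unfolding map_space_cells
proof (intro conjI allI ballI impI)
  fix m s assume s: "s \<in> cells A m"
  show "act (map_space A X) k \<theta> g m s \<in> cells (space_at X m) j"
    using s presheafD(1)[OF ss_functorD(1)[OF X] \<theta> map_spaceD(1)[OF g s]] by (simp add: map_space_act)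
  fix l \<alpha> assume \<alpha>: "\<alpha> \<in> delta_s l m"
  have "act A m \<alpha> s \<in> cells A l" using face_complexD[OF A s] \<alpha> by simp
  then show "act (map_space A X) k \<theta> g l (act A m \<alpha> s) = pull X m \<alpha> j (act (map_space A X) k \<theta> g m s)"
    using s map_spaceD(3)[OF g \<alpha> s] ss_functorD(6)[OF X \<alpha> \<theta> map_spaceD(1)[OF g s]] by (simp add: map_space_act)
qed (simp add: map_space_act)

text \<open>
  Induction along a zigzag of paths from the restriction of \<open>h\<close> to \<open>g\<close>, lifting one path at a time.
\<close>

lemma homotopy_lifting:
  assumes X: "semisimplicial_space X" and A: "face_complex n A" and B: "face_complex n B"
    and AB: "\<And>m. cells A m \<subseteq> cells B m" and h: "h \<in> cells (map_space B X) 0"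
    and hg: "same_component (map_space A X) (restrict_map A h) g"
  shows "\<exists>h'\<in>cells (map_space B X) 0. restrict_map A h' = g \<and> same_component (map_space B X) h h'"
    (is "?Q g")
proof (rule same_component_induct[where Q = ?Q, OF hg])
  show "?Q (restrict_map A h)" by (intro bexI[of _ h] conjI refl same_component_refl h)
next
  fix e and \<epsilon> \<delta> :: nat
  assume edge: "e \<in> cells (map_space A X) 1" "\<epsilon> \<le> 1" "\<delta> \<le> 1" "?Q (act (map_space A X) 1 [\<epsilon>] e)"
  have F: "ss_functor X" using X by (simp add: semisimplicial_space_def)
  from edge(4) obtain h1 where h1: "h1 \<in> cells (map_space B X) 0"
    "restrict_map A h1 = act (map_space A X) 1 [\<epsilon>] e" "same_component (map_space B X) h h1" by blast
  obtain e' where e': "e' \<in> cells (map_space B X) 1" "restrict_map A e' = e" "act (map_space B X) 1 [\<epsilon>] e' = h1"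
    using path_lifting[OF X A edge(2,1) B AB h1(1) h1(2)[symmetric]] by blast
  let ?v = "\<lambda>\<epsilon>. act (map_space B X) 1 [\<epsilon>] e'"
  have v: "?v \<epsilon> \<in> cells (map_space B X) 0" if "\<epsilon> \<le> 1" for \<epsilon>
    using map_space_act_cells[OF F B e'(1) vertex_delta[OF that]] .
  have path: "same_component (map_space B X) (?v 0) (?v 1)"
    using e'(1) v by (intro same_component_edge) auto
  have "\<epsilon> = 0 \<or> \<epsilon> = 1" "\<delta> = 0 \<or> \<delta> = 1" using edge(2,3) by auto
  then have "same_component (map_space B X) h1 (?v \<delta>)"
    using path same_component_sym[OF path] same_component_refl[OF h1(1)] e'(3) by auto
  moreover have "restrict_map A (?v \<delta>) = act (map_space A X) 1 [\<delta>] e"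
    unfolding e'(2)[symmetric] using AB by (intro ext) (auto simp: restrict_map_def map_space_act)
  ultimately show "?Q (act (map_space A X) 1 [\<delta>] e)"
    using v[OF edge(3)] same_component_trans[OF h1(3)] by blast
qed

text \<open>
  An extension up to homotopy is moved to a strict one by lifting the homotopy on the horn.
\<close>

lemma horn_fills_iff_extends:
  assumes X: "semisimplicial_space X"
  shows "extends_up_to_homotopy (horn n i) (simplex n) X g \<longleftrightarrow> g \<in> cells (map_space (horn n i) X) 0 \<and> horn_fills X n i g"
proof -
  have sub: "cells (horn n i) m \<subseteq> cells (simplex n) m" for m by auto
  show ?thesis
  proof
    assume "extends_up_to_homotopy (horn n i) (simplex n) X g"
    then obtain h where h: "h \<in> cells (map_space (simplex n) X) 0"
      "same_component (map_space (horn n i) X) (restrict_map (horn n i) h) g"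
      unfolding extends_up_to_homotopy_def by blast
    have "\<exists>h'\<in>cells (map_space (simplex n) X) 0. restrict_map (horn n i) h' = g \<and>
      same_component (map_space (simplex n) X) h h'"
      using X face_complex_horn face_complex_simplex sub h by (rule homotopy_lifting)
    then show "g \<in> cells (map_space (horn n i) X) 0 \<and> horn_fills X n i g"
      using h(2) unfolding horn_fills_def same_component_def by blast
  next
    assume "g \<in> cells (map_space (horn n i) X) 0 \<and> horn_fills X n i g"
    then show "extends_up_to_homotopy (horn n i) (simplex n) X g"
      unfolding horn_fills_def extends_up_to_homotopy_def using same_component_refl[of g "map_space (horn n i) X"]
      by metis
  qed
qed

text \<open>
  The face of \<open>\<Delta>\<^sup>n\<^sub>s\<close> spanned by the vertices \<open>c, \<dots>, c + k\<close>.  Maps out of it are the same as simplices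
  of \<open>X\<^sub>k\<close>, so it transports paths in \<open>X\<^sub>k\<close> to paths of maps.
\<close>

definition interval_complex :: "nat \<Rightarrow> nat \<Rightarrow> nat \<Rightarrow> nat list presheaf" where
  "interval_complex n c k = (simplex n)\<lparr>cells := \<lambda>m. {s \<in> delta_s m n. set s \<subseteq> {c..c + k}}\<rparr>"

lemma interval_complex_simps [simp]:
  "s \<in> cells (interval_complex n c k) m \<longleftrightarrow> s \<in> delta_s m n \<and> set s \<subseteq> {c..c + k}"
  "act (interval_complex n c k) m \<alpha> s = comp_op s \<alpha>"
  by (simp_all add: interval_complex_def simplex_def)

lemma face_complex_interval: "face_complex n (interval_complex n c k)"
proof -
  have "comp_op s \<alpha> \<in> cells (interval_complex n c k) l"
    if s: "s \<in> cells (interval_complex n c k) m" and \<alpha>: "\<alpha> \<in> delta_s l m" for s \<alpha> l m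
  proof -
    have "s \<in> delta_s m n" "set s \<subseteq> {c..c + k}" using s by auto
    then show ?thesis using comp_op_delta_s[OF _ \<alpha>] by fastforce
  qed
  moreover have "cells (interval_complex n c k) m \<subseteq> delta_s m n" for m by auto
  moreover have "act (interval_complex n c k) m \<alpha> s = comp_op s \<alpha>" for m \<alpha> s by simp
  ultimately show ?thesis unfolding face_complex_def by blast
qed

definition shift_down :: "nat \<Rightarrow> nat list \<Rightarrow> nat list" where
  "shift_down c s = map (\<lambda>v. v - c) s"

lemma shift_down_delta_s:
  assumes "s \<in> delta_s m n" "set s \<subseteq> {c..c + k}"
  shows "shift_down c s \<in> delta_s m k"
proof -
  have "sorted_wrt (\<lambda>u v. u - c < v - c) s"
    by (rule sorted_wrt_mono_rel[of s "(<)"]) (use assms in \<open>auto simp: delta_s_iff subset_iff diff_less_mono\<close>)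
  then show ?thesis using assms by (auto simp: delta_s_iff shift_down_def sorted_wrt_map subset_iff)
qed

lemma shift_down_comp: "s \<in> delta_s m n \<Longrightarrow> \<alpha> \<in> delta_s l m \<Longrightarrow> shift_down c (comp_op s \<alpha>) = comp_op (shift_down c s) \<alpha>"
  by (auto simp: shift_down_def comp_op_def delta_s_iff subset_iff)

lemma interval_top:
  assumes "c + k \<le> n"
  shows "[c..<Suc (c + k)] \<in> cells (interval_complex n c k) k"
  using assms by (auto simp: delta_s_iff simp del: upt_Suc)

lemma interval_top_comp:
  assumes "s \<in> cells (interval_complex n c k) m"
  shows "comp_op [c..<Suc (c + k)] (shift_down c s) = s"
proof -
  have "comp_op [c..<Suc (c + k)] (shift_down c s) = map (\<lambda>v. [c..<Suc (c + k)] ! (v - c)) s"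
    by (simp add: comp_op_def shift_down_def)
  also have "\<dots> = s" by (rule map_idI) (use assms in \<open>auto simp: subset_iff simp del: upt_Suc\<close>)
  finally show ?thesis .
qed

text \<open>
  A path in \<open>X\<^sub>k\<close> that starts at the value on a face is a path of maps on that face, which lifts to a
  path of maps on all of \<open>B\<close>.
\<close>

lemma move_interval:
  assumes X: "semisimplicial_space X" and B: "face_complex n B" and c: "c + k \<le> n"
    and sub: "\<And>m. cells (interval_complex n c k) m \<subseteq> cells B m" and h: "h \<in> cells (map_space B X) 0"
    and f: "same_component (space_at X k) (h k [c..<Suc (c + k)]) f"
  shows "\<exists>h'\<in>cells (map_space B X) 0. h' k [c..<Suc (c + k)] = f \<and> same_component (map_space B X) h h'"
proof -
  let ?I = "interval_complex n c k" and ?top = "[c..<Suc (c + k)]"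
  have F: "ss_functor X" using X by (simp add: semisimplicial_space_def)
  define ind where "ind q e m s = (if s \<in> cells ?I m then pull X k (shift_down c s) q e else undefined)" for q e m s
  have sd: "shift_down c s \<in> delta_s m k" if "s \<in> cells ?I m" for s m using shift_down_delta_s[of s m n c k] that by simp
  have ind: "ind q e \<in> cells (map_space ?I X) q" if e: "e \<in> cells (space_at X k) q" for q e
    unfolding map_space_cells
  proof (intro conjI allI ballI impI)
    fix m s assume s: "s \<in> cells ?I m"
    show "ind q e m s \<in> cells (space_at X m) q"
      using s ss_functorD(3)[OF F sd[OF s] e] by (simp add: ind_def)
    fix l \<alpha> assume \<alpha>: "\<alpha> \<in> delta_s l m"
    have sc: "comp_op s \<alpha> \<in> cells ?I l" using face_complexD(3)[OF face_complex_interval s \<alpha>] .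
    have "shift_down c (comp_op s \<alpha>) = comp_op (shift_down c s) \<alpha>" using s \<alpha> shift_down_comp by auto
    moreover have "pull X m \<alpha> q (pull X k (shift_down c s) q e) = pull X k (comp_op (shift_down c s) \<alpha>) q e"
      using ss_functorD(5)[OF F \<alpha> sd[OF s] e] .
    moreover have "act ?I m \<alpha> s = comp_op s \<alpha>" by simp
    ultimately show "ind q e l (act ?I m \<alpha> s) = pull X m \<alpha> q (ind q e m s)"
      unfolding ind_def using s sc by presburger
  next
    fix m s assume "s \<notin> cells ?I m"
    then show "ind q e m s = undefined" unfolding ind_def by (rule if_not_P)
  qed
  have top: "?top \<in> cells ?I k" using c by (rule interval_top)
  have shift_top: "shift_down c ?top = ident k"
    using sd[OF top] by (rule delta_s_top)
  have ind_top: "ind q e k ?top = e" if "e \<in> cells (space_at X k) q" for q e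
    using top ss_functorD(4)[OF F that] shift_top unfolding ind_def by simp
  have hI: "restrict_map ?I h \<in> cells (map_space ?I X) 0"
    using face_complex_interval B sub h by (rule restrict_map_cells)
  have "restrict_map ?I h = ind 0 (h k ?top)"
  proof (intro ext)
    fix m s
    show "restrict_map ?I h m s = ind 0 (h k ?top) m s"
    proof (cases "s \<in> cells ?I m")
      case True
      have "restrict_map ?I h m (act ?I k (shift_down c s) ?top) = pull X k (shift_down c s) 0 (restrict_map ?I h k ?top)"
        using map_spaceD(3)[OF hI sd[OF True] top] .
      moreover have "act ?I k (shift_down c s) ?top = s" using interval_top_comp[OF True] by simp
      moreover have "restrict_map ?I h k ?top = h k ?top" unfolding restrict_map_def using top by (rule if_P)
      ultimately have "restrict_map ?I h m s = pull X k (shift_down c s) 0 (h k ?top)" by (simp only:)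
      then show ?thesis unfolding ind_def if_P[OF True] .
    next
      case False
      then show ?thesis by (simp only: restrict_map_def ind_def if_False)
    qed
  qed
  moreover have "same_component (map_space ?I X) (ind 0 (h k ?top)) (ind 0 f)"
    using f
  proof (rule same_component_map[where g = "ind 1"])
    show "ind 0 (h k ?top) \<in> cells (map_space ?I X) 0"
      using f by (intro ind) (simp add: same_component_def)
    fix e and \<epsilon> :: nat assume e: "e \<in> cells (space_at X k) 1" and \<epsilon>: "\<epsilon> \<le> 1"
    have "ind 0 (act (space_at X k) 1 [\<epsilon>] e) = act (map_space ?I X) 1 [\<epsilon>] (ind 1 e)"
    proof (intro ext)
      fix m s
      show "ind 0 (act (space_at X k) 1 [\<epsilon>] e) m s = act (map_space ?I X) 1 [\<epsilon>] (ind 1 e) m s"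
      proof (cases "s \<in> cells ?I m")
        case True
        then show ?thesis
          using ss_functorD(6)[OF F sd[OF True] vertex_delta[OF \<epsilon>] e] by (simp only: ind_def map_space_act if_True)
      next
        case False
        then show ?thesis by (simp only: ind_def map_space_act if_False)
      qed
    qed
    then show "ind 1 e \<in> cells (map_space ?I X) 1 \<and>
      ind 0 (act (space_at X k) 1 [\<epsilon>] e) = act (map_space ?I X) 1 [\<epsilon>] (ind 1 e) \<and>
      act (map_space ?I X) 1 [\<epsilon>] (ind 1 e) \<in> cells (map_space ?I X) 0"
      using ind[OF e] map_space_act_cells[OF F face_complex_interval ind[OF e] vertex_delta[OF \<epsilon>]] by simp
  qed
  ultimately have "same_component (map_space ?I X) (restrict_map ?I h) (ind 0 f)" by (simp only:)
  with X face_complex_interval B sub h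
  have "\<exists>h'\<in>cells (map_space B X) 0. restrict_map ?I h' = ind 0 f \<and> same_component (map_space B X) h h'"
    by (rule homotopy_lifting)
  then obtain h' where h': "h' \<in> cells (map_space B X) 0" "restrict_map ?I h' = ind 0 f"
    "same_component (map_space B X) h h'" by blast
  have "h' k ?top = restrict_map ?I h' k ?top" unfolding restrict_map_def using top by (rule if_P[symmetric])
  also have "\<dots> = f" unfolding h'(2) using f by (intro ind_top) (simp add: same_component_def)
  finally show ?thesis using h' by blast
qed

lemma same_component_eval:
  assumes X: "ss_functor X" and uv: "same_component (map_space A X) u v" and s: "s \<in> cells A m"
  shows "same_component (space_at X m) (u m s) (v m s)"
  using uv
proof (rule same_component_map[where g = "\<lambda>g. g m s"])
  show "u m s \<in> cells (space_at X m) 0" using uv unfolding same_component_def by (blast intro: map_spaceD(1)[OF _ s])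
  fix e and \<epsilon> :: nat assume e: "e \<in> cells (map_space A X) 1" and \<epsilon>: "\<epsilon> \<le> 1"
  show "e m s \<in> cells (space_at X m) 1 \<and> act (map_space A X) 1 [\<epsilon>] e m s = act (space_at X m) 1 [\<epsilon>] (e m s) \<and>
    act (space_at X m) 1 [\<epsilon>] (e m s) \<in> cells (space_at X m) 0"
    using map_spaceD(1)[OF e s] presheafD(1)[OF ss_functorD(1)[OF X] vertex_delta[OF \<epsilon>] map_spaceD(1)[OF e s]] s
    by (simp add: map_space_act)
qed

section \<open>Lifting against the terminal object\<close>

lemma terminal_cells: "g \<in> cells (map_space A terminal_ss) k"
proof -
  have "undefined = ()" by simp
  then show ?thesis by (auto simp: map_space_def terminal_ss_def)
qed

text \<open>
  The projection to the first factor is simplicial; \<open>P\<close> stands for a union of components of the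
  mapping space, such as the maps that preserve a marking.
\<close>

lemma same_component_fibre_product:
  assumes X: "ss_functor X" and A: "face_complex n A"
    and P: "\<And>k. cells P k \<subseteq> cells (map_space A X) k" "act P = act (map_space A X)"
    and ab: "same_component (fibre_product P R p r) (a, w) (b, w')"
  shows "same_component (map_space A X) a b"
proof -
  let ?Q = "fibre_product P R p r"
  have "same_component (map_space A X) (fst (a, w)) (fst (b, w'))"
    using ab
  proof (rule same_component_map[where g = fst])
    have "(a, w) \<in> cells ?Q 0" using ab by (simp add: same_component_def)
    then show "fst (a, w) \<in> cells (map_space A X) 0" using P(1)[of 0] by (auto simp: fibre_product_def)
    fix e and \<epsilon> :: nat assume e: "e \<in> cells ?Q 1" and \<epsilon>: "\<epsilon> \<le> 1"
    then have e1: "fst e \<in> cells (map_space A X) 1" using P(1)[of 1] by (auto simp: fibre_product_def)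
    have "fst (act ?Q 1 [\<epsilon>] e) = act (map_space A X) 1 [\<epsilon>] (fst e)"
      using P(2) by (cases e) (simp add: fibre_product_def)
    then show "fst e \<in> cells (map_space A X) 1 \<and> fst (act ?Q 1 [\<epsilon>] e) = act (map_space A X) 1 [\<epsilon>] (fst e) \<and>
      act (map_space A X) 1 [\<epsilon>] (fst e) \<in> cells (map_space A X) 0"
      using e1 map_space_act_cells[OF X A e1 vertex_delta[OF \<epsilon>]] by simp
  qed
  then show ?thesis by simp
qed

text \<open>
  The factor that belongs to the terminal object is a point, so the lifting property says that every
  horn extends up to homotopy, and hence strictly.
\<close>

lemma inner_kan_iff:
  assumes X: "semisimplicial_space X"
  shows "inner_kan X \<longleftrightarrow> (\<forall>n i. \<forall>g\<in>cells (map_space (horn n i) X) 0. 0 < i \<longrightarrow> i < n \<longrightarrow> horn_fills X n i g)"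
proof -
  have F: "ss_functor X" using X by (simp add: semisimplicial_space_def)
  have "rlp (horn n i) (simplex n) X terminal_ss to_terminal \<longleftrightarrow>
    (\<forall>g\<in>cells (map_space (horn n i) X) 0. horn_fills X n i g)" for n i
  proof -
    let ?A = "horn n i" and ?B = "simplex n"
    let ?Q = "fibre_product (map_space ?A X) (map_space ?B terminal_ss) (post_compose ?A to_terminal) (\<lambda>_. restrict_map ?A)"
    have mem: "(u, w) \<in> cells ?Q 0 \<longleftrightarrow> u \<in> cells (map_space ?A X) 0" for u w
      using terminal_cells[of w ?B 0] by (auto simp: fibre_product_def fun_eq_iff)
    show ?thesis
    proof (intro iffI ballI)
      fix g assume rlp: "rlp ?A ?B X terminal_ss to_terminal" and g: "g \<in> cells (map_space ?A X) 0"
      define w where "w = (\<lambda>(m::nat) (s::nat list). ())"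
      have "(g, w) \<in> cells ?Q 0" using g mem by simp
      then obtain h where h: "h \<in> cells (map_space ?B X) 0"
        "same_component ?Q (restrict_map ?A h, post_compose ?B to_terminal 0 h) (g, w)"
        using rlp unfolding rlp_def pi0_surjective_def by blast
      have "same_component (map_space ?A X) (restrict_map ?A h) g"
        using F face_complex_horn _ _ h(2) by (rule same_component_fibre_product) simp_all
      then have "extends_up_to_homotopy ?A ?B X g" using h(1) unfolding extends_up_to_homotopy_def by blast
      then show "horn_fills X n i g" using horn_fills_iff_extends[OF X] by blast
    next
      assume fill: "\<forall>g\<in>cells (map_space ?A X) 0. horn_fills X n i g"
      show "rlp ?A ?B X terminal_ss to_terminal"
        unfolding rlp_def pi0_surjective_def
      proof
        fix b assume b: "b \<in> cells ?Q 0"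
        obtain g w where gw: "b = (g, w)" by (cases b)
        then have "g \<in> cells (map_space ?A X) 0" using b mem by blast
        then obtain h where h: "h \<in> cells (map_space ?B X) 0" "restrict_map ?A h = g"
          using fill unfolding horn_fills_def by blast
        have "post_compose ?B to_terminal 0 h = w" by (auto simp: fun_eq_iff)
        then have "(restrict_map ?A h, post_compose ?B to_terminal 0 h) = b" using h gw by simp
        then show "\<exists>a\<in>cells (map_space ?B X) 0. same_component ?Q (restrict_map ?A a, post_compose ?B to_terminal 0 a) b"
          using h(1) same_component_refl[OF b] by metis
      qed
    qed
  qed
  then show ?thesis unfolding inner_kan_def by metis
qed

lemma marked_map_space_cells:
  assumes F: "ss_functor (fst Z)" and A: "snd A \<subseteq> cells (fst A) 1"
  shows "g \<in> cells (marked_map_space A Z) 0 \<longleftrightarrow>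
    g \<in> cells (map_space (fst A) (fst Z)) 0 \<and> (\<forall>e\<in>snd A. g 1 e \<in> snd Z)"
proof -
  have "act (space_at (fst Z) 1) 0 [0] (g 1 e) = g 1 e" if "g \<in> cells (map_space (fst A) (fst Z)) 0" "e \<in> snd A" for e
  proof -
    have "g 1 e \<in> cells (space_at (fst Z) 1) 0" using map_spaceD(1)[OF that(1), of e 1] A that(2) by auto
    then show ?thesis using presheafD(2)[OF ss_functorD(1)[OF F]] by (fastforce simp: ident_def)
  qed
  then show ?thesis by (auto simp: marked_map_space_def)
qed

text \<open>
  For marked lifting problems the two directions are kept apart: solutions up to homotopy are
  extracted from the lifting property, and strict solutions are fed into it.
\<close>

lemma
  assumes F: "ss_functor (fst Z)" and A: "face_complex n (fst A)"
  shows marked_rlp_terminalD: "\<lbrakk>marked_rlp A B Z (sharp terminal_ss) to_terminal; u \<in> cells (marked_map_space A Z) 0\<rbrakk> \<Longrightarrow>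
      \<exists>h\<in>cells (marked_map_space B Z) 0. same_component (map_space (fst A) (fst Z)) (restrict_map (fst A) h) u"
    and marked_rlp_terminalI: "(\<And>u. u \<in> cells (marked_map_space A Z) 0 \<Longrightarrow>
      \<exists>h\<in>cells (marked_map_space B Z) 0. restrict_map (fst A) h = u) \<Longrightarrow>
      marked_rlp A B Z (sharp terminal_ss) to_terminal"
proof -
  let ?T = "sharp terminal_ss"
  let ?Q = "fibre_product (marked_map_space A Z) (marked_map_space B ?T)
    (post_compose (fst A) to_terminal) (\<lambda>_. restrict_map (fst A))"
  have "w \<in> cells (marked_map_space B ?T) 0" for w
    using terminal_cells[of w "fst B" 0] by (simp add: marked_map_space_def sharp_def terminal_ss_def)
  then have mem: "(u, w) \<in> cells ?Q 0 \<longleftrightarrow> u \<in> cells (marked_map_space A Z) 0" for u w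
    by (auto simp: fibre_product_def fun_eq_iff)
  show "\<exists>h\<in>cells (marked_map_space B Z) 0. same_component (map_space (fst A) (fst Z)) (restrict_map (fst A) h) u"
    if rlp: "marked_rlp A B Z ?T to_terminal" and u: "u \<in> cells (marked_map_space A Z) 0"
  proof -
    define w where "w = (\<lambda>(m::nat) (s::nat list). ())"
    have "(u, w) \<in> cells ?Q 0" using u mem by simp
    then obtain h where h: "h \<in> cells (marked_map_space B Z) 0"
      "same_component ?Q (restrict_map (fst A) h, post_compose (fst B) to_terminal 0 h) (u, w)"
      using rlp unfolding marked_rlp_def pi0_surjective_def by blast
    have "same_component (map_space (fst A) (fst Z)) (restrict_map (fst A) h) u"
      using F A _ _ h(2) by (rule same_component_fibre_product) (auto simp: marked_map_space_def)
    then show ?thesis using h(1) by blast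
  qed
  show "marked_rlp A B Z ?T to_terminal"
    if fill: "\<And>u. u \<in> cells (marked_map_space A Z) 0 \<Longrightarrow>
      \<exists>h\<in>cells (marked_map_space B Z) 0. restrict_map (fst A) h = u"
    unfolding marked_rlp_def pi0_surjective_def
  proof
    fix b assume b: "b \<in> cells ?Q 0"
    obtain g w where gw: "b = (g, w)" by (cases b)
    then have "g \<in> cells (marked_map_space A Z) 0" using b mem by blast
    then obtain h where h: "h \<in> cells (marked_map_space B Z) 0" "restrict_map (fst A) h = g"
      using fill by blast
    have "post_compose (fst B) to_terminal 0 h = w" by (auto simp: fun_eq_iff)
    then have "(restrict_map (fst A) h, post_compose (fst B) to_terminal 0 h) = b" using h gw by simp
    then show "\<exists>a\<in>cells (marked_map_space B Z) 0.
        same_component ?Q (restrict_map (fst A) a, post_compose (fst B) to_terminal 0 a) b"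
      using h(1) same_component_refl[OF b] by metis
  qed
qed

section \<open>Equivalences as invertible edges\<close>

lemma inner_kan_system_pts:
  assumes X: "semisimplicial_space X" and kan: "inner_kan X"
  shows "inner_kan_system (pts X) (restr X)"
proof -
  have F: "ss_functor X" using X by (simp add: semisimplicial_space_def)
  interpret simplex_system "pts X" "restr X" using F by (rule simplex_system_pts)
  show ?thesis
  proof
    fix V a i b x
    assume V: "finite V" "a \<in> V" "i \<in> V" "b \<in> V" "a < i" "i < b" and x: "is_map (horn_faces V i) x"
    have "card V > 0" using V(1,2) by (auto simp: card_gt_0_iff)
    then have "card V = Suc (card V - 1)" by simp
    with F V(1) show "fills V i x"
      using V(3) x
    proof (rule fills_if_horn_fills)
      fix g assume g: "g \<in> cells (map_space (horn (card V - 1) (pos V i)) X) 0"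
      have "0 < pos V i" using pos_less[OF V(1,2,5)] by simp
      moreover have "pos V i < card V - 1" using pos_less[OF V(1,3,6)] pos_less_card[OF V(1,4)] by simp
      ultimately show "horn_fills X (card V - 1) (pos V i) g" using kan g unfolding inner_kan_iff[OF X] by blast
    qed
  qed
qed

lemma outer_horn_edges:
  assumes "2 \<le> n"
  shows "[0..<Suc (0 + 1)] = [0, 1]" "[n - 1..<Suc (n - 1 + 1)] = [n - 1, n]"
    and "cells (interval_complex n 0 1) m \<subseteq> cells (horn n 0) m"
    and "cells (interval_complex n (n - 1) 1) m \<subseteq> cells (horn n n) m"
proof -
  show "[0..<Suc (0 + 1)] = [0, 1]" by simp
  have "Suc (n - 1) = n" "n - 1 + 1 = n" "n - 1 < Suc n" "n - 1 < n" using assms by auto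
  then show "[n - 1..<Suc (n - 1 + 1)] = [n - 1, n]" by (simp add: upt_conv_Cons)
  show "cells (interval_complex n 0 1) m \<subseteq> cells (horn n 0) m"
  proof
    fix s assume "s \<in> cells (interval_complex n 0 1) m"
    then have "s \<in> delta_s m n" "2 \<notin> set s" by auto
    then show "s \<in> cells (horn n 0) m" using assms by (auto intro!: exI[of _ 2])
  qed
  show "cells (interval_complex n (n - 1) 1) m \<subseteq> cells (horn n n) m"
  proof
    fix s assume "s \<in> cells (interval_complex n (n - 1) 1) m"
    then have "s \<in> delta_s m n" "0 \<notin> set s" using assms by auto
    then show "s \<in> cells (horn n n) m" using assms by (auto intro!: exI[of _ 0])
  qed
qed

text \<open>
  A horn whose distinguished edge is homotopic to \<open>f\<close> is homotopic to one whose edge equals \<open>f\<close>, and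
  the filler of the latter extends the former up to homotopy.
\<close>

lemma outer_horn_extends:
  assumes X: "semisimplicial_space X" and n: "c + 1 \<le> n"
    and sub: "\<And>m. cells (interval_complex n c 1) m \<subseteq> cells (horn n i) m"
    and g: "g \<in> cells (map_space (horn n i) X) 0"
    and f: "same_component (space_at X 1) (g 1 [c..<Suc (c + 1)]) f"
    and fill: "\<And>g. g \<in> cells (map_space (horn n i) X) 0 \<Longrightarrow> g 1 [c..<Suc (c + 1)] = f \<Longrightarrow> horn_fills X n i g"
  shows "extends_up_to_homotopy (horn n i) (simplex n) X g"
proof -
  obtain g' where g': "g' \<in> cells (map_space (horn n i) X) 0" "g' 1 [c..<Suc (c + 1)] = f"
    "same_component (map_space (horn n i) X) g g'"
    using move_interval[OF X face_complex_horn n sub g f] by blast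
  then show ?thesis
    using fill[OF g'(1,2)] same_component_sym[OF g'(3)]
    unfolding horn_fills_def extends_up_to_homotopy_def by blast
qed

text \<open>
  The definition of an equivalence allows horns whose edge is only homotopic to \<open>f\<close> and asks for
  extensions up to homotopy; by path lifting, horns with edge \<open>f\<close> and strict fillers suffice.
\<close>

lemma equivalence_edge_iff:
  assumes X: "semisimplicial_space X"
  shows "equivalence_edge X f \<longleftrightarrow> f \<in> cells (space_at X 1) 0 \<and>
    simplex_system.left_inv (pts X) (restr X) f \<and> simplex_system.right_inv (pts X) (restr X) f"
proof -
  have F: "ss_functor X" using X by (simp add: semisimplicial_space_def)
  interpret simplex_system "pts X" "restr X" using F by (rule simplex_system_pts)
  show ?thesis
  proof
    assume f: "equivalence_edge X f"
    have fX: "f \<in> cells (space_at X 1) 0" using f by (simp add: equivalence_edge_def)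
    have "left_inv f"
      unfolding left_inv_def
    proof (intro allI impI)
      fix V a b x
      assume V: "finite V" "a \<in> V" "b \<in> V" "a < b" "\<forall>v\<in>V - {a, b}. b < v" "V - {a, b} \<noteq> {}"
        and x: "is_map (horn_faces V a) x" "x {a, b} = f"
      let ?n = "card V - 1"
      have "card (V - {a, b}) > 0" using V(1,6) by (simp add: card_gt_0_iff)
      then have n: "2 \<le> ?n" using V(1-4) by (simp add: card_Diff_subset)
      then have cV: "card V = Suc ?n" by simp
      have cases: "w = a \<or> w = b \<or> b < w" if "w \<in> V" for w using V(5) that by blast
      have "{w \<in> V. w < a} = {}" using V(4) by (auto dest: cases)
      moreover have "{w \<in> V. w < b} = {a}" using V(2,4) by (auto dest: cases)
      ultimately have pos: "pos V a = 0" "pos V b = 1" unfolding pos_def by (simp_all only: card.empty card_1_singleton_iff) auto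
      have only: "v = a \<or> v = b" if "v \<in> V" "pos V v \<le> 1" for v
      proof (rule ccontr)
        assume "\<not> (v = a \<or> v = b)"
        then have "pos V b < pos V v" using V that by (intro pos_less) auto
        then show False using that pos by simp
      qed
      have "select V [0, 1] \<subseteq> {a, b}"
      proof
        fix v assume "v \<in> select V [0, 1]"
        then have "v \<in> V" "pos V v \<le> 1" by (auto simp: select_def)
        then show "v \<in> {a, b}" using only by blast
      qed
      moreover have "{a, b} \<subseteq> select V [0, 1]" using V(2,3) pos by (simp add: select_def)
      ultimately have sub: "select V [0, 1] = {a, b}" by (rule subset_antisym)
      show "fills V a x"
        using F V(1) cV V(2) x(1)
      proof (rule fills_if_horn_fills)
        fix g assume g: "g \<in> cells (map_space (horn ?n (pos V a)) X) 0"
          and gx: "\<And>m s. s \<in> cells (horn ?n (pos V a)) m \<Longrightarrow> g m s = x (select V s)"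
        have "[0, 1] \<in> cells (horn ?n (pos V a)) 1" using n pos by (auto simp: delta_s_iff intro!: exI[of _ 2])
        then have "g 1 [0, 1] = f" using gx[of "[0, 1]" 1] sub x(2) by simp
        then have "extends_up_to_homotopy (horn ?n 0) (simplex ?n) X g"
          using f n g pos same_component_refl[OF fX] by (simp add: equivalence_edge_def)
        then show "horn_fills X ?n (pos V a) g" using horn_fills_iff_extends[OF X] pos by simp
      qed
    qed
    moreover have "right_inv f"
      unfolding right_inv_def
    proof (intro allI impI)
      fix V a b x
      assume V: "finite V" "a \<in> V" "b \<in> V" "b < a" "\<forall>v\<in>V - {a, b}. v < b" "V - {a, b} \<noteq> {}"
        and x: "is_map (horn_faces V a) x" "x {a, b} = f"
      let ?n = "card V - 1"
      have "card (V - {a, b}) > 0" using V(1,6) by (simp add: card_gt_0_iff)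
      then have n: "2 \<le> ?n" using V(1-4) by (simp add: card_Diff_subset)
      then have cV: "card V = Suc ?n" by simp
      have cases: "w = a \<or> w = b \<or> w < b" if "w \<in> V" for w using V(5) that by blast
      have "{w \<in> V. w < a} = V - {a}" using V(4) by (auto dest: cases)
      moreover have "{w \<in> V. w < b} = V - {a, b}" using V(4) by (auto dest: cases)
      ultimately have pos: "pos V a = ?n" "pos V b = ?n - 1" using V(1-4) by (simp_all add: pos_def card_Diff_subset)
      have only: "v = a \<or> v = b" if "v \<in> V" "?n - 1 \<le> pos V v" for v
      proof (rule ccontr)
        assume "\<not> (v = a \<or> v = b)"
        then have "pos V v < pos V b" using V that by (intro pos_less) auto
        then show False using that pos by simp
      qed
      have "select V [?n - 1, ?n] \<subseteq> {a, b}"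
      proof
        fix v assume "v \<in> select V [?n - 1, ?n]"
        then have "v \<in> V" "?n - 1 \<le> pos V v" by (auto simp: select_def)
        then show "v \<in> {a, b}" using only by blast
      qed
      moreover have "{a, b} \<subseteq> select V [?n - 1, ?n]" using V(2,3) pos by (simp add: select_def)
      ultimately have sub: "select V [?n - 1, ?n] = {a, b}" by (rule subset_antisym)
      show "fills V a x"
        using F V(1) cV V(2) x(1)
      proof (rule fills_if_horn_fills)
        fix g assume g: "g \<in> cells (map_space (horn ?n (pos V a)) X) 0"
          and gx: "\<And>m s. s \<in> cells (horn ?n (pos V a)) m \<Longrightarrow> g m s = x (select V s)"
        have "[?n - 1, ?n] \<in> cells (horn ?n (pos V a)) 1" using n pos by (auto simp: delta_s_iff intro!: exI[of _ 0])
        then have "g 1 [?n - 1, ?n] = f" using gx[of "[?n - 1, ?n]" 1] sub x(2) by simp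
        then have "same_component (space_at X 1) (g 1 [?n - 1, ?n]) f" using same_component_refl[OF fX] by simp
        then have "extends_up_to_homotopy (horn ?n ?n) (simplex ?n) X g"
          using f n g unfolding pos equivalence_edge_def by blast
        then show "horn_fills X ?n (pos V a) g" using horn_fills_iff_extends[OF X] pos by simp
      qed
    qed
    ultimately show "f \<in> cells (space_at X 1) 0 \<and> left_inv f \<and> right_inv f" using fX by simp
  next
    assume f: "f \<in> cells (space_at X 1) 0 \<and> left_inv f \<and> right_inv f"
    then have L: "left_inv f" and R: "right_inv f" by simp_all
    have "extends_up_to_homotopy (horn n 0) (simplex n) X g"
      if n: "2 \<le> n" and g: "g \<in> cells (map_space (horn n 0) X) 0" "same_component (space_at X 1) (g 1 [0, 1]) f" for n g
    proof (rule outer_horn_extends[OF X, of 0 n 0 g f])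
      show "same_component (space_at X 1) (g 1 [0..<Suc (0 + 1)]) f" using g(2) by simp
      fix g' assume g': "g' \<in> cells (map_space (horn n 0) X) 0" "g' 1 [0..<Suc (0 + 1)] = f"
      show "horn_fills X n 0 g'"
        using F _ g'(1)
      proof (rule horn_fills_if_fills)
        fix x assume x: "is_map (horn_faces {0..int n} (int 0)) x"
          "\<And>m s. s \<in> cells (horn n 0) m \<Longrightarrow> x (int ` set s) = g' m s"
        have "[0, 1] \<in> cells (horn n 0) 1" using n by (auto simp: delta_s_iff intro!: exI[of _ 2])
        then have "x {0, 1} = f" using x(2)[of "[0, 1]" 1] g'(2) by simp
        have "fills {0..int n} 0 x"
        proof (rule L[unfolded left_inv_def, rule_format, of "{0..int n}" 0 1 x])
          show "is_map (horn_faces {0..int n} 0) x" using x(1) by simp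
          have "2 \<in> {0..int n} - {0, 1}" using n by simp
          then show "{0..int n} - {0, 1} \<noteq> {}" by blast
        qed (use n \<open>x {0, 1} = f\<close> in auto)
        then show "fills {0..int n} (int 0) x" by simp
      qed simp
    qed (use n g outer_horn_edges in auto)
    moreover have "extends_up_to_homotopy (horn n n) (simplex n) X g"
      if n: "2 \<le> n" and g: "g \<in> cells (map_space (horn n n) X) 0" "same_component (space_at X 1) (g 1 [n - 1, n]) f" for n g
    proof (rule outer_horn_extends[OF X, of "n - 1" n n g f])
      note top = outer_horn_edges(2)[OF n]
      show "same_component (space_at X 1) (g 1 [n - 1..<Suc (n - 1 + 1)]) f" using g(2) unfolding top .
      show "n - 1 + 1 \<le> n" using n by simp
      fix g' assume g': "g' \<in> cells (map_space (horn n n) X) 0" "g' 1 [n - 1..<Suc (n - 1 + 1)] = f"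
      show "horn_fills X n n g'"
        using F _ g'(1)
      proof (rule horn_fills_if_fills)
        fix x assume x: "is_map (horn_faces {0..int n} (int n)) x"
          "\<And>m s. s \<in> cells (horn n n) m \<Longrightarrow> x (int ` set s) = g' m s"
        have "[n - 1, n] \<in> cells (horn n n) 1" using n by (auto simp: delta_s_iff intro!: exI[of _ 0])
        then have "x (int ` set [n - 1, n]) = f" using x(2)[of "[n - 1, n]" 1] g'(2) unfolding top by simp
        moreover have "int ` set [n - 1, n] = {int n, int n - 1}" using n by auto
        ultimately have "x {int n, int n - 1} = f" by simp
        show "fills {0..int n} (int n) x"
        proof (rule R[unfolded right_inv_def, rule_format, of "{0..int n}" "int n" "int n - 1" x])
          show "is_map (horn_faces {0..int n} (int n)) x" by (rule x(1))
          have "0 \<in> {0..int n} - {int n, int n - 1}" using n by simp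
          then show "{0..int n} - {int n, int n - 1} \<noteq> {}" by blast
        qed (use n \<open>x {int n, int n - 1} = f\<close> in auto)
      qed simp
    qed (use n g outer_horn_edges(4)[OF n] in auto)
    ultimately show "equivalence_edge X f" using f unfolding equivalence_edge_def by blast
  qed
qed

section \<open>Quasi-unital and marked inner Kan spaces\<close>

lemma face_restr:
  "face X 1 0 = restr X {1} {0, 1}" "face X 1 1 = restr X {0} {0, 1}"
  "face X 2 0 = restr X {1, 2} {0, 1, 2}" "face X 2 1 = restr X {0, 2} {0, 1, 2}" "face X 2 2 = restr X {0, 1} {0, 1, 2}"
proof -
  have V: "{0, 1 :: int} = {0..int 1}" "{0, 1, 2 :: int} = {0..int 2}" by auto
  have d: "[1] \<in> delta_s 0 1" "[0] \<in> delta_s 0 1" "[1, 2] \<in> delta_s 1 2" "[0, 2] \<in> delta_s 1 2" "[0, 1] \<in> delta_s 1 2"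
    by (auto simp: delta_s_iff)
  have i: "incl {1} {0, 1} = [1]" "incl {0} {0, 1} = [0]"
    using incl_interval[OF d(1)] incl_interval[OF d(2)] unfolding V(1)[symmetric] by simp_all
  have j: "incl {1, 2} {0, 1, 2} = [1, 2]" "incl {0, 2} {0, 1, 2} = [0, 2]" "incl {0, 1} {0, 1, 2} = [0, 1]"
    using incl_interval[OF d(3)] incl_interval[OF d(4)] incl_interval[OF d(5)] unfolding V(2)[symmetric] by simp_all
  have c: "coface 1 0 = [1]" "coface 1 1 = [0]" "coface 2 0 = [1, 2]" "coface 2 1 = [0, 2]" "coface 2 2 = [0, 1]"
    by (simp_all add: coface_def upt_rec)
  have k: "card {0, 1 :: int} - 1 = 1" "card {0, 1, 2 :: int} - 1 = 2" by simp_all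
  show "face X 1 0 = restr X {1} {0, 1}" "face X 1 1 = restr X {0} {0, 1}"
    "face X 2 0 = restr X {1, 2} {0, 1, 2}" "face X 2 1 = restr X {0, 2} {0, 1, 2}"
    "face X 2 2 = restr X {0, 1} {0, 1, 2}"
    by (simp_all only: fun_eq_iff face_def restr_def i j c k simp_thms)
qed

lemma pts_simps:
  "pts X {0, 1} = cells (space_at X 1) 0" "pts X {0, 1, 2} = cells (space_at X 2) 0"
  "pts X {0, 1, 2, 3} = cells (space_at X 3) 0" "pts X {v} = cells (space_at X 0) 0"
  by (simp_all add: pts_def eval_nat_numeral)

lemma simplex_map:
  assumes F: "ss_functor X" and z: "z \<in> cells (space_at X n) 0"
  shows "\<exists>h\<in>cells (map_space (simplex n) X) 0. \<forall>m. \<forall>s\<in>delta_s m n. h m s = pull X n s 0 z"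
proof
  let ?h = "\<lambda>m s. if s \<in> delta_s m n then pull X n s 0 z else undefined"
  show "?h \<in> cells (map_space (simplex n) X) 0"
    using ss_functorD(3,5)[OF F] z comp_op_delta_s(1) by (auto simp: map_space_cells)
qed simp

lemma equivalence_edge_same_component:
  assumes e: "equivalence_edge X e" and ee': "same_component (space_at X 1) e e'"
  shows "equivalence_edge X e'"
proof -
  have "e' \<in> cells (space_at X 1) 0" using ee' by (simp add: same_component_def)
  moreover have "same_component (space_at X 1) a e' \<Longrightarrow> same_component (space_at X 1) a e" for a
    using same_component_sym[OF ee'] by (rule same_component_trans[rotated])
  ultimately show ?thesis using e unfolding equivalence_edge_def by blast
qed

lemma vertex_horn:
  assumes "c = 0 \<or> c = (1::nat)"
  shows "s \<in> cells (horn 1 c) m \<longleftrightarrow> s = [c] \<and> m = 0"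
proof
  assume "s \<in> cells (horn 1 c) m"
  then have s: "s \<in> delta_s m 1" "set s \<subseteq> {c}" using assms
    by (auto simp: delta_s_iff subset_iff le_Suc_eq)
  moreover have "set s \<noteq> {}" using s(1) by (auto simp: delta_s_iff)
  ultimately have "set s = set [c]" using subset_singletonD[of "set s" c] by simp
  moreover have c: "[c] \<in> delta_s 0 1" using assms by (auto simp: delta_s_iff)
  ultimately have "s = [c]" using delta_s_unique[OF s(1) c] by simp
  then show "s = [c] \<and> m = 0" using s(1) by (simp add: delta_s_iff)
next
  assume "s = [c] \<and> m = 0"
  then show "s \<in> cells (horn 1 c) m" using assms by (auto simp: delta_s_iff intro!: exI[of _ "1 - c"])
qed

text \<open>
  The equivalence \<open>f\<close> ends or starts only up to homotopy at the prescribed vertex.  Moving its endpoint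
  along a path drags \<open>f\<close> to an edge in the same component, which is again an equivalence.
\<close>

lemma edge_into_vertex:
  assumes X: "semisimplicial_space X" and c: "c = 0 \<or> c = (1::nat)"
    and f: "equivalence_edge X f" "same_component (space_at X 0) (face X 1 (1 - c) f) (u 0 [c])"
    and u: "u \<in> cells (map_space (horn 1 c) X) 0"
  shows "\<exists>h\<in>cells (map_space (simplex 1) X) 0. restrict_map (horn 1 c) h = u \<and> equivalence_edge X (h 1 [0, 1])"
proof -
  have F: "ss_functor X" using X by (simp add: semisimplicial_space_def)
  have fX: "f \<in> cells (space_at X 1) 0" using f(1) by (simp add: equivalence_edge_def)
  obtain h0 where h0: "h0 \<in> cells (map_space (simplex 1) X) 0" "\<And>m s. s \<in> delta_s m 1 \<Longrightarrow> h0 m s = pull X 1 s 0 f"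
    using simplex_map[OF F fX] by blast
  have d: "[0, 1] \<in> delta_s 1 1" "[c] \<in> delta_s 0 1" using c by (auto simp: delta_s_iff)
  have "[0, 1] = ident 1" by (simp add: ident_def)
  then have h0f: "h0 1 [0, 1] = f" using h0(2)[OF d(1)] ss_functorD(4)[OF F fX] by simp
  have "coface 1 (1 - c) = [c]" using c by (auto simp: coface_def)
  then have "h0 0 [c] = face X 1 (1 - c) f" using h0(2)[OF d(2)] by (simp add: face_def)
  then have "same_component (space_at X 0) (h0 0 [c..<Suc (c + 0)]) (u 0 [c])" using f(2) by simp
  moreover have "c + 0 \<le> 1" using c by auto
  moreover have "cells (interval_complex 1 c 0) m \<subseteq> cells (simplex 1) m" for m by auto
  ultimately obtain h where h: "h \<in> cells (map_space (simplex 1) X) 0" "h 0 [c..<Suc (c + 0)] = u 0 [c]"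
    "same_component (map_space (simplex 1) X) h0 h"
    using move_interval[OF X face_complex_simplex _ _ h0(1), of c 0 "u 0 [c]"] by blast
  have "same_component (space_at X 1) (h0 1 [0, 1]) (h 1 [0, 1])"
    using F h(3) by (rule same_component_eval) (use d in simp)
  then have "equivalence_edge X (h 1 [0, 1])" using equivalence_edge_same_component f(1) h0f by metis
  moreover have "restrict_map (horn 1 c) h = u"
  proof (intro ext)
    fix m s
    show "restrict_map (horn 1 c) h m s = u m s"
      using h(2) map_spaceD(2)[OF u, of s m] unfolding restrict_map_def vertex_horn[OF c] by auto
  qed
  ultimately show ?thesis using h(1) by blast
qed

lemma strict_idempotent_edge_at:
  assumes F: "ss_functor X" and kan: "inner_kan_system (pts X) (restr X)"
    and e: "inner_kan_system.strict_idempotent (pts X) (restr X) e"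
  shows "idempotent_edge X e" "face X 1 0 e = face X 1 1 e" "face X 1 0 e \<in> cells (space_at X 0) 0"
proof -
  interpret inner_kan_system "pts X" "restr X" by (rule kan)
  note se = strict_idempotent_edge[OF e]
  show eq: "face X 1 0 e = face X 1 1 e" using se(2) by (simp add: face_restr[simplified])
  have "restr X {1} {0, 1} e \<in> pts X {1}" using se(1) by (intro res_in) auto
  then show c: "face X 1 0 e \<in> cells (space_at X 0) 0" unfolding face_restr pts_simps .
  obtain G where G: "G \<in> pts X {0, 1, 2}" "d0 G = e" "d1 G = e" "d2 G = e"
    using e unfolding strict_idempotent_def by blast
  have eX: "e \<in> cells (space_at X 1) 0" using se(1) unfolding pts_simps .
  have "face X 2 i G = e" if "i \<le> 2" for i
  proof -
    have "i = 0 \<or> i = 1 \<or> i = 2" using that by auto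
    then show ?thesis using G face_restr(3-5)[of X] by auto
  qed
  then have "\<forall>i\<le>2. same_component (space_at X 1) (face X 2 i G) e" using same_component_refl[OF eX] by simp
  moreover have "same_component (space_at X 0) (face X 1 0 e) (face X 1 1 e)"
    using same_component_refl[OF c] unfolding eq .
  ultimately show "idempotent_edge X e"
    unfolding idempotent_edge_def using eX G(1) unfolding pts_simps by blast
qed

text \<open>
  Inner and outer horns of dimension at least two have fillers by the definitions.  Idempotent
  equivalences provide the edges for the horns in \<open>\<Delta>\<^sup>1\<close>, and \<open>S_two_six\<close> is two out of six.
\<close>

lemma marked_inner_kan_if_quasi_unital:
  assumes X: "semisimplicial_space X" and qu: "quasi_unital_inner_kan X"
  shows "marked_inner_kan (natural_marking X)"
proof -
  have F: "ss_functor X" using X by (simp add: semisimplicial_space_def)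
  have kan: "inner_kan X" using qu by (simp add: quasi_unital_inner_kan_def)
  interpret inner_kan_system "pts X" "restr X" using X kan by (rule inner_kan_system_pts)
  let ?Z = "natural_marking X"
  have Z: "fst ?Z = X" "e \<in> snd ?Z \<longleftrightarrow> equivalence_edge X e" for e by (simp_all add: natural_marking_def)
  have FZ: "ss_functor (fst ?Z)" using F Z by simp
  have marked: "marked_ssspace ?Z"
    unfolding marked_ssspace_def Z
  proof (intro conjI ballI allI impI subsetI)
    fix e e' assume e: "e \<in> snd ?Z" "same_component (space_at X 1) e e'"
    then show "equivalence_edge X e'"
      unfolding Z by (rule equivalence_edge_same_component)
  qed (use X in \<open>simp_all add: Z equivalence_edge_def\<close>)
  have horn: "marked_rlp A B ?Z (sharp terminal_ss) to_terminal"
    if AB: "(A, B) = marked_horn_inclusion n i E" and E: "E \<subseteq> cells (simplex n) 1"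
      and fill: "\<And>u. u \<in> cells (map_space (horn n i) X) 0 \<Longrightarrow>
        (\<And>e. e \<in> E \<Longrightarrow> e \<in> cells (horn n i) 1 \<Longrightarrow> equivalence_edge X (u 1 e)) \<Longrightarrow>
        \<exists>h\<in>cells (map_space (simplex n) X) 0. restrict_map (horn n i) h = u \<and> (\<forall>e\<in>E. equivalence_edge X (h 1 e))"
    for A B n i E
  proof -
    have AB': "A = (horn n i, E \<inter> cells (horn n i) 1)" "B = (simplex n, E)"
      using AB by (simp_all add: marked_horn_inclusion_def)
    have fA: "face_complex n (fst A)" using face_complex_horn AB' by simp
    have cA: "u \<in> cells (marked_map_space A ?Z) 0 \<longleftrightarrow> u \<in> cells (map_space (horn n i) X) 0 \<and>
      (\<forall>e\<in>E \<inter> cells (horn n i) 1. equivalence_edge X (u 1 e))" for u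
      using marked_map_space_cells[OF FZ, of A u] unfolding AB' Z by simp
    have cB: "h \<in> cells (marked_map_space B ?Z) 0 \<longleftrightarrow> h \<in> cells (map_space (simplex n) X) 0 \<and>
      (\<forall>e\<in>E. equivalence_edge X (h 1 e))" for h
      using marked_map_space_cells[OF FZ, of B h] E unfolding AB' Z by simp
    show ?thesis
    proof (rule marked_rlp_terminalI[OF FZ fA])
      fix u assume "u \<in> cells (marked_map_space A ?Z) 0"
      then have um: "u \<in> cells (map_space (horn n i) X) 0"
        and ue: "\<forall>e\<in>E \<inter> cells (horn n i) 1. equivalence_edge X (u 1 e)"
        unfolding cA by blast+
      have "equivalence_edge X (u 1 e)" if "e \<in> E" "e \<in> cells (horn n i) 1" for e
        using ue that by blast
      with um have "\<exists>h\<in>cells (map_space (simplex n) X) 0. restrict_map (horn n i) h = u \<and> (\<forall>e\<in>E. equivalence_edge X (h 1 e))"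
        by (rule fill)
      then obtain h where h: "h \<in> cells (map_space (simplex n) X) 0" "restrict_map (horn n i) h = u"
        "\<forall>e\<in>E. equivalence_edge X (h 1 e)" by blast
      have "h \<in> cells (marked_map_space B ?Z) 0" unfolding cB using h(1,3) by (rule conjI)
      moreover have "restrict_map (fst A) h = u" using h(2) AB'(1) by simp
      ultimately show "\<exists>h\<in>cells (marked_map_space B ?Z) 0. restrict_map (fst A) h = u" by (intro bexI[of _ h])
    qed
  qed
  have unit: "\<exists>f. equivalence_edge X f \<and> same_component (space_at X 0) (face X 1 j f) x"
    if "x \<in> cells (space_at X 0) 0" "j = 0 \<or> j = 1" for x j
  proof -
    have "\<forall>x\<in>cells (space_at X 0) 0. \<exists>f. idempotent_edge_at X x f \<and> equivalence_edge X f"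
      using qu unfolding quasi_unital_inner_kan_def by (rule conjunct2)
    from bspec[OF this that(1)] obtain f where f: "idempotent_edge_at X x f" "equivalence_edge X f"
      by (elim exE conjE)
    have "same_component (space_at X 0) (face X 1 0 f) x" "same_component (space_at X 0) (face X 1 1 f) x"
      using f(1) unfolding idempotent_edge_at_def by simp_all
    then have "same_component (space_at X 0) (face X 1 j f) x" using that(2) by (elim disjE) (simp_all only:)
    then show ?thesis using f(2) by (intro exI[of _ f] conjI)
  qed
  have outer: "\<exists>h\<in>cells (map_space (simplex n) X) 0. restrict_map (horn n i) h = u \<and> (\<forall>e\<in>{t}. equivalence_edge X (h 1 e))"
    if n: "1 \<le> n" and it: "i = 0 \<and> t = [0, 1] \<or> i = n \<and> t = [n - 1, n]" and u: "u \<in> cells (map_space (horn n i) X) 0"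
      and eq: "t \<in> cells (horn n i) 1 \<Longrightarrow> equivalence_edge X (u 1 t)" for n i t u
  proof (cases "n = 1")
    case True
    then have i: "i = 0 \<or> i = 1" "t = [0, 1]" using it by auto
    have u1: "u \<in> cells (map_space (horn 1 i) X) 0" using u unfolding True .
    have "[i] \<in> cells (horn 1 i) 0" unfolding vertex_horn[OF i(1)] by blast
    then have "u 0 [i] \<in> cells (space_at X 0) 0" using map_spaceD(1)[OF u1] by blast
    moreover have "1 - i = 0 \<or> 1 - i = 1" using i(1) by auto
    ultimately have "\<exists>f. equivalence_edge X f \<and> same_component (space_at X 0) (face X 1 (1 - i) f) (u 0 [i])"
      by (rule unit)
    then obtain f where f: "equivalence_edge X f" "same_component (space_at X 0) (face X 1 (1 - i) f) (u 0 [i])"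
      by (elim exE conjE)
    show ?thesis using edge_into_vertex[OF X i(1) f u1] unfolding True i(2) by simp
  next
    case False
    then have n2: "2 \<le> n" using n by simp
    have t: "t \<in> cells (horn n i) 1"
      using it n2 by (auto simp: delta_s_iff intro: exI[of _ 2] exI[of _ 0])
    have f: "equivalence_edge X (u 1 t)" using eq[OF t] .
    have "same_component (space_at X 1) (u 1 t) (u 1 t)"
      using f by (intro same_component_refl) (simp add: equivalence_edge_def)
    then have "extends_up_to_homotopy (horn n i) (simplex n) X u"
      using it f n2 u unfolding equivalence_edge_def by blast
    then obtain h where h: "h \<in> cells (map_space (simplex n) X) 0" "restrict_map (horn n i) h = u"
      using horn_fills_iff_extends[OF X] unfolding horn_fills_def by blast
    have "h 1 t = u 1 t" unfolding h(2)[symmetric] restrict_map_def using t by (rule if_P[symmetric])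
    then show ?thesis using h f by auto
  qed
  have "marked_rlp A B ?Z (sharp terminal_ss) to_terminal" if J: "(A, B) \<in> J_JL" for A B
  proof -
    consider n i where "0 < i" "i < n" "(A, B) = marked_horn_inclusion n i {}"
      | n where "1 \<le> n" "(A, B) = marked_horn_inclusion n 0 {[0, 1]}"
      | n where "1 \<le> n" "(A, B) = marked_horn_inclusion n n {[n - 1, n]}"
      | "(A, B) = S_two_six"
      using J unfolding J_JL_def admissible_horn_inclusions_def by blast
    then show ?thesis
    proof cases
      case 1
      show ?thesis
        using 1(3)
      proof (rule horn)
        fix u assume "u \<in> cells (map_space (horn n i) X) 0"
        then have "horn_fills X n i u" using kan 1(1,2) unfolding inner_kan_iff[OF X] by blast
        then show "\<exists>h\<in>cells (map_space (simplex n) X) 0. restrict_map (horn n i) h = u \<and>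
          (\<forall>e\<in>{}. equivalence_edge X (h 1 e))"
          unfolding horn_fills_def by simp
      qed simp
    next
      case 2
      show ?thesis
        using 2(2)
      proof (rule horn)
        show "{[0, 1]} \<subseteq> cells (simplex n) 1" using 2 by (auto simp: delta_s_iff)
      qed (rule outer; use 2 in simp)
    next
      case 3
      show ?thesis
        using 3(2)
      proof (rule horn)
        show "{[n - 1, n]} \<subseteq> cells (simplex n) 1" using 3 by (auto simp: delta_s_iff)
      qed (rule outer; use 3 in simp)
    next
      case 4
      then have AB: "A = (simplex 3, {[0, 2], [1, 3]})" "B = (simplex 3, cells (simplex 3) 1)"
        by (simp_all add: S_two_six_def)
      show ?thesis
      proof (rule marked_rlp_terminalI[OF FZ])
        show "face_complex 3 (fst A)" using AB face_complex_simplex by simp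
        fix u assume u: "u \<in> cells (marked_map_space A ?Z) 0"
        have sA: "snd A \<subseteq> cells (fst A) 1" and sB: "snd B \<subseteq> cells (fst B) 1"
          unfolding AB by (auto simp: delta_s_iff)
        have um: "u \<in> cells (map_space (simplex 3) X) 0" "equivalence_edge X (u 1 [0, 2])" "equivalence_edge X (u 1 [1, 3])"
          using u unfolding marked_map_space_cells[OF FZ sA] Z by (simp_all add: AB)
        define z where "z = u 3 (ident 3)"
        have z: "z \<in> pts X {0, 1, 2, 3}"
          using map_spaceD(1)[OF um(1), of "ident 3" 3] ident_delta_s[of 3] by (simp add: z_def pts_simps)
        have V: "{0, 1, 2, 3} = {0..int 3}" by auto
        have res: "restr X (int ` set s) {0, 1, 2, 3} z = u m s" if s: "s \<in> delta_s m 3" for m s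
        proof -
          have "u m (act (simplex 3) 3 s (ident 3)) = pull X 3 s 0 z"
            using map_spaceD(3)[OF um(1) s, of "ident 3"] ident_delta_s[of 3] by (simp add: z_def)
          then show ?thesis
            using comp_op_ident(1)[OF s] incl_interval[OF s] unfolding V restr_def by simp
        qed
        have inv: "invertible g \<longleftrightarrow> equivalence_edge X g" if "g \<in> cells (space_at X 1) 0" for g
          using equivalence_edge_iff[OF X] that by (simp add: invertible_def)
        have d: "[0, 2] \<in> delta_s 1 3" "[1, 3] \<in> delta_s 1 3" by (auto simp: delta_s_iff)
        have uX: "u 1 s \<in> cells (space_at X 1) 0" if "s \<in> delta_s 1 3" for s
          using map_spaceD(1)[OF um(1)] that by simp
        have i: "invertible (restr X {0, 2} {0, 1, 2, 3} z)" "invertible (restr X {1, 3} {0, 1, 2, 3} z)"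
          using res[OF d(1)] res[OF d(2)] inv[OF uX[OF d(1)]] inv[OF uX[OF d(2)]] um(2,3) by simp_all
        have "equivalence_edge X (u 1 s)" if s: "s \<in> delta_s 1 3" for s
        proof -
          obtain p q where pq: "s = [p, q]" "p < q" "q \<le> 3"
            using s by (auto simp: delta_s_iff length_Suc_conv)
          have "int p \<in> {0, 1, 2, 3}" "int q \<in> {0, 1, 2, 3}" "int p < int q" using pq(2,3) by auto
          then have "invertible (restr X {int p, int q} {0, 1, 2, 3} z)"
            using invertible_two_of_six[OF z i] by blast
          then show ?thesis using res[OF s] inv[OF uX[OF s]] pq(1) by simp
        qed
        then have "u \<in> cells (marked_map_space B ?Z) 0"
          unfolding marked_map_space_cells[OF FZ sB] Z using um(1) by (simp add: AB)
        moreover have "restrict_map (fst A) u = u"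
          using map_spaceD(2)[OF um(1)] by (intro ext) (simp add: AB restrict_map_def)
        ultimately show "\<exists>h\<in>cells (marked_map_space B ?Z) 0. restrict_map (fst A) h = u" by blast
      qed
    qed
  qed
  then show ?thesis using marked unfolding marked_inner_kan_def by blast
qed

lemma equivalence_edge_iff_invertible:
  assumes X: "semisimplicial_space X" and kan: "inner_kan X"
  shows "equivalence_edge X f \<longleftrightarrow> f \<in> pts X {0, 1} \<and> inner_kan_system.invertible (pts X) (restr X) f"
proof -
  interpret inner_kan_system "pts X" "restr X" using X kan by (rule inner_kan_system_pts)
  show ?thesis using equivalence_edge_iff[OF X] unfolding pts_simps invertible_def by blast
qed

text \<open>
  Lifting against \<open>\<Lambda>\<^sup>1\<^sub>0\<close> yields an equivalence whose source is homotopic to \<open>x\<close>; dividing it by itself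
  gives an idempotent equivalence at that source.
\<close>

lemma quasi_unital_if_marked_inner_kan:
  assumes X: "semisimplicial_space X" and M: "marked_inner_kan (natural_marking X)"
  shows "quasi_unital_inner_kan X"
proof -
  have F: "ss_functor X" using X by (simp add: semisimplicial_space_def)
  let ?Z = "natural_marking X"
  have Z: "fst ?Z = X" "e \<in> snd ?Z \<longleftrightarrow> equivalence_edge X e" for e by (simp_all add: natural_marking_def)
  have FZ: "ss_functor (fst ?Z)" using F Z by simp
  have rlp: "marked_rlp A B ?Z (sharp terminal_ss) to_terminal" if "(A, B) \<in> admissible_horn_inclusions" for A B
    using M that unfolding marked_inner_kan_def J_JL_def by blast
  have lift: "\<exists>h\<in>cells (map_space (simplex n) X) 0. (\<forall>e\<in>E. equivalence_edge X (h 1 e)) \<and>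
      same_component (map_space (horn n i) X) (restrict_map (horn n i) h) u"
    if adm: "marked_horn_inclusion n i E \<in> admissible_horn_inclusions" and E: "E \<subseteq> cells (simplex n) 1"
      and u: "u \<in> cells (map_space (horn n i) X) 0" and uE: "E \<inter> cells (horn n i) 1 = {}" for n i E u
  proof -
    let ?A = "(horn n i, E \<inter> cells (horn n i) 1)" and ?B = "(simplex n, E)"
    have AB: "(?A, ?B) \<in> admissible_horn_inclusions" using adm by (simp only: marked_horn_inclusion_def)
    have fA: "face_complex n (fst ?A)" using face_complex_horn by simp
    have sA: "snd ?A \<subseteq> cells (fst ?A) 1" and sB: "snd ?B \<subseteq> cells (fst ?B) 1" using E by simp_all
    have "u \<in> cells (marked_map_space ?A ?Z) 0"
      unfolding marked_map_space_cells[OF FZ sA] using u uE unfolding Z by simp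
    from marked_rlp_terminalD[OF FZ fA rlp[OF AB] this]
    obtain h where h: "h \<in> cells (marked_map_space ?B ?Z) 0"
      "same_component (map_space (horn n i) X) (restrict_map (horn n i) h) u" unfolding Z fst_conv by blast
    have "h \<in> cells (map_space (simplex n) X) 0" "\<forall>e\<in>E. equivalence_edge X (h 1 e)"
      using h(1) unfolding marked_map_space_cells[OF FZ sB] Z fst_conv snd_conv by simp_all
    then show ?thesis using h(2) by blast
  qed
  have kan: "inner_kan X"
    unfolding inner_kan_iff[OF X]
  proof (intro allI ballI impI)
    fix n i g assume g: "g \<in> cells (map_space (horn n i) X) 0" and i: "0 < i" "i < n"
    have "marked_horn_inclusion n i {} \<in> admissible_horn_inclusions"
      using i unfolding admissible_horn_inclusions_def by blast
    from lift[OF this _ g] have "extends_up_to_homotopy (horn n i) (simplex n) X g"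
      unfolding extends_up_to_homotopy_def by blast
    then show "horn_fills X n i g" using horn_fills_iff_extends[OF X] by blast
  qed
  interpret inner_kan_system "pts X" "restr X" using X kan by (rule inner_kan_system_pts)
  note eqv = equivalence_edge_iff_invertible[OF X kan]
  have unit: "\<exists>e. idempotent_edge_at X x e \<and> equivalence_edge X e" if x: "x \<in> cells (space_at X 0) 0" for x
  proof -
    define u where "u m s = (if s = [0] \<and> m = 0 then x else undefined)" for m :: nat and s :: "nat list"
    have vh: "s \<in> cells (horn 1 0) m \<longleftrightarrow> s = [0] \<and> m = 0" for s m by (rule vertex_horn) simp
    have u: "u \<in> cells (map_space (horn 1 0) X) 0"
      unfolding map_space_cells vh
    proof (intro conjI allI ballI impI)
      fix l m \<alpha> s assume \<alpha>: "\<alpha> \<in> delta_s l m" and s: "s \<in> cells (horn 1 0) m"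
      have s0: "s = [0]" "m = 0" using s unfolding vh by simp_all
      have "act (horn 1 0) m \<alpha> s \<in> cells (horn 1 0) l" using face_complexD(2,3)[OF face_complex_horn s \<alpha>] by simp
      then have "act (horn 1 0) m \<alpha> s = [0]" "l = 0" unfolding vh by simp_all
      moreover have "\<alpha> = ident 0" using \<alpha> s0 \<open>l = 0\<close> delta_s_top by simp
      ultimately show "u l (act (horn 1 0) m \<alpha> s) = pull X m \<alpha> 0 (u m s)"
        using s0 ss_functorD(4)[OF F x] by (simp add: u_def)
    next
      fix m s assume "s \<in> cells (horn 1 0) m"
      then have "s = [0] \<and> m = 0" unfolding vh .
      then show "u m s \<in> cells (space_at X m) 0" using x by (simp add: u_def)
    next
      fix m :: nat and s :: "nat list" assume "\<not> (s = [0] \<and> m = 0)"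
      then show "u m s = undefined" unfolding u_def by (rule if_not_P)
    qed
    have adm: "marked_horn_inclusion 1 0 {[0, 1]} \<in> admissible_horn_inclusions"
      unfolding admissible_horn_inclusions_def by blast
    have "{[0, 1]} \<subseteq> cells (simplex 1) 1" by (auto simp: delta_s_iff)
    moreover have "{[0, 1]} \<inter> cells (horn 1 0) 1 = {}" using vh by blast
    ultimately obtain h where h: "h \<in> cells (map_space (simplex 1) X) 0" "equivalence_edge X (h 1 [0, 1])"
      "same_component (map_space (horn 1 0) X) (restrict_map (horn 1 0) h) u"
      using lift[OF adm _ u] by blast
    have d: "[0, 1] \<in> delta_s 1 1" "[0] \<in> delta_s 0 1" by (auto simp: delta_s_iff)
    have v0: "[0] \<in> cells (horn 1 0) 0" unfolding vh by simp
    have "same_component (space_at X 0) (restrict_map (horn 1 0) h 0 [0]) (u 0 [0])"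
      using F h(3) v0 by (rule same_component_eval)
    then have hx: "same_component (space_at X 0) (h 0 [0]) x"
      unfolding restrict_map_def if_P[OF v0] by (simp add: u_def)
    let ?f = "h 1 [0, 1]"
    have "coface 1 1 = [0]" by (simp add: coface_def)
    then have "face X 1 1 ?f = h 0 [0]"
      using map_spaceD(3)[OF h(1) d(2), of "[0, 1]"] d(1) by (simp add: face_def comp_op_def)
    then have srcf: "same_component (space_at X 0) (src ?f) x" using hx unfolding face_restr by simp
    have f: "?f \<in> pts X {0, 1}" "invertible ?f" using h(2) unfolding eqv by simp_all
    obtain e where e: "invertible e" "strict_idempotent e" "src e = src ?f" using units_from_invertible(1)[OF f] by blast
    note ie = strict_idempotent_edge_at[OF F inner_kan_system_axioms e(2)]
    have "same_component (space_at X 0) (face X 1 1 e) x" using srcf e(3) unfolding face_restr by simp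
    then have "idempotent_edge_at X x e" using ie(1,2) unfolding idempotent_edge_at_def by simp
    moreover have "equivalence_edge X e" unfolding eqv using e(1) strict_idempotent_edge(1)[OF e(2)] by simp
    ultimately show ?thesis by blast
  qed
  show ?thesis unfolding quasi_unital_inner_kan_def using kan unit by blast
qed

section \<open>Quasi-unital maps\<close>

lemma ss_mapD:
  assumes "ss_map X Y F"
  shows "simplicial_map (space_at X n) (space_at Y n) (F n)"
    and "\<alpha> \<in> delta_s m n \<Longrightarrow> x \<in> cells (space_at X n) k \<Longrightarrow> F m k (pull X n \<alpha> k x) = pull Y n \<alpha> k (F n k x)"
  using assms unfolding ss_map_def by blast+

lemma coface_delta_s: "i \<le> Suc n \<Longrightarrow> coface (Suc n) i \<in> delta_s n (Suc n)"
proof -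
  assume i: "i \<le> Suc n"
  have "set (coface (Suc n) i) = {..Suc n} - {i}" by (auto simp: coface_def)
  moreover have "distinct (coface (Suc n) i)" "sorted (coface (Suc n) i)"
    by (auto simp: coface_def intro: sorted_wrt_filter simp del: upt_Suc)
  ultimately show ?thesis using i distinct_card[of "coface (Suc n) i"] by (auto simp: delta_s_def delta_def)
qed

lemma idempotent_edge_map:
  assumes X: "ss_functor X" and F: "ss_map X Y F" and f: "idempotent_edge X f"
  shows "idempotent_edge Y (F 1 0 f)"
proof -
  have comp: "same_component (space_at Y n) (F n 0 a) (F n 0 b)" if "same_component (space_at X n) a b" for n a b
    using ss_mapD(1)[OF F] ss_functorD(1)[OF X] that by (rule same_component_simplicial_map)
  have faceF: "face Y (Suc n) i (F (Suc n) 0 x) = F n 0 (face X (Suc n) i x)"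
    if "x \<in> cells (space_at X (Suc n)) 0" "i \<le> Suc n" for n i x
    using ss_mapD(2)[OF F coface_delta_s[OF that(2)] that(1)] by (simp add: face_def)
  have cell: "F n 0 x \<in> cells (space_at Y n) 0" if "x \<in> cells (space_at X n) 0" for n x
    using simplicial_mapD(1)[OF ss_mapD(1)[OF F]] that by blast
  obtain H where fX: "f \<in> cells (space_at X 1) 0" and d: "same_component (space_at X 0) (face X 1 0 f) (face X 1 1 f)"
    and H: "H \<in> cells (space_at X 2) 0" "\<And>i. i \<le> 2 \<Longrightarrow> same_component (space_at X 1) (face X 2 i H) f"
    using f unfolding idempotent_edge_def by blast
  have "same_component (space_at Y 0) (face Y 1 0 (F 1 0 f)) (face Y 1 1 (F 1 0 f))"
    using comp[OF d] faceF[of f 0 0] faceF[of f 0 1] fX by simp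
  moreover have "same_component (space_at Y 1) (face Y 2 i (F 2 0 H)) (F 1 0 f)" if "i \<le> 2" for i
    using comp[OF H(2)[OF that]] faceF[of H 1 i] H(1) that by (simp add: numeral_2_eq_2)
  ultimately show ?thesis unfolding idempotent_edge_def using cell[OF fX] cell[OF H(1)] by blast
qed

lemma restr_map:
  assumes F: "ss_map X Y F" and V: "finite V" "U \<subseteq> V" "U \<noteq> {}" and z: "z \<in> pts X V"
  shows "restr Y U V (F (card V - 1) 0 z) = F (card U - 1) 0 (restr X U V z)"
  using ss_mapD(2)[OF F incl_delta_s[OF V]] z by (simp add: restr_def pts_def)

text \<open>
  The map preserves the two unit edges of the 3-simplex around \<open>f\<close>; two out of six then applies to its
  image in \<open>Y\<close>.
\<close>

lemma quasi_unital_map_preserves_equivalences: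
  assumes X: "semisimplicial_space X" "inner_kan X" and Y: "semisimplicial_space Y" "inner_kan Y"
    and F: "quasi_unital_map X Y F" and f: "equivalence_edge X f"
  shows "equivalence_edge Y (F 1 0 f)"
proof -
  have FX: "ss_functor X" and map: "ss_map X Y F"
    using X(1) F by (simp_all add: semisimplicial_space_def quasi_unital_map_def)
  interpret IX: inner_kan_system "pts X" "restr X" using X by (rule inner_kan_system_pts)
  interpret IY: inner_kan_system "pts Y" "restr Y" using Y by (rule inner_kan_system_pts)
  note eX = equivalence_edge_iff_invertible[OF X] and eY = equivalence_edge_iff_invertible[OF Y]
  let ?V = "{0, 1, 2, 3 :: int}"
  have "f \<in> pts X {0, 1}" "IX.invertible f" using f unfolding eX by simp_all
  then obtain z where z: "z \<in> pts X ?V" "restr X {1, 2} ?V z = f"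
    and units: "\<And>e. e \<in> {restr X {0, 2} ?V z, restr X {1, 3} ?V z} \<Longrightarrow> IX.invertible e \<and> IX.strict_idempotent e"
    using IX.invertible_between_units by blast
  let ?w = "F 3 0 z"
  have w: "?w \<in> pts Y ?V"
    using simplicial_mapD(1)[OF ss_mapD(1)[OF map]] z(1) unfolding pts_simps by blast
  have edge: "restr Y {a, b} ?V ?w = F 1 0 (restr X {a, b} ?V z)" if "{a, b} \<subseteq> ?V" "a \<noteq> b" for a b
    using restr_map[OF map _ that(1) _ z(1)] that(2) by (simp add: numeral_3_eq_3)
  have "IY.invertible (F 1 0 e)" if e: "e \<in> {restr X {0, 2} ?V z, restr X {1, 3} ?V z}" for e
  proof -
    have i: "IX.invertible e" "IX.strict_idempotent e" using units[OF e] by simp_all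
    then have "equivalence_edge X e" unfolding eX using IX.strict_idempotent_edge(1) by simp
    moreover have "idempotent_edge X e"
      using FX IX.inner_kan_system_axioms i(2) by (rule strict_idempotent_edge_at)
    ultimately have "equivalence_edge Y (F 1 0 e)" using F unfolding quasi_unital_map_def by blast
    then show ?thesis unfolding eY by simp
  qed
  then have "IY.invertible (restr Y {0, 2} ?V ?w)" "IY.invertible (restr Y {1, 3} ?V ?w)"
    using edge[of 0 2] edge[of 1 3] by simp_all
  then have "IY.invertible (restr Y {1, 2} ?V ?w)"
    using IY.invertible_two_of_six[OF w, of 1 2] by simp
  moreover have "restr Y {1, 2} ?V ?w = F 1 0 f" using edge[of 1 2] z(2) by simp
  moreover have "restr Y {1, 2} ?V ?w \<in> pts Y {1, 2}" using w by (intro IY.res_in) auto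
  then have "restr Y {1, 2} ?V ?w \<in> pts Y {0, 1}" using IY.edge_standard(1)[of 1 2] by simp
  ultimately show ?thesis unfolding eY by simp
qed

theorem theorem1p1:
  shows "(\<forall>X :: 'a ssspace. semisimplicial_space X \<longrightarrow>
            (quasi_unital_inner_kan X \<longleftrightarrow> marked_inner_kan (natural_marking X))) \<and>
         (\<forall>(X :: 'b ssspace) (Y :: 'c ssspace) F.
            semisimplicial_space X \<longrightarrow> quasi_unital_inner_kan X \<longrightarrow>
            semisimplicial_space Y \<longrightarrow> quasi_unital_inner_kan Y \<longrightarrow>
            ss_map X Y F \<longrightarrow>
            (quasi_unital_map X Y F \<longleftrightarrow> marked_map (natural_marking X) (natural_marking Y) F))"
proof (intro conjI allI impI)
  fix X :: "'a ssspace" assume "semisimplicial_space X"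
  then show "quasi_unital_inner_kan X \<longleftrightarrow> marked_inner_kan (natural_marking X)"
    using marked_inner_kan_if_quasi_unital quasi_unital_if_marked_inner_kan by blast
next
  fix X :: "'b ssspace" and Y :: "'c ssspace" and F
  assume X: "semisimplicial_space X" "quasi_unital_inner_kan X" and Y: "semisimplicial_space Y" "quasi_unital_inner_kan Y"
    and F: "ss_map X Y F"
  have kan: "inner_kan X" "inner_kan Y" using X(2) Y(2) by (simp_all add: quasi_unital_inner_kan_def)
  have FX: "ss_functor X" using X(1) by (simp add: semisimplicial_space_def)
  have "marked_map (natural_marking X) (natural_marking Y) F \<longleftrightarrow>
    (\<forall>f. equivalence_edge X f \<longrightarrow> equivalence_edge Y (F 1 0 f))"
    using F by (simp add: marked_map_def natural_marking_def)
  then show "quasi_unital_map X Y F \<longleftrightarrow> marked_map (natural_marking X) (natural_marking Y) F"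
    using quasi_unital_map_preserves_equivalences[OF X(1) kan(1) Y(1) kan(2)] idempotent_edge_map[OF FX F] F
    unfolding quasi_unital_map_def by blast
qed

end
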